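(* Each of the 600-cell, the 120-cell and Gosset's polytope $4_{21}$ has fifteen-fold parity proofs consisting of exactly fifteen bases (a single orbit of bases under the fifteen-fold rotation $g$). The number of such proofs is exactly 2 for the 600-cell, 4 for the 120-cell, and 16 for Gosset's polytope.
   Context: The 600-cell $\{3,3,5\}$ and 120-cell $\{5,3,3\}$ are the regular polytopes in $\mathbb{R}^4$ with 120 and 600 vertices, and Gosset's polytope $4_{21}$ is the uniform polytope in $\mathbb{R}^8$ whose 240 vertices are the roots of $E_8$; all are centered at the origin. A ray is an undirected line through the origin and a pair of antipodal vertices (so there are 60, 300 and 120 rays, respectively). A basis is a set of $N$ mutually orthogonal rays of the polytope, where $N=4$ for the 600-cell and the 120-cell and $N=8$ for Gosset's polytope (there are 75, 675 and 2025 bases, respectively). The triacontagonal projection is the orthogonal projection of the polytope to a plane (the Coxeter plane of its symmetry group $H_4$, $H_4$, or $E_8$) in which the vertices lie on concentric regular 30-gons. Let $g$ be the orthogonal symmetry of the polytope that preserves this plane and rotates it by $24^\circ$, namely the square of the Coxeter element that rotates the plane by $12^\circ$; since the 15th power of the Coxeter element is $-1$, $g$ has order 15 on rays and generates the same group of permutations of the rays as the Coxeter element. A parity proof is a set of bases of the polytope consisting of an odd number of bases such that each ray occurs in an even number (possibly zero) of the bases of the set. It is called fifteen-fold if it is invariant under $g$. *)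

theory Defs
  imports "HOL-Analysis.Analysis"
begin

section \<open>The three polytopes, given by their vertex sets\<close>

definition gold :: real where
  "gold = (1 + sqrt 5) / 2"

definition signed_perms :: "real^4 \<Rightarrow> (real^4) set" where
  "signed_perms w = {(\<chi> i. s i * w $ p i) | s p. range s \<subseteq> {-1, 1} \<and> p permutes UNIV}"

text \<open>All sign changes are allowed here, but only even permutations of the coordinates.\<close>

definition even_signed_perms :: "real^4 \<Rightarrow> (real^4) set" where
  "even_signed_perms w =
     {(\<chi> i. s i * w $ p i) | s p. range s \<subseteq> {-1, 1} \<and> p permutes UNIV \<and> evenperm p}"

definition cell600 :: "(real^4) set" where
  "cell600 =
     signed_perms (vector [1, 0, 0, 0]) \<union>
     signed_perms (vector [1/2, 1/2, 1/2, 1/2]) \<union>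
     even_signed_perms (vector [gold/2, 1/2, 1/(2*gold), 0])"

text \<open>
  The 120-cell with circumradius \<open>sqrt 8\<close>. The coordinate order in the last three orbits is chosen
  so that this is the dual of \<open>cell600\<close>: the vertices are the rescaled centroids of the 600 cells
  of \<open>cell600\<close>. Hence both polytopes have literally the same symmetry group. (With the opposite
  parity one gets a congruent 120-cell in a position whose symmetry group is a different
  conjugate of the one of \<open>cell600\<close>.)
\<close>

definition cell120 :: "(real^4) set" where
  "cell120 =
     signed_perms (vector [2, 2, 0, 0]) \<union>
     signed_perms (vector [sqrt 5, 1, 1, 1]) \<union>
     signed_perms (vector [gold, gold, gold, 1/gold^2]) \<union>
     signed_perms (vector [gold^2, 1/gold, 1/gold, 1/gold]) \<union>
     even_signed_perms (vector [1, gold^2, 1/gold^2, 0]) \<union>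
     even_signed_perms (vector [gold, sqrt 5, 1/gold, 0]) \<union>
     even_signed_perms (vector [gold, 2, 1, 1/gold])"

definition E8_roots :: "(real^8) set" where
  "E8_roots =
     {s *\<^sub>R axis i 1 + t *\<^sub>R axis j 1 | s t i j. s \<in> {-1, 1} \<and> t \<in> {-1, 1} \<and> i \<noteq> j} \<union>
     {x. (\<forall>i. x $ i \<in> {-1/2, 1/2}) \<and> even (card {i. x $ i = -1/2})}"

definition gosset421 :: "(real^8) set" where
  "gosset421 = E8_roots"

text \<open>The 60 mirrors of the reflection group \<open>H\<^sub>4\<close> are orthogonal to the vertices of the 600-cell.\<close>

definition H4_roots :: "(real^4) set" where
  "H4_roots = cell600"


section \<open>Coxeter elements and the triacontagonal projection\<close>

definition reflection :: "'a::euclidean_space \<Rightarrow> 'a \<Rightarrow> 'a" where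
  "reflection a x = x - (2 * (x \<bullet> a) / (a \<bullet> a)) *\<^sub>R a"

definition simple_system :: "'a::euclidean_space set \<Rightarrow> 'a set \<Rightarrow> bool" where
  "simple_system \<Phi> \<Delta> \<longleftrightarrow> \<Delta> \<subseteq> \<Phi> \<and> independent \<Delta> \<and>
     (\<forall>x\<in>\<Phi>. \<exists>k. (\<forall>a\<in>\<Delta>. 0 \<le> k a) \<and>
        (x = (\<Sum>a\<in>\<Delta>. k a *\<^sub>R a) \<or> x = - (\<Sum>a\<in>\<Delta>. k a *\<^sub>R a)))"

definition coxeter_element :: "'a::euclidean_space set \<Rightarrow> ('a \<Rightarrow> 'a) \<Rightarrow> bool" where
  "coxeter_element \<Phi> c \<longleftrightarrow>
     (\<exists>as. distinct as \<and> simple_system \<Phi> (set as) \<and> c = foldr (\<circ>) (map reflection as) id)"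

definition orthonormal_frame :: "'a::euclidean_space set \<Rightarrow> 'a \<Rightarrow> 'a \<Rightarrow> bool" where
  "orthonormal_frame P u v \<longleftrightarrow> norm u = 1 \<and> norm v = 1 \<and> orthogonal u v \<and> P = span {u, v}"

text \<open>The plane carries no orientation, so the rotation may have either sense.\<close>

definition rotates_plane :: "('a::euclidean_space \<Rightarrow> 'a) \<Rightarrow> 'a set \<Rightarrow> real \<Rightarrow> bool" where
  "rotates_plane f P \<theta> \<longleftrightarrow>
     (\<exists>u v. orthonormal_frame P u v \<and>
        f u = cos \<theta> *\<^sub>R u + sin \<theta> *\<^sub>R v \<and> f v = - sin \<theta> *\<^sub>R u + cos \<theta> *\<^sub>R v)"

definition orth_proj :: "'a::euclidean_space set \<Rightarrow> 'a \<Rightarrow> 'a" where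
  "orth_proj P x = (THE y. y \<in> P \<and> (\<forall>z\<in>P. orthogonal (x - y) z))"

text \<open>The vertex sets of regular \<open>n\<close>-gons in the plane \<open>P\<close> centred at the origin.\<close>

definition regular_gon :: "nat \<Rightarrow> 'a::euclidean_space set \<Rightarrow> 'a set \<Rightarrow> bool" where
  "regular_gon n P Q \<longleftrightarrow>
     (\<exists>u v r. orthonormal_frame P u v \<and> r > 0 \<and>
        Q = (\<lambda>k. (r * cos (2 * pi * real k / real n)) *\<^sub>R u +
                  (r * sin (2 * pi * real k / real n)) *\<^sub>R v) ` {..<n})"

definition triacontagonal_plane :: "'a::euclidean_space set \<Rightarrow> 'a set \<Rightarrow> bool" where
  "triacontagonal_plane V P \<longleftrightarrow>
     subspace P \<and> dim P = 2 \<and> (\<exists>\<Q>. (\<forall>Q\<in>\<Q>. regular_gon 30 P Q) \<and> orth_proj P ` V = \<Union>\<Q>)"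

text \<open>
  Here \<open>V\<close> is the vertex set and \<open>\<Phi>\<close> the root system of the symmetry group of the polytope;
  the angles are \<open>2 * pi / 15 = 24\<close> and \<open>pi / 15 = 12\<close> degrees.
\<close>

definition fifteenfold_rotation ::
    "'a::euclidean_space set \<Rightarrow> 'a set \<Rightarrow> 'a set \<Rightarrow> ('a \<Rightarrow> 'a) \<Rightarrow> bool" where
  "fifteenfold_rotation V \<Phi> P g \<longleftrightarrow>
     triacontagonal_plane V P \<and>
     orthogonal_transformation g \<and> g ` V = V \<and> rotates_plane g P (2 * pi / 15) \<and>
     (\<exists>c. coxeter_element \<Phi> c \<and> rotates_plane c P (pi / 15) \<and> g = c \<circ> c)"


section \<open>Rays, bases and parity proofs\<close>

definition rays :: "'a::euclidean_space set \<Rightarrow> 'a set set" where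
  "rays V = (\<lambda>v. span {v}) ` V"

definition bases :: "nat \<Rightarrow> 'a::euclidean_space set \<Rightarrow> 'a set set set" where
  "bases N V = {B. B \<subseteq> rays V \<and> card B = N \<and>
     pairwise (\<lambda>r s. \<forall>x\<in>r. \<forall>y\<in>s. orthogonal x y) B}"

definition parity_proof :: "nat \<Rightarrow> 'a::euclidean_space set \<Rightarrow> 'a set set set \<Rightarrow> bool" where
  "parity_proof N V S \<longleftrightarrow>
     S \<subseteq> bases N V \<and> odd (card S) \<and> (\<forall>r\<in>rays V. even (card {B\<in>S. r \<in> B}))"

text \<open>A map of the space acts on rays by taking images, and on bases raywise.\<close>

definition act_basis :: "('a \<Rightarrow> 'a) \<Rightarrow> 'a set set \<Rightarrow> 'a set set" where
  "act_basis g B = (\<lambda>r. g ` r) ` B"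

definition fifteenfold_parity_proof ::
    "nat \<Rightarrow> 'a::euclidean_space set \<Rightarrow> ('a \<Rightarrow> 'a) \<Rightarrow> 'a set set set \<Rightarrow> bool" where
  "fifteenfold_parity_proof N V g S \<longleftrightarrow> parity_proof N V S \<and> act_basis g ` S = S"

definition fifteen_basis_proofs ::
    "nat \<Rightarrow> 'a::euclidean_space set \<Rightarrow> ('a \<Rightarrow> 'a) \<Rightarrow> 'a set set set set" where
  "fifteen_basis_proofs N V g = {S. fifteenfold_parity_proof N V g S \<and> card S = 15}"

definition basis_orbit :: "('a \<Rightarrow> 'a) \<Rightarrow> 'a set set \<Rightarrow> 'a set set set" where
  "basis_orbit g B = range (\<lambda>k. (act_basis g ^^ k) B)"

end

(* Any two Coxeter elements are conjugate: simple systems are conjugate under the group generated by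
   the reflections of a fixed one, and since the Coxeter graph is a tree, the order of the simple
   reflections does not matter up to conjugation. So it suffices to treat one Coxeter element c and
   g = c o c.

   The group generated by g acts freely on the rays, whose orbits all have 15 elements. A basis has
   4 or 8 rays, which is prime to 15, so its orbit has 15 bases as well. Hence a g-invariant set of 15
   bases is the orbit of a single basis B, and the number of its bases through a ray is the number of
   rays of B in the orbit of that ray. The proofs thus correspond to the orbits of bases that meet every
   orbit of rays in an even number of rays; these are found by a finite search over exact coordinates
   in the golden integers. *)

theory Submission
  imports Defs "HOL-Library.List_Lexorder"
begin

section \<open>Conjugacy of Coxeter elements\<close>

text \<open>The conjugating map must be more than an isometry: taken from the reflection group, it
  preserves vertices and roots, so the labelled orbits of one rotation are carried to those of any
  other. A Coxeter word can be reordered because a leaf of the diagram fails to commute with one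
  letter only, and cyclic rotation, a conjugation, leads around that letter. The obstacle in the
  geometry is that 2 cos (pi / 15) has degree 2 over the golden field, so the Coxeter plane has no
  basis with golden coordinates. It is obtained from a golden vector e that is killed by x^4 - s x^3
  - s x^2 - s x + 1, evaluated at the Coxeter element, where s = gold - 1. This quartic is (x^2 - t
  x + 1) (x^2 - t' x + 1) with t = 2 cos (pi / 15) and t' = 2 cos (11 pi / 15); the second factor
  maps e into the plane. For H4 the quartic is the characteristic polynomial. For E8 it is one of
  the two golden factors of the 30th cyclotomic polynomial, which is why even the rational root
  system E8 is treated in golden coordinates.\<close>

lemma reflection_linear: "linear (reflection a)"
  by (rule linearI)
    (simp_all add: reflection_def inner_add_left add_divide_distrib scaleR_left_distrib
      ring_distribs scaleR_diff_right)

lemma reflection_inner_self_adjoint: "reflection a x \<bullet> y = x \<bullet> reflection a y"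
  by (simp add: reflection_def inner_diff_left inner_diff_right inner_commute)

lemma reflection_reflection [simp]: "reflection a (reflection a x) = x"
  by (cases "a = 0") (simp_all add: reflection_def inner_diff_left algebra_simps)

lemma reflection_orthogonal: "orthogonal_transformation (reflection a)"
  unfolding orthogonal_transformation_def
  by (simp add: reflection_linear reflection_inner_self_adjoint)

lemma reflection_commute:
  assumes "orthogonal a b"
  shows "reflection a \<circ> reflection b = reflection b \<circ> reflection a"
proof -
  have "a \<bullet> b = 0" "b \<bullet> a = 0" using assms by (auto simp: orthogonal_def inner_commute)
  then show ?thesis by (simp add: reflection_def fun_eq_iff inner_diff_left)
qed

lemma reflection_conj:
  assumes "orthogonal_transformation w"
  shows "reflection (w a) \<circ> w = w \<circ> reflection a"
  using assms
  by (auto simp: reflection_def fun_eq_iff orthogonal_transformation_def linear_diff linear_cmul)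

section \<open>Words in reflections and their conjugacy\<close>

definition refl_prod :: "'a::euclidean_space list \<Rightarrow> 'a \<Rightarrow> 'a" where
  "refl_prod as = foldr (\<circ>) (map reflection as) id"

lemma refl_prod_Nil [simp]: "refl_prod [] = id"
  and refl_prod_Cons [simp]: "refl_prod (a # as) = reflection a \<circ> refl_prod as"
  by (simp_all add: refl_prod_def)

lemma refl_prod_append: "refl_prod (as @ bs) = refl_prod as \<circ> refl_prod bs"
  by (induction as) (auto simp: o_assoc)

lemma refl_prod_conj:
  assumes "orthogonal_transformation w"
  shows "refl_prod (map w as) \<circ> w = w \<circ> refl_prod as"
proof (induction as)
  case (Cons a as)
  then show ?case
    using reflection_conj[OF assms, of a] by (simp add: fun_eq_iff)
qed auto

text \<open>Left multiplication by generators suffices for a group, since reflections are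
  involutions; statements about members become inductions over words.\<close>

inductive_set refl_grp :: "'a::euclidean_space set \<Rightarrow> ('a \<Rightarrow> 'a) set" for D where
  id: "id \<in> refl_grp D"
| step: "a \<in> D \<Longrightarrow> w \<in> refl_grp D \<Longrightarrow> reflection a \<circ> w \<in> refl_grp D"

lemma refl_grp_reflection: "a \<in> D \<Longrightarrow> reflection a \<in> refl_grp D"
  using refl_grp.step[OF _ refl_grp.id] by auto

lemma refl_grp_comp: "v \<in> refl_grp D \<Longrightarrow> w \<in> refl_grp D \<Longrightarrow> v \<circ> w \<in> refl_grp D"
  by (induction rule: refl_grp.induct) (auto simp: comp_assoc intro: refl_grp.step)

lemma refl_grp_inverse:
  "w \<in> refl_grp D \<Longrightarrow> \<exists>v\<in>refl_grp D. v \<circ> w = id \<and> w \<circ> v = id"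
proof (induction rule: refl_grp.induct)
  case id
  show ?case by (rule bexI[OF _ refl_grp.id]) simp
next
  case (step a w)
  then obtain v where v: "v \<in> refl_grp D" "v \<circ> w = id" "w \<circ> v = id" by blast
  have "v \<circ> reflection a \<in> refl_grp D"
    using refl_grp_comp v(1) refl_grp_reflection step.hyps(1) by blast
  moreover have "(v \<circ> reflection a) \<circ> (reflection a \<circ> w) = id"
    "(reflection a \<circ> w) \<circ> (v \<circ> reflection a) = id"
    using v by (auto simp: fun_eq_iff)
  ultimately show ?case by blast
qed

lemma refl_grp_orthogonal: "w \<in> refl_grp D \<Longrightarrow> orthogonal_transformation w"
proof (induction rule: refl_grp.induct)
  case id
  then show ?case by (simp add: orthogonal_transformation_id id_def)
next
  case (step a w)
  then show ?case by (intro orthogonal_transformation_compose reflection_orthogonal)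
qed

lemma refl_grp_image:
  assumes "w \<in> refl_grp D" "\<And>a. a \<in> D \<Longrightarrow> reflection a ` V = V"
  shows "w ` V = V"
  using assms(1)
proof (induction rule: refl_grp.induct)
  case (step a w)
  then show ?case using assms(2)[of a] by (metis image_comp)
qed simp

text \<open>The conjugator is taken from the group generated by \<open>D\<close>, not among all
  isometries, because it later has to preserve vertices and roots.\<close>

definition grp_conj :: "'a::euclidean_space set \<Rightarrow> ('a \<Rightarrow> 'a) \<Rightarrow> ('a \<Rightarrow> 'a) \<Rightarrow> bool" where
  "grp_conj D c c' \<longleftrightarrow> (\<exists>w\<in>refl_grp D. c \<circ> w = w \<circ> c')"

lemma grp_conj_refl: "grp_conj D c c"
  unfolding grp_conj_def by (rule bexI[OF _ refl_grp.id]) simp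

lemma grp_conj_trans: "grp_conj D a b \<Longrightarrow> grp_conj D b c \<Longrightarrow> grp_conj D a c"
  unfolding grp_conj_def by (metis comp_assoc refl_grp_comp)

lemma grp_conj_sym: "grp_conj D a b \<Longrightarrow> grp_conj D b a"
  unfolding grp_conj_def by (metis comp_assoc comp_id id_comp refl_grp_inverse)

text \<open>Exchanging commuting neighbours leaves the product unchanged; moving the first letter to
  the end conjugates the product by that letter.\<close>

inductive cox_eq :: "'a::euclidean_space list \<Rightarrow> 'a list \<Rightarrow> bool" where
  base: "cox_eq xs xs"
| chain: "cox_eq xs ys \<Longrightarrow> cox_eq ys zs \<Longrightarrow> cox_eq xs zs"
| swap: "orthogonal a b \<Longrightarrow> cox_eq (xs @ a # b # ys) (xs @ b # a # ys)"
| rot: "cox_eq (a # xs) (xs @ [a])"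

lemma cox_eq_mset: "cox_eq xs ys \<Longrightarrow> mset xs = mset ys"
  by (induction rule: cox_eq.induct) auto

lemma cox_eq_conj: "cox_eq xs ys \<Longrightarrow> set xs \<subseteq> D \<Longrightarrow> grp_conj D (refl_prod xs) (refl_prod ys)"
proof (induction rule: cox_eq.induct)
  case (chain xs ys zs)
  moreover have "set ys = set xs" using cox_eq_mset[OF chain.hyps(1)] by (metis set_mset_mset)
  ultimately show ?case using grp_conj_trans by blast
next
  case (swap a b xs ys)
  have "refl_prod (xs @ a # b # ys) = refl_prod (xs @ b # a # ys)"
    using reflection_commute[OF swap.hyps] by (simp add: refl_prod_append fun_eq_iff)
  then show ?case by (simp add: grp_conj_refl)
next
  case (rot a xs)
  have "reflection a \<in> refl_grp D" using rot by (simp add: refl_grp_reflection)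
  then show ?case
    unfolding grp_conj_def by (auto simp: refl_prod_append comp_assoc intro!: bexI[of _ "reflection a"])
qed (rule grp_conj_refl)

lemma cox_eq_rotate: "cox_eq (xs @ ys) (ys @ xs)"
proof (induction xs arbitrary: ys)
  case (Cons x xs)
  have "cox_eq (x # xs @ ys) (xs @ (ys @ [x]))" using cox_eq.rot[of x "xs @ ys"] by simp
  with Cons[of "ys @ [x]"] show ?case by (auto intro: cox_eq.chain)
qed (auto intro: cox_eq.base)

lemma cox_eq_move:
  assumes "\<forall>x\<in>set xs. orthogonal l x"
  shows "cox_eq (zs @ xs @ [l]) (zs @ l # xs)"
  using assms
proof (induction xs arbitrary: zs)
  case (Cons x xs)
  have "cox_eq (zs @ (x # xs) @ [l]) ((zs @ [x]) @ l # xs)" using Cons.IH[of "zs @ [x]"] Cons.prems by simp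
  moreover have "cox_eq ((zs @ [x]) @ l # xs) (zs @ l # x # xs)"
    using cox_eq.swap[of x l zs xs] Cons.prems by (simp add: orthogonal_commute)
  ultimately show ?case by (rule cox_eq.chain)
qed (auto intro: cox_eq.base)

text \<open>Moves on a word lift to the word with a leaf \<open>l\<close> in front. A rotated letter
  that commutes with \<open>l\<close> just passes it. Only \<open>m\<close> cannot; then
  \<open>l\<close> itself travels the other way round, through the remaining letters, which all
  commute with it.\<close>

lemma cox_eq_leaf:
  assumes "cox_eq xs ys" "distinct xs" "\<forall>b\<in>set xs. b \<noteq> m \<longrightarrow> orthogonal l b"
  shows "cox_eq (l # xs) (l # ys)"
  using assms
proof (induction rule: cox_eq.induct)
  case (chain xs ys zs)
  have "set ys = set xs" "distinct ys"
    using cox_eq_mset[OF chain.hyps(1)] chain.prems by (metis set_mset_mset, metis mset_eq_imp_distinct_iff)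
  then show ?case using chain cox_eq.chain by blast
next
  case (swap a b xs ys)
  then show ?case using cox_eq.swap[of a b "l # xs" ys] by simp
next
  case (rot a xs)
  show ?case
  proof (cases "a = m")
    case True
    \<comment> \<open>Distinctness leaves no second \<open>m\<close> in \<open>xs\<close>.\<close>
    then have o: "\<forall>x\<in>set xs. orthogonal l x" using rot.prems by auto
    have "cox_eq (l # a # xs) ([a] @ xs @ [l])" using cox_eq.rot[of l "a # xs"] by simp
    moreover have "cox_eq ([a] @ xs @ [l]) ([a] @ l # xs)" using o by (rule cox_eq_move)
    moreover have "cox_eq ([a] @ l # xs) (l # xs @ [a])" using cox_eq.rot[of a "l # xs"] by simp
    ultimately show ?thesis by (blast intro: cox_eq.chain)
  next
    case False
    then have "orthogonal l a" using rot.prems by simp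
    then have "cox_eq (l # a # xs) (a # l # xs)" using cox_eq.swap[of l a "[]" xs] by simp
    moreover have "cox_eq (a # l # xs) (l # xs @ [a])" using cox_eq.rot[of a "l # xs"] by simp
    ultimately show ?thesis by (rule cox_eq.chain)
  qed
qed (rule cox_eq.base)

text \<open>The list enumerates a forest so that each entry is a leaf of the subgraph spanned by itself and
  the later entries.\<close>

fun leafy :: "'a::euclidean_space list \<Rightarrow> bool" where
  "leafy [] = True"
| "leafy (a # as) = (leafy as \<and> (\<exists>m. \<forall>b\<in>set as. b \<noteq> m \<longrightarrow> orthogonal a b))"

text \<open>Rotation brings the first letter of \<open>ps\<close> to the front of \<open>qs\<close>.
  The other letters are sorted by induction, and \<open>cox_eq_leaf\<close> performs this behind the
  leaf.\<close>

lemma leafy_cox_eq: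
  assumes "leafy ps" "distinct ps" "distinct qs" "set qs = set ps"
  shows "cox_eq qs ps"
  using assms
proof (induction ps arbitrary: qs)
  case (Cons l ps)
  obtain xs ys where qs: "qs = xs @ l # ys" using Cons.prems by (metis list.set_intros(1) split_list)
  obtain m where m: "\<forall>b\<in>set ps. b \<noteq> m \<longrightarrow> orthogonal l b" using Cons.prems(1) by auto
  have s: "set (ys @ xs) = set ps" and d: "distinct (ys @ xs)" using Cons.prems qs by auto
  have "cox_eq (ys @ xs) ps" using Cons.IH Cons.prems s d by simp
  then have "cox_eq (l # ys @ xs) (l # ps)" using cox_eq_leaf d m s by metis
  moreover have "cox_eq qs (l # ys @ xs)" using cox_eq_rotate[of xs "l # ys"] qs by simp
  ultimately show ?case by (blast intro: cox_eq.chain)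
qed (auto intro: cox_eq.base)

section \<open>Simple systems and their chambers\<close>

lemma simple_system_positive_functional:
  fixes D :: "'a::euclidean_space set"
  assumes "independent D"
  obtains r where "\<And>a. a \<in> D \<Longrightarrow> r \<bullet> a = (1::real)"
proof -
  obtain f where f: "linear f" "\<And>a. a \<in> D \<Longrightarrow> f a = (1::real)"
    using linear_independent_extend[OF assms, of "\<lambda>_. 1"] by blast
  have "adjoint f 1 \<bullet> a = f a" for a
    using adjoint_works[OF f(1), of a 1] by (simp add: inner_commute)
  then show ?thesis using f(2) by (intro that[of "adjoint f 1"]) simp
qed

text \<open>The positive roots are the nonnegative combinations of simple roots, hence determine the
  simple roots as their extremal elements.\<close>

lemma simple_system_unique:
  fixes D1 D2 :: "'a::euclidean_space set"
  assumes "simple_system \<Phi> D1" "simple_system \<Phi> D2"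
    and norm: "\<And>x. x \<in> \<Phi> \<Longrightarrow> norm x = c" and "c > 0"
    and pos: "\<And>a. a \<in> D1 \<Longrightarrow> r \<bullet> a > 0" "\<And>a. a \<in> D2 \<Longrightarrow> r \<bullet> a > 0"
  shows "D1 \<subseteq> D2"
proof
  fix a assume a: "a \<in> D1"
  have ind: "independent D1" "independent D2" and sub: "D1 \<subseteq> \<Phi>" "D2 \<subseteq> \<Phi>"
    using assms(1,2) by (auto simp: simple_system_def)
  have fin: "finite D1" "finite D2" using ind by (auto intro: independent_imp_finite)
  have comb: "\<exists>k. (\<forall>a\<in>D. 0 \<le> k a) \<and> x = (\<Sum>a\<in>D. k a *\<^sub>R a)"
    if D: "simple_system \<Phi> D" and p: "\<And>a. a \<in> D \<Longrightarrow> r \<bullet> a > 0" and x: "x \<in> \<Phi>" "r \<bullet> x > 0" for D x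
  proof -
    obtain k where k: "\<forall>a\<in>D. 0 \<le> k a" "x = (\<Sum>a\<in>D. k a *\<^sub>R a) \<or> x = - (\<Sum>a\<in>D. k a *\<^sub>R a)"
      using D x(1) by (auto simp: simple_system_def)
    have "0 \<le> r \<bullet> (\<Sum>a\<in>D. k a *\<^sub>R a)"
      unfolding inner_sum_right inner_scaleR_right
      using k(1) p by (intro sum_nonneg mult_nonneg_nonneg) (auto intro: less_imp_le)
    then show ?thesis using k x(2) by auto
  qed
  obtain k where k: "\<And>b. b \<in> D2 \<Longrightarrow> 0 \<le> k b" "a = (\<Sum>b\<in>D2. k b *\<^sub>R b)"
    using comb[OF assms(2) pos(2), of a] a sub pos(1) by blast
  have "\<exists>b\<in>D2. k b \<noteq> 0"
  proof (rule ccontr)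
    assume "\<not> ?thesis"
    then have "a = 0" using k(2) by simp
    then show False using pos(1)[OF a] by simp
  qed
  then obtain b where b: "b \<in> D2" "k b > 0" using k(1) by (metis less_eq_real_def)
  obtain m where m: "\<And>d. d \<in> D1 \<Longrightarrow> 0 \<le> m d" "b = (\<Sum>d\<in>D1. m d *\<^sub>R d)"
    using comb[OF assms(1) pos(1), of b] b sub pos(2) by blast
  \<comment> \<open>The coordinate functional \<open>f\<close> of \<open>d\<close> with respect to
    \<open>D1\<close> is nonnegative on \<open>D2\<close>, which consists of positive roots, and
    vanishes at \<open>a\<close>. As \<open>a\<close> is a nonnegative combination of
    \<open>D2\<close>, each \<open>b\<close> with a positive coefficient has
    \<open>f b = 0\<close>.\<close>
  have zero: "m d = 0" if d: "d \<in> D1" "d \<noteq> a" for d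
  proof -
    obtain f where f: "linear f" "\<And>x. x \<in> D1 \<Longrightarrow> f x = (if x = d then 1 else 0::real)"
      using linear_independent_extend[OF ind(1), of "\<lambda>x. if x = d then 1 else 0"] by blast
    have fsum: "f (\<Sum>x\<in>D1. q x *\<^sub>R x) = q d" for q
    proof -
      have "f (\<Sum>x\<in>D1. q x *\<^sub>R x) = (\<Sum>x\<in>D1. q x * f x)"
        using f(1) by (simp add: linear_sum linear_cmul)
      also have "\<dots> = (\<Sum>x\<in>D1. if x = d then q x else 0)"
        by (rule sum.cong) (auto simp: f(2))
      finally show ?thesis using d fin by simp
    qed
    have nn: "0 \<le> f y" if y: "y \<in> D2" for y
    proof -
      obtain q where "\<forall>d\<in>D1. 0 \<le> q d" "y = (\<Sum>d\<in>D1. q d *\<^sub>R d)"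
        using comb[OF assms(1) pos(1), of y] y sub pos(2) by blast
      then show ?thesis using fsum[of q] d by auto
    qed
    have "0 = f a" using f(2) a d by auto
    also have "\<dots> = (\<Sum>b\<in>D2. k b * f b)" using f(1) by (subst k(2)) (simp add: linear_sum linear_cmul)
    finally have "k b * f b = 0"
      using b fin nn k(1) sum_nonneg_eq_0_iff[of D2 "\<lambda>b. k b * f b"] by auto
    then show ?thesis using b fsum[of m] m(2) by auto
  qed
  have "b = m a *\<^sub>R a"
    using m(2) a fin zero sum.remove[of D1 a "\<lambda>d. m d *\<^sub>R d"] by simp
  moreover have "norm b = c" "norm a = c" using norm a b sub by auto
  ultimately have "m a = 1" using \<open>c > 0\<close> m(1)[OF a] by auto
  then show "a \<in> D2" using \<open>b = m a *\<^sub>R a\<close> b by simp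
qed

lemma simple_system_image:
  assumes "orthogonal_transformation w" "w ` \<Phi> = \<Phi>" "simple_system \<Phi> D"
  shows "simple_system \<Phi> (w ` D)"
proof -
  have lin: "linear w" and inj: "inj w"
    using assms(1) orthogonal_transformation_inj orthogonal_transformation_linear by auto
  have "independent (w ` D)"
    using assms(3) inj lin unfolding simple_system_def
    by (intro linear_independent_injective_image) (auto intro: inj_on_subset)
  moreover have "\<exists>k. (\<forall>a\<in>w ` D. 0 \<le> k a) \<and>
        (x = (\<Sum>a\<in>w ` D. k a *\<^sub>R a) \<or> x = - (\<Sum>a\<in>w ` D. k a *\<^sub>R a))" if x: "x \<in> \<Phi>" for x
  proof -
    obtain y where y: "y \<in> \<Phi>" "x = w y" using x assms(2) by blast
    obtain k where k: "\<forall>a\<in>D. 0 \<le> k a" "y = (\<Sum>a\<in>D. k a *\<^sub>R a) \<or> y = - (\<Sum>a\<in>D. k a *\<^sub>R a)"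
      using assms(3) y by (auto simp: simple_system_def)
    have inv: "inv w (w a) = a" for a using inj by simp
    have "(\<Sum>a\<in>w ` D. k (inv w a) *\<^sub>R a) = w (\<Sum>a\<in>D. k a *\<^sub>R a)"
      using inj lin by (subst sum.reindex) (auto simp: inv linear_sum linear_cmul inj_on_def)
    then show ?thesis using k y lin by (intro exI[of _ "\<lambda>a. k (inv w a)"]) (auto simp: inv linear_neg)
  qed
  moreover have "w ` D \<subseteq> \<Phi>" using assms(2,3) by (metis image_mono simple_system_def)
  ultimately show ?thesis unfolding simple_system_def by (intro conjI ballI)
qed

text \<open>Let \<open>r\<close> and \<open>r0\<close> be points of the open chambers of
  \<open>D\<close> and \<open>D0\<close>. Among the images of \<open>r\<close> under the group, one
  with the largest inner product with \<open>r0\<close> lies in the chamber of \<open>D0\<close>,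
  since otherwise a reflection in \<open>D0\<close> would increase it. The image of \<open>D\<close>
  and \<open>D0\<close> are then positive at a common point and agree.\<close>

lemma simple_systems_conjugate:
  fixes D D0 :: "'a::euclidean_space set"
  assumes fin: "finite \<Phi>" and D0: "simple_system \<Phi> D0" "span D0 = UNIV" and D: "simple_system \<Phi> D"
    and norm: "\<And>x. x \<in> \<Phi> \<Longrightarrow> norm x = c" "c > 0"
    and refl: "\<And>a. a \<in> D0 \<Longrightarrow> reflection a ` \<Phi> = \<Phi>"
  obtains w where "w \<in> refl_grp D0" "w ` D = D0"
proof -
  obtain r where r: "\<And>a. a \<in> D \<Longrightarrow> r \<bullet> a = 1"
    using simple_system_positive_functional D by (metis simple_system_def)
  obtain r0 where r0: "\<And>a. a \<in> D0 \<Longrightarrow> r0 \<bullet> a = 1"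
    using simple_system_positive_functional D0(1) by (metis simple_system_def)
  \<comment> \<open>The orbit of \<open>r\<close> is finite because \<open>w r\<close> is determined
    by the permutation of the roots that \<open>w\<close> induces.\<close>
  have "r \<in> span \<Phi>" using D0 span_mono[of D0 \<Phi>] by (auto simp: simple_system_def)
  then obtain q where q: "r = (\<Sum>x\<in>\<Phi>. q x *\<^sub>R x)" using fin by (auto simp: span_finite)
  let ?W = "refl_grp D0"
  have Wimg: "w ` \<Phi> = \<Phi>" if "w \<in> ?W" for w using refl_grp_image[OF that refl] .
  have "(\<lambda>w. w r) ` ?W \<subseteq> (\<lambda>h. \<Sum>x\<in>\<Phi>. q x *\<^sub>R h x) ` (PiE \<Phi> (\<lambda>_. \<Phi>))"
  proof
    fix y assume "y \<in> (\<lambda>w. w r) ` ?W"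
    then obtain w where w: "w \<in> ?W" "y = w r" by blast
    have "linear w" using refl_grp_orthogonal[OF w(1)] by (rule orthogonal_transformation_linear)
    then have "y = (\<Sum>x\<in>\<Phi>. q x *\<^sub>R w x)" using w(2) q by (simp add: linear_sum linear_cmul)
    also have "\<dots> = (\<Sum>x\<in>\<Phi>. q x *\<^sub>R restrict w \<Phi> x)" by simp
    finally show "y \<in> (\<lambda>h. \<Sum>x\<in>\<Phi>. q x *\<^sub>R h x) ` (PiE \<Phi> (\<lambda>_. \<Phi>))"
      using Wimg[OF w(1)] by (intro image_eqI[of _ _ "restrict w \<Phi>"]) auto
  qed
  then have "finite ((\<lambda>w. w r) ` ?W)" by (rule finite_subset) (auto intro: finite_PiE fin)
  then have finv: "finite ((\<lambda>w. w r \<bullet> r0) ` ?W)"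
    using finite_imageI[of "(\<lambda>w. w r) ` ?W" "\<lambda>x. x \<bullet> r0"] by (simp add: image_image)
  define M where "M = Max ((\<lambda>w. w r \<bullet> r0) ` ?W)"
  have "M \<in> (\<lambda>w. w r \<bullet> r0) ` ?W"
    unfolding M_def using finv refl_grp.id[of D0] by (intro Max_in) auto
  then obtain w where w: "w \<in> ?W" "M = w r \<bullet> r0" by blast
  have max: "v r \<bullet> r0 \<le> w r \<bullet> r0" if "v \<in> ?W" for v
    using Max_ge[OF finv] that w(2) unfolding M_def by (metis image_eqI)
  have wo: "orthogonal_transformation w" using refl_grp_orthogonal[OF w(1)] .
  \<comment> \<open>As \<open>r\<close> is 1 on \<open>D\<close>, its value at a root is, up to
    sign, the sum of the nonnegative coefficients. So no image of \<open>r\<close> lies on a mirror,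
    which excludes equality in \<open>pos\<close>.\<close>
  have rx: "r \<bullet> x \<noteq> 0" if x: "x \<in> \<Phi>" for x
  proof
    assume 0: "r \<bullet> x = 0"
    obtain k where k: "\<forall>a\<in>D. 0 \<le> k a" "x = (\<Sum>a\<in>D. k a *\<^sub>R a) \<or> x = - (\<Sum>a\<in>D. k a *\<^sub>R a)"
      using D x by (auto simp: simple_system_def)
    have "r \<bullet> (\<Sum>a\<in>D. k a *\<^sub>R a) = (\<Sum>a\<in>D. k a)" using r by (simp add: inner_sum_right)
    then have "(\<Sum>a\<in>D. k a) = 0" using 0 k by auto
    moreover have "finite D" using D by (auto simp: simple_system_def intro: independent_imp_finite)
    ultimately have "\<forall>a\<in>D. k a = 0" using k(1) by (simp add: sum_nonneg_eq_0_iff)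
    then have "x = 0" using k(2) by auto
    then show False using norm x by force
  qed
  have pos: "w r \<bullet> a > 0" if a: "a \<in> D0" for a
  proof -
    have a\<Phi>: "a \<in> \<Phi>" using a D0 by (auto simp: simple_system_def)
    then have "a \<noteq> 0" using norm by force
    have "reflection a (w r) \<bullet> r0 \<le> w r \<bullet> r0" using max refl_grp.step[OF a w(1)] by fastforce
    moreover have "reflection a (w r) \<bullet> r0 = w r \<bullet> r0 - 2 * (w r \<bullet> a) / (a \<bullet> a) * (r0 \<bullet> a)"
      unfolding reflection_def inner_diff_left inner_scaleR_left inner_commute[of a r0] ..
    ultimately have "(w r \<bullet> a) / (a \<bullet> a) \<ge> 0" unfolding r0[OF a] by linarith
    then have "w r \<bullet> a \<ge> 0" using \<open>a \<noteq> 0\<close> inner_gt_zero_iff[of a]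
      by (simp add: zero_le_divide_iff del: inner_gt_zero_iff)
    moreover obtain y where "y \<in> \<Phi>" "a = w y" using a\<Phi> Wimg[OF w(1)] by blast
    then have "w r \<bullet> a \<noteq> 0" using rx wo by (auto simp: orthogonal_transformation_def)
    ultimately show ?thesis by simp
  qed
  have sw: "simple_system \<Phi> (w ` D)" using simple_system_image[OF wo Wimg[OF w(1)] D] .
  have pos': "w r \<bullet> a > 0" if "a \<in> w ` D" for a
    using that r wo by (auto simp: orthogonal_transformation_def)
  have "w ` D = D0"
    using simple_system_unique[OF sw D0(1) norm pos' pos]
      simple_system_unique[OF D0(1) sw norm pos pos'] by blast
  with w(1) that show ?thesis by blast
qed

text \<open>A group element moves the simple system of \<open>c\<close> onto \<open>set as\<close>;
  what remains is another order of the same letters.\<close>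

lemma coxeter_elements_conjugate:
  fixes as :: "'a::euclidean_space list"
  assumes "finite \<Phi>" "simple_system \<Phi> (set as)" "span (set as) = UNIV" "distinct as" "leafy as"
    and norm: "\<And>x. x \<in> \<Phi> \<Longrightarrow> norm x = r" "r > 0"
    and "\<And>a. a \<in> set as \<Longrightarrow> reflection a ` \<Phi> = \<Phi>"
    and "coxeter_element \<Phi> c"
  obtains w where "w \<in> refl_grp (set as)" "c \<circ> w = w \<circ> refl_prod as"
proof -
  obtain bs where bs: "distinct bs" "simple_system \<Phi> (set bs)" "c = refl_prod bs"
    using assms(9) by (auto simp: coxeter_element_def refl_prod_def)
  obtain w where w: "w \<in> refl_grp (set as)" "w ` set bs = set as"
    using simple_systems_conjugate[OF assms(1-3) bs(2) norm assms(8)] .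
  have wo: "orthogonal_transformation w" using refl_grp_orthogonal[OF w(1)] .
  have "distinct (map w bs)"
    using bs(1) orthogonal_transformation_inj[OF wo] by (simp add: distinct_map inj_on_def)
  then have "cox_eq (map w bs) as" using w(2) assms by (intro leafy_cox_eq) auto
  then have "grp_conj (set as) (refl_prod (map w bs)) (refl_prod as)"
    using w(2) by (intro cox_eq_conj) auto
  moreover have "grp_conj (set as) (refl_prod (map w bs)) c"
    using refl_prod_conj[OF wo] w(1) bs(3) by (auto simp: grp_conj_def)
  ultimately have "grp_conj (set as) c (refl_prod as)" using grp_conj_sym grp_conj_trans by blast
  then show ?thesis using that by (auto simp: grp_conj_def)
qed

section \<open>Invariant planes\<close>

lemma gold_sq: "gold * gold = gold + 1"
proof -
  have "sqrt 5 * sqrt 5 = 5" by simp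
  then show ?thesis unfolding gold_def by (simp add: field_simps)
qed

lemma gold_pos: "gold > 0"
  unfolding gold_def by (simp add: add_pos_pos)

text \<open>The equation says that x^2 - 2 cos \<theta> x + 1, evaluated at \<open>c\<close>, kills
  \<open>z\<close>. Gram-Schmidt applied to \<open>z\<close> and \<open>c z\<close> gives the
  frame.\<close>

lemma rotation_plane:
  fixes c :: "'a::euclidean_space \<Rightarrow> 'a"
  assumes c: "orthogonal_transformation c" and "z \<noteq> 0" and eq: "c (c z) + z = (2 * cos \<theta>) *\<^sub>R c z"
    and \<theta>: "0 < \<theta>" "\<theta> < pi"
  obtains u v where "z \<in> span {u, v}" "orthonormal_frame (span {u, v}) u v"
    "c u = cos \<theta> *\<^sub>R u + sin \<theta> *\<^sub>R v" "c v = - sin \<theta> *\<^sub>R u + cos \<theta> *\<^sub>R v"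
proof -
  have lin: "linear c" and inn: "\<And>x y. c x \<bullet> c y = x \<bullet> y"
    using c by (auto simp: orthogonal_transformation_def)
  have s: "sin \<theta> > 0" using \<theta> by (rule sin_gt_zero)
  define u where "u = (1 / norm z) *\<^sub>R z"
  define v where "v = (1 / sin \<theta>) *\<^sub>R (c u - cos \<theta> *\<^sub>R u)"
  have uu: "u \<bullet> u = 1" using \<open>z \<noteq> 0\<close> by (simp add: u_def dot_square_norm power2_eq_square)
  have "c (c u) + u = (1 / norm z) *\<^sub>R (c (c z) + z)"
    using lin by (simp add: u_def linear_cmul scaleR_right_distrib)
  then have ccu: "c (c u) + u = (2 * cos \<theta>) *\<^sub>R c u"
    using eq lin by (simp add: u_def linear_cmul)
  \<comment> \<open>Pairing with \<open>c u\<close> gives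
    \<open>2 * (u \<bullet> c u) = 2 * cos \<theta>\<close>, as \<open>c\<close> preserves inner
    products.\<close>
  have "c (c u) \<bullet> c u + u \<bullet> c u = (2 * cos \<theta>) * (c u \<bullet> c u)"
    using ccu by (metis inner_add_left inner_scaleR_left)
  then have ucu: "u \<bullet> c u = cos \<theta>" by (simp add: inn uu inner_commute)
  have cu: "c u = cos \<theta> *\<^sub>R u + sin \<theta> *\<^sub>R v" using s by (simp add: v_def)
  have uv: "u \<bullet> v = 0" by (simp add: v_def inner_diff_right ucu uu)
  have "1 = c u \<bullet> c u" by (simp add: inn uu)
  also have "\<dots> = (cos \<theta>)\<^sup>2 + (sin \<theta>)\<^sup>2 * (v \<bullet> v)"
    unfolding cu by (simp add: inner_add_left inner_add_right uu uv inner_commute[of v u] power2_eq_square)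
  finally have "(sin \<theta>)\<^sup>2 * (v \<bullet> v) = (sin \<theta>)\<^sup>2"
    using sin_cos_squared_add[of \<theta>] by linarith
  then have vv: "v \<bullet> v = 1" using s by simp
  have "sin \<theta> *\<^sub>R c v = c (sin \<theta> *\<^sub>R v)" using lin by (simp add: linear_cmul)
  also have "sin \<theta> *\<^sub>R v = c u - cos \<theta> *\<^sub>R u" using s by (simp add: v_def)
  also have "c (c u - cos \<theta> *\<^sub>R u) = c (c u) - cos \<theta> *\<^sub>R c u" using lin by (simp add: linear_diff linear_cmul)
  also have "c (c u) = (2 * cos \<theta>) *\<^sub>R c u - u" using ccu by (simp add: algebra_simps)
  also have "(2 * cos \<theta>) *\<^sub>R c u - u - cos \<theta> *\<^sub>R c u = cos \<theta> *\<^sub>R c u - u"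
    using scaleR_left_distrib[of "cos \<theta>" "cos \<theta>" "c u"] by simp
  also have "\<dots> = ((cos \<theta>)\<^sup>2 - 1) *\<^sub>R u + (cos \<theta> * sin \<theta>) *\<^sub>R v"
    unfolding cu by (simp add: algebra_simps power2_eq_square)
  also have "(cos \<theta>)\<^sup>2 - 1 = - (sin \<theta> * sin \<theta>)"
    using sin_cos_squared_add[of \<theta>] by (simp add: power2_eq_square)
  finally have "sin \<theta> *\<^sub>R c v = sin \<theta> *\<^sub>R (- sin \<theta> *\<^sub>R u + cos \<theta> *\<^sub>R v)"
    by (simp add: algebra_simps)
  then have cv: "c v = - sin \<theta> *\<^sub>R u + cos \<theta> *\<^sub>R v" using s by (metis less_irrefl real_vector.scale_cancel_left)
  have "z = norm z *\<^sub>R u" using \<open>z \<noteq> 0\<close> by (simp add: u_def)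
  then have "z \<in> span {u, v}" by (metis insertI1 span_base span_scale)
  moreover have "orthonormal_frame (span {u, v}) u v"
    using uu vv uv by (simp add: orthonormal_frame_def norm_eq_1 orthogonal_def)
  ultimately show ?thesis using cu cv that by blast
qed

lemma orthonormal_frame_inner:
  assumes "orthonormal_frame P u v"
  shows "u \<bullet> u = 1" "v \<bullet> v = 1" "u \<bullet> v = 0" "v \<bullet> u = 0"
  using assms by (auto simp: orthonormal_frame_def norm_eq_1 orthogonal_def inner_commute)

lemma orth_proj_frame:
  assumes "orthonormal_frame P u v"
  shows "orth_proj P x = (x \<bullet> u) *\<^sub>R u + (x \<bullet> v) *\<^sub>R v"
  unfolding orth_proj_def
proof (rule the_equality)
  note uv = orthonormal_frame_inner[OF assms]
  have P: "P = span {u, v}" using assms by (simp add: orthonormal_frame_def)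
  have mem: "y \<in> P \<longleftrightarrow> (\<exists>a b. y = a *\<^sub>R u + b *\<^sub>R v)" for y
    unfolding P by (auto simp: span_insert algebra_simps)
  let ?p = "(x \<bullet> u) *\<^sub>R u + (x \<bullet> v) *\<^sub>R v"
  show "?p \<in> P \<and> (\<forall>z\<in>P. orthogonal (x - ?p) z)"
    by (auto simp: mem orthogonal_def inner_diff_left inner_add_left inner_add_right uv)
  fix y assume y: "y \<in> P \<and> (\<forall>z\<in>P. orthogonal (x - y) z)"
  then obtain a b where ab: "y = a *\<^sub>R u + b *\<^sub>R v" using mem by blast
  have "u \<in> P" "v \<in> P" unfolding P by (auto simp: span_base)
  then have "(x - y) \<bullet> u = 0" "(x - y) \<bullet> v = 0" using y by (auto simp: orthogonal_def)
  then show "y = ?p" by (simp add: ab inner_diff_left inner_add_left uv)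
qed

text \<open>\<open>regular_gon\<close> has a vertex on the first axis, so each projected vertex
  requires a frame turned into its own direction.\<close>

lemma rotated_frame:
  assumes "orthonormal_frame P u v" "a\<^sup>2 + b\<^sup>2 = 1"
  shows "orthonormal_frame P (a *\<^sub>R u + b *\<^sub>R v) (- b *\<^sub>R u + a *\<^sub>R v)"
proof -
  note uv = orthonormal_frame_inner[OF assms(1)]
  let ?u = "a *\<^sub>R u + b *\<^sub>R v" and ?v = "- b *\<^sub>R u + a *\<^sub>R v"
  have ab: "a * a + b * b = 1" using assms(2) by (simp add: power2_eq_square)
  have "a *\<^sub>R ?u - b *\<^sub>R ?v = (a * a + b * b) *\<^sub>R u" "b *\<^sub>R ?u + a *\<^sub>R ?v = (a * a + b * b) *\<^sub>R v"
    by (simp_all add: algebra_simps)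
  then have u: "u = a *\<^sub>R ?u - b *\<^sub>R ?v" and v: "v = b *\<^sub>R ?u + a *\<^sub>R ?v" using ab by auto
  have "span {?u, ?v} = span {u, v}"
  proof (rule span_eq[THEN iffD2], intro conjI subsetI)
    have "u \<in> span {u, v}" "v \<in> span {u, v}" by (auto intro: span_base)
    then have "?u \<in> span {u, v}" "?v \<in> span {u, v}" by (meson span_add span_scale)+
    then show "x \<in> span {u, v}" if "x \<in> {?u, ?v}" for x using that by auto
  next
    have "?u \<in> span {?u, ?v}" "?v \<in> span {?u, ?v}" by (auto intro: span_base)
    then have "a *\<^sub>R ?u - b *\<^sub>R ?v \<in> span {?u, ?v}" "b *\<^sub>R ?u + a *\<^sub>R ?v \<in> span {?u, ?v}"
      by (meson span_add span_diff span_scale)+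
    then show "x \<in> span {?u, ?v}" if "x \<in> {u, v}" for x using that u v by auto
  qed
  moreover have "?u \<bullet> ?u = 1" "?v \<bullet> ?v = 1" "?u \<bullet> ?v = 0"
    using ab by (simp_all add: inner_add_left inner_add_right uv algebra_simps)
  ultimately show ?thesis using assms(1)
    by (simp add: orthonormal_frame_def norm_eq_1 orthogonal_def)
qed

lemma rotation_power:
  fixes c :: "'a::euclidean_space \<Rightarrow> 'a"
  assumes "linear c" "c u = cos \<theta> *\<^sub>R u + sin \<theta> *\<^sub>R v" "c v = - sin \<theta> *\<^sub>R u + cos \<theta> *\<^sub>R v"
  shows "(c ^^ k) u = cos (k * \<theta>) *\<^sub>R u + sin (k * \<theta>) *\<^sub>R v"
proof (induction k)
  case (Suc k)
  have "(c ^^ Suc k) u = c (cos (k * \<theta>) *\<^sub>R u + sin (k * \<theta>) *\<^sub>R v)" using Suc by simp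
  also have "\<dots> = cos (k * \<theta>) *\<^sub>R c u + sin (k * \<theta>) *\<^sub>R c v"
    using assms(1) by (simp add: linear_add linear_cmul)
  also have "\<dots> = (cos (k * \<theta>) * cos \<theta> - sin (k * \<theta>) * sin \<theta>) *\<^sub>R u
      + (sin (k * \<theta>) * cos \<theta> + cos (k * \<theta>) * sin \<theta>) *\<^sub>R v"
    unfolding assms(2,3) by (simp add: algebra_simps)
  also have "\<dots> = cos (k * \<theta> + \<theta>) *\<^sub>R u + sin (k * \<theta> + \<theta>) *\<^sub>R v"
    by (simp add: cos_add sin_add)
  also have "k * \<theta> + \<theta> = Suc k * \<theta>" by (simp add: algebra_simps)
  finally show ?case .
qed simp

lemma rotation_twice:
  fixes c :: "'a::euclidean_space \<Rightarrow> 'a"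
  assumes "linear c" "c u = cos \<theta> *\<^sub>R u + sin \<theta> *\<^sub>R v" "c v = - sin \<theta> *\<^sub>R u + cos \<theta> *\<^sub>R v"
  shows "c (c u) = cos (2 * \<theta>) *\<^sub>R u + sin (2 * \<theta>) *\<^sub>R v"
    "c (c v) = - sin (2 * \<theta>) *\<^sub>R u + cos (2 * \<theta>) *\<^sub>R v"
proof -
  have d: "(2 * sin \<theta> * cos \<theta>) *\<^sub>R x = (sin \<theta> * cos \<theta>) *\<^sub>R x + (sin \<theta> * cos \<theta>) *\<^sub>R x" for x :: 'a
    by (simp flip: scaleR_left_distrib)
  have e: "c (c u) = cos \<theta> *\<^sub>R (cos \<theta> *\<^sub>R u + sin \<theta> *\<^sub>R v) + sin \<theta> *\<^sub>R (- sin \<theta> *\<^sub>R u + cos \<theta> *\<^sub>R v)"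
    "c (c v) = - sin \<theta> *\<^sub>R (cos \<theta> *\<^sub>R u + sin \<theta> *\<^sub>R v) + cos \<theta> *\<^sub>R (- sin \<theta> *\<^sub>R u + cos \<theta> *\<^sub>R v)"
    using assms(1) by (metis assms(2,3) linear_add linear_cmul)+
  show "c (c u) = cos (2 * \<theta>) *\<^sub>R u + sin (2 * \<theta>) *\<^sub>R v"
    "c (c v) = - sin (2 * \<theta>) *\<^sub>R u + cos (2 * \<theta>) *\<^sub>R v"
    unfolding e sin_double cos_double
    unfolding scaleR_minus_left d by (simp_all add: power2_eq_square algebra_simps)
qed

text \<open>Projection commutes with \<open>c\<close>, so the images of a vertex under thirty powers
  of \<open>c\<close> project to the rotations of one point by multiples of \<open>pi / 15\<close>.
  The assumption \<open>nz\<close> keeps this point away from the origin.\<close>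

lemma coxeter_plane:
  fixes c :: "'a::euclidean_space \<Rightarrow> 'a"
  assumes c: "orthogonal_transformation c" and fr: "orthonormal_frame P u v"
    and cu: "c u = cos (pi / 15) *\<^sub>R u + sin (pi / 15) *\<^sub>R v"
    and cv: "c v = - sin (pi / 15) *\<^sub>R u + cos (pi / 15) *\<^sub>R v"
    and V: "c ` V = V" and nz: "\<And>x. x \<in> V \<Longrightarrow> x \<bullet> u \<noteq> 0 \<or> x \<bullet> v \<noteq> 0"
  shows "triacontagonal_plane V P" "rotates_plane c P (pi / 15)"
    "rotates_plane (c \<circ> c) P (2 * pi / 15)"
proof -
  let ?C = "cos (pi / 15)" and ?S = "sin (pi / 15)"
  have lin: "linear c" and inn: "\<And>x y. c x \<bullet> c y = x \<bullet> y"
    using c by (auto simp: orthogonal_transformation_def)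
  note uv = orthonormal_frame_inner[OF fr] and proj = orth_proj_frame[OF fr]
  have P: "P = span {u, v}" using fr by (simp add: orthonormal_frame_def)
  have CS: "?C * ?C + ?S * ?S = 1" using sin_cos_squared_add2[of "pi / 15"] by (simp add: power2_eq_square)
  show "rotates_plane c P (pi / 15)" unfolding rotates_plane_def using fr cu cv by blast
  show "rotates_plane (c \<circ> c) P (2 * pi / 15)"
    unfolding rotates_plane_def using fr rotation_twice[OF lin cu cv]
    by (intro exI[of _ u] exI[of _ v]) simp
  \<comment> \<open>Invariance of the inner product expresses the old coordinates by the new ones;
    \<open>CS\<close> inverts this rotation.\<close>
  have eu: "x \<bullet> u = ?C * (c x \<bullet> u) + ?S * (c x \<bullet> v)" and ev: "x \<bullet> v = ?C * (c x \<bullet> v) - ?S * (c x \<bullet> u)" for x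
    using inn[of x u] inn[of x v] unfolding cu cv by (simp_all add: inner_add_right inner_diff_right)
  have cu': "c x \<bullet> u = ?C * (x \<bullet> u) - ?S * (x \<bullet> v)" for x
    using eu[of x] ev[of x] CS by algebra
  have cv': "c x \<bullet> v = ?S * (x \<bullet> u) + ?C * (x \<bullet> v)" for x
    using eu[of x] ev[of x] CS by algebra
  have comm: "orth_proj P (c x) = c (orth_proj P x)" for x
    unfolding proj cu' cv' using lin
    by (simp add: linear_add linear_cmul cu cv algebra_simps)
  have commk: "orth_proj P ((c ^^ k) x) = (c ^^ k) (orth_proj P x)" for k x
    by (induction k) (auto simp: comm)
  have Vk: "(c ^^ k) x \<in> V" if "x \<in> V" for k x
    using that V by (induction k) auto
  define Q where "Q x = (\<lambda>k. (c ^^ k) (orth_proj P x)) ` {..<30}" for x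
  have "regular_gon 30 P (Q x)" if x: "x \<in> V" for x
  proof -
    let ?a = "x \<bullet> u" and ?b = "x \<bullet> v"
    define r where "r = sqrt (?a\<^sup>2 + ?b\<^sup>2)"
    have r: "r > 0" "r\<^sup>2 = ?a\<^sup>2 + ?b\<^sup>2"
      using nz[OF x] unfolding r_def by (auto simp: sum_power2_gt_zero_iff)
    have "(?a / r)\<^sup>2 + (?b / r)\<^sup>2 = r\<^sup>2 / r\<^sup>2"
      by (simp only: power_divide r(2) add_divide_distrib)
    also have "\<dots> = 1" using r(1) by simp
    finally have ab: "(?a / r)\<^sup>2 + (?b / r)\<^sup>2 = 1" .
    note fr' = rotated_frame[OF fr ab]
    let ?u = "(?a / r) *\<^sub>R u + (?b / r) *\<^sub>R v" and ?v = "- (?b / r) *\<^sub>R u + (?a / r) *\<^sub>R v"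
    have "c ?u = ?C *\<^sub>R ?u + ?S *\<^sub>R ?v" "c ?v = - ?S *\<^sub>R ?u + ?C *\<^sub>R ?v"
      using lin by (simp_all add: linear_add linear_diff linear_neg linear_cmul cu cv algebra_simps)
    note pw = rotation_power[OF lin this]
    have px: "orth_proj P x = r *\<^sub>R ?u" using r by (simp add: proj scaleR_right_distrib)
    have lin_pow: "linear (c ^^ k)" for k
    proof (induction k)
      case (Suc k)
      then show ?case using linear_compose[OF Suc lin] by (simp only: funpow.simps)
    next
      case 0
      show ?case using linear_id by (simp add: id_def)
    qed
    have "(c ^^ k) (orth_proj P x) = (r * cos (2 * pi * real k / real 30)) *\<^sub>R ?u +
                  (r * sin (2 * pi * real k / real 30)) *\<^sub>R ?v" for k
    proof -
      have ang: "2 * pi * real k / real 30 = real k * (pi / 15)" by simp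
      have "(c ^^ k) (orth_proj P x) = r *\<^sub>R (c ^^ k) ?u"
        unfolding px using lin_pow by (rule linear_cmul)
      then show ?thesis unfolding ang by (simp only: pw scaleR_right_distrib scaleR_scaleR mult.assoc)
    qed
    then show ?thesis unfolding regular_gon_def Q_def using fr' r(1)
      by (intro exI[of _ ?u] exI[of _ ?v] exI[of _ r]) simp
  qed
  moreover have "orth_proj P ` V = \<Union> (Q ` V)"
  proof
    have "orth_proj P x \<in> Q x" for x
      unfolding Q_def by (rule image_eqI[of _ _ 0]) auto
    then show "orth_proj P ` V \<subseteq> \<Union> (Q ` V)" by blast
    show "\<Union> (Q ` V) \<subseteq> orth_proj P ` V" unfolding Q_def using Vk commk by (auto simp flip: commk)
  qed
  moreover have "dim P = 2"
  proof -
    have "independent {u, v}"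
      using uv by (intro pairwise_orthogonal_independent) (auto simp: pairwise_def orthogonal_def)
    moreover have "u \<noteq> v" using uv by auto
    ultimately show ?thesis
      unfolding P by (subst dim_span_eq_card_independent) auto
  qed
  ultimately show "triacontagonal_plane V P"
    unfolding triacontagonal_plane_def using P by (auto intro!: exI[of _ "Q ` V"])
qed

section \<open>Golden numbers and the cosines of pi / 5 and pi / 15\<close>

lemma cos_pi_fifth: "2 * cos (pi / 5) = gold"
proof -
  let ?x = "cos (pi / 5)"
  have pos: "?x > 0" by (rule cos_gt_zero) (use pi_gt_zero in \<open>auto simp: field_simps\<close>)
  \<comment> \<open>The angles 3 pi / 5 and 2 pi / 5 are supplementary; the resulting cubic equation
    has the extraneous root -1.\<close>
  have "cos (3 * (pi / 5)) = cos (pi - 2 * (pi / 5))" by (rule arg_cong[of _ _ cos]) (simp add: field_simps)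
  also have "\<dots> = - cos (2 * (pi / 5))" by (simp only: cos_pi_minus)
  finally have "4 * ?x ^ 3 - 3 * ?x = 1 - 2 * ?x\<^sup>2"
    using cos_treble_cos[of "pi / 5"] cos_double_cos[of "pi / 5"] by simp
  then have "(?x + 1) * ((2 * ?x) * (2 * ?x) - (2 * ?x) - 1) = 0" by algebra
  then have "(2 * ?x) * (2 * ?x) = (2 * ?x) + 1" using pos by simp
  then have "(2 * ?x - gold) * (2 * ?x + gold - 1) = 0" using gold_sq by algebra
  moreover have "gold > 1" unfolding gold_def using real_less_rsqrt[of 1 5] by simp
  ultimately show ?thesis using pos by (smt (verit) mult_eq_0_iff)
qed

text \<open>The quadratic equation of 2 cos 12 degrees over the golden field; its other root is 2
  cos 132 degrees. As gold - 1 is 2 cos 72 degrees, it comes down to cos 24 - cos 84 = cos 36 in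
  degrees.\<close>

lemma cos_pi_fifteenth:
  fixes t defines "t \<equiv> 2 * cos (pi / 15)"
  shows "t * t = (gold - 1) * t + (gold + 1)"
proof -
  let ?a = "pi / 15"
  have "t * t = 2 + 2 * cos (2 * ?a)"
    unfolding t_def using cos_double_cos[of ?a] by (simp add: power2_eq_square)
  have "gold - 1 = 2 * cos (6 * ?a)"
  proof -
    have "cos (6 * ?a) = 2 * (cos (pi / 5))\<^sup>2 - 1" using cos_double_cos[of "pi / 5"] by simp
    then have "2 * cos (6 * ?a) = gold * gold - 2"
      unfolding cos_pi_fifth[symmetric] by (simp add: power2_eq_square)
    then show ?thesis using gold_sq by simp
  qed
  then have "(gold - 1) * t = 4 * (cos (6 * ?a) * cos ?a)" unfolding t_def by simp
  also have "\<dots> = 2 * (cos (5 * ?a) + cos (7 * ?a))" by (simp add: cos_times_cos field_simps)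
  finally have "(gold - 1) * t = 1 + 2 * cos (7 * ?a)" using cos_60 by (simp add: field_simps)
  moreover note \<open>t * t = _\<close>
  moreover have "cos (2 * ?a) - cos (7 * ?a) = gold / 2"
  proof -
    have "cos (2 * ?a) - cos (7 * ?a) = 2 * sin (9 * ?a / 2) * sin (5 * ?a / 2)"
      using cos_diff_cos[of "2 * ?a" "7 * ?a"] by (simp add: field_simps)
    also have "sin (5 * ?a / 2) = 1 / 2" using sin_30 by (simp add: field_simps)
    also have "sin (9 * ?a / 2) = cos (pi / 5)" by (simp add: sin_cos_eq field_simps)
    finally show ?thesis using cos_pi_fifth by simp
  qed
  ultimately show ?thesis by simp
qed

definition zgold :: "int \<Rightarrow> int \<Rightarrow> real" where
  "zgold a b = of_int a + of_int b * gold"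

text \<open>Irrationality of the square root of 5: for nonzero \<open>b\<close> the exponent of the
  prime 5 is even on the left and odd on the right.\<close>

lemma square_eq_5_square:
  fixes a b :: int
  assumes "a\<^sup>2 = 5 * b\<^sup>2"
  shows "b = 0"
proof (rule ccontr)
  assume b: "b \<noteq> 0"
  then have a: "a \<noteq> 0" using assms by auto
  have p: "prime_elem (5::int)" by simp
  have "multiplicity 5 (a\<^sup>2) = 2 * multiplicity 5 a"
    using p a by (simp add: prime_elem_multiplicity_power_distrib)
  moreover have "multiplicity 5 (5 * b\<^sup>2) = Suc (2 * multiplicity 5 b)"
    using p b by (simp add: prime_elem_multiplicity_mult_distrib prime_elem_multiplicity_power_distrib)
  ultimately have "2 * multiplicity 5 a = Suc (2 * multiplicity 5 b)" using assms by simp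
  then show False by presburger
qed

text \<open>Makes the two integer parts unique, so that equality of golden numbers is decided in
  integer arithmetic.\<close>

lemma zgold_eq_0_iff: "zgold a b = 0 \<longleftrightarrow> a = 0 \<and> b = 0"
proof
  assume z: "zgold a b = 0"
  have "of_int (2 * a + b) = of_int (- b) * sqrt 5"
    using z by (simp add: zgold_def gold_def field_simps)
  then have "(of_int (2 * a + b))\<^sup>2 = (of_int b)\<^sup>2 * (5::real)" by (simp add: power_mult_distrib)
  then have "(of_int ((2 * a + b)\<^sup>2) :: real) = of_int (5 * b\<^sup>2)" by simp
  then have "b = 0" using square_eq_5_square by (metis of_int_eq_iff)
  then show "a = 0 \<and> b = 0" using z by (simp add: zgold_def)
qed (simp add: zgold_def)

section \<open>Parity proofs that are single orbits\<close>

text \<open>The label \<open>(j, k)\<close> denotes ray number \<open>k\<close> of orbit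
  \<open>j\<close>; on labels, the rotation \<open>g\<close> is \<open>shift 1\<close>.\<close>

fun shift :: "nat \<Rightarrow> nat \<times> nat \<Rightarrow> nat \<times> nat" where
  "shift t (j, k) = (j, (k + t) mod 15)"

lemma fst_shift [simp]: "fst (shift t i) = fst i"
  by (cases i) simp

lemma shift_shift: "shift s (shift t i) = shift (s + t) i"
  by (cases i) (simp add: mod_simps ac_simps)

lemma shift_image_image: "shift s ` shift t ` C = shift (s + t) ` C"
  by (simp add: image_image shift_shift)

lemma shift_mod: "shift (t mod 15) i = shift t i"
  by (cases i) (simp add: mod_simps)

text \<open>What the count takes from geometry: labels of the rays on which \<open>g\<close> acts by
  \<open>shift 1\<close>, and \<open>N\<close> prime to 15. Freeness is built into the labels, as
  \<open>inj_span\<close> makes the 15 rays of an orbit different.\<close>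

locale cyclic_rays =
  fixes V :: "'a::euclidean_space set" and g :: "'a \<Rightarrow> 'a"
    and e :: "nat \<times> nat \<Rightarrow> 'a" and m N :: nat
  assumes orth_g: "orthogonal_transformation g"
    and V_eq: "V = e ` ({..<m} \<times> {..<15}) \<union> (\<lambda>i. - e i) ` ({..<m} \<times> {..<15})"
    and inj_span: "inj_on (\<lambda>i. span {e i}) ({..<m} \<times> {..<15})"
    and g_e: "\<And>i. i \<in> {..<m} \<times> {..<15} \<Longrightarrow> g (e i) = e (shift 1 i)"
    and coprime_N: "coprime N 15" "N > 0"
begin

definition I :: "(nat \<times> nat) set" where "I = {..<m} \<times> {..<15}"
definition R :: "nat \<times> nat \<Rightarrow> 'a set" where "R i = span {e i}"
definition clique :: "(nat \<times> nat) set \<Rightarrow> bool" where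
  "clique C \<longleftrightarrow> C \<subseteq> I \<and> card C = N \<and> pairwise (\<lambda>i i'. e i \<bullet> e i' = 0) C"
definition even_clique :: "(nat \<times> nat) set \<Rightarrow> bool" where
  "even_clique C \<longleftrightarrow> clique C \<and> (\<forall>j. even (card {k. (j, k) \<in> C}))"
definition orb :: "(nat \<times> nat) set \<Rightarrow> 'a set set set" where
  "orb C = basis_orbit g (R ` C)"

lemma lin_g: "linear g"
  using orth_g by (rule orthogonal_transformation_linear)

lemma shift_I: "i \<in> I \<Longrightarrow> shift t i \<in> I"
  by (cases i) (auto simp: I_def)

lemma shift_15: "i \<in> I \<Longrightarrow> shift (15 * t) i = i"
  by (cases i) (auto simp: I_def)

lemma shift_15_image: "C \<subseteq> I \<Longrightarrow> shift (15 * t) ` C = C"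
proof -
  assume C: "C \<subseteq> I"
  have "shift (15 * t) ` C = (\<lambda>i. i) ` C" by (rule image_cong) (use C shift_15 in blast)+
  then show ?thesis by simp
qed

lemma inj_shift: "inj_on (shift t) I"
proof (rule inj_on_inverseI)
  fix i assume "i \<in> I"
  \<comment> \<open>Modulo 15, \<open>14 * t\<close> is the negative of \<open>t\<close>.\<close>
  then show "shift (14 * t) (shift t i) = i" using shift_15[of i t] by (simp add: shift_shift)
qed

lemma finite_I: "finite I" by (simp add: I_def)

lemma inj_R: "inj_on R I"
  using inj_span by (simp add: I_def R_def inj_on_def)

lemma rays_V: "rays V = R ` I"
proof -
  have "span {- x} = span {x}" for x :: 'a
  proof (rule span_eq[THEN iffD2], intro conjI subsetI)
    show "y \<in> span {x}" if "y \<in> {- x}" for y using that by (simp add: span_neg span_base)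
    show "y \<in> span {- x}" if "y \<in> {x}" for y using that span_neg[of "- x" "{- x}"] by (simp add: span_base)
  qed
  then show ?thesis by (auto simp: rays_def V_eq R_def I_def image_Un image_image)
qed

lemma g_pow_e: "i \<in> I \<Longrightarrow> (g ^^ t) (e i) = e (shift t i)"
proof (induction t)
  case 0
  then show ?case using shift_15[of i 0] by simp
next
  case (Suc t)
  then show ?case using g_e[of "shift t i"] shift_I[of i t] by (simp add: I_def shift_shift)
qed

lemma e_shift_inner: "i \<in> I \<Longrightarrow> i' \<in> I \<Longrightarrow> e (shift t i) \<bullet> e (shift t i') = e i \<bullet> e i'"
proof -
  assume "i \<in> I" "i' \<in> I"
  moreover have "(g ^^ t) x \<bullet> (g ^^ t) y = x \<bullet> y" for x y
    by (induction t) (use orth_g in \<open>auto simp: orthogonal_transformation_def\<close>)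
  ultimately show ?thesis by (metis g_pow_e)
qed

lemma act_basis_R: "C \<subseteq> I \<Longrightarrow> act_basis g (R ` C) = R ` shift 1 ` C"
proof -
  assume C: "C \<subseteq> I"
  have "g ` R i = R (shift 1 i)" if "i \<in> C" for i
    using linear_span_image[OF lin_g, of "{e i}"] g_e[of i] that C by (auto simp: R_def I_def)
  then show ?thesis unfolding act_basis_def image_image by (rule image_cong[OF refl])
qed

lemma act_basis_pow: "C \<subseteq> I \<Longrightarrow> (act_basis g ^^ t) (R ` C) = R ` shift t ` C"
proof (induction t)
  case 0
  then show ?case using shift_15_image[of C 0] by simp
next
  case (Suc t)
  then have "(act_basis g ^^ Suc t) (R ` C) = act_basis g (R ` shift t ` C)" by simp
  also have "\<dots> = R ` shift 1 ` shift t ` C" using Suc.prems shift_I by (intro act_basis_R) auto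
  finally show ?case by (simp only: shift_image_image) simp
qed

lemma orb_eq: "C \<subseteq> I \<Longrightarrow> orb C = range (\<lambda>t. R ` shift t ` C)"
  by (simp add: orb_def basis_orbit_def act_basis_pow)

lemma orb_eq_15: "C \<subseteq> I \<Longrightarrow> orb C = (\<lambda>t. R ` shift t ` C) ` {..<15}"
proof -
  assume C: "C \<subseteq> I"
  have "R ` shift t ` C \<in> (\<lambda>t. R ` shift t ` C) ` {..<15}" for t
    by (rule image_eqI[of _ _ "t mod 15"]) (simp_all add: shift_mod)
  then show ?thesis unfolding orb_eq[OF C] by auto
qed

lemma orb_shift: "C \<subseteq> I \<Longrightarrow> orb (shift t ` C) = orb C"
proof -
  assume C: "C \<subseteq> I"
  then have C': "shift t ` C \<subseteq> I" using shift_I by auto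
  have "R ` shift s ` C \<in> orb (shift t ` C)" for s
  proof -
    have "shift s ` shift (15 * t) ` C = shift (s + 14 * t) ` shift t ` C"
      by (simp add: shift_image_image ac_simps)
    then show ?thesis using shift_15_image[OF C] unfolding orb_eq[OF C'] by auto
  qed
  moreover have "R ` shift s ` shift t ` C \<in> orb C" for s
    unfolding orb_eq[OF C] shift_image_image by blast
  ultimately show ?thesis using orb_eq[OF C] orb_eq[OF C'] by auto
qed

lemma R_orthogonal: "(\<forall>x\<in>R i. \<forall>y\<in>R i'. orthogonal x y) \<longleftrightarrow> e i \<bullet> e i' = 0"
  by (auto simp: R_def span_singleton orthogonal_def)

lemma bases_V: "bases N V = (\<lambda>C. R ` C) ` {C. clique C}"
proof (intro subset_antisym subsetI)
  fix B assume B: "B \<in> bases N V"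
  then have "B \<subseteq> R ` I" by (simp add: bases_def rays_V)
  then obtain C where C: "C \<subseteq> I" "B = R ` C" by (meson subset_imageE)
  have inj: "inj_on R C" using inj_R C(1) by (rule inj_on_subset)
  have "pairwise (\<lambda>i i'. e i \<bullet> e i' = 0) C"
  proof (rule pairwiseI)
    fix i i' assume i: "i \<in> C" "i' \<in> C" "i \<noteq> i'"
    then have "R i \<noteq> R i'" using inj by (auto dest: inj_onD)
    then show "e i \<bullet> e i' = 0"
      using B i(1,2) unfolding bases_def C(2) pairwise_def by (simp add: R_orthogonal)
  qed
  moreover have "card C = N" using B inj C(2) by (simp add: bases_def card_image)
  ultimately show "B \<in> (\<lambda>C. R ` C) ` {C. clique C}" using C by (auto simp: clique_def)
next
  fix B assume "B \<in> (\<lambda>C. R ` C) ` {C. clique C}"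
  then obtain C where C: "clique C" "B = R ` C" by blast
  have inj: "inj_on R C" using inj_R C(1) unfolding clique_def by (blast intro: inj_on_subset)
  then show "B \<in> bases N V"
    using C by (auto simp: bases_def rays_V clique_def card_image pairwise_def R_orthogonal)
qed

lemma clique_shift: "clique C \<Longrightarrow> clique (shift t ` C)"
proof -
  assume C: "clique C"
  then have inj: "inj_on (shift t) C" using inj_shift unfolding clique_def by (blast intro: inj_on_subset)
  have "pairwise (\<lambda>i i'. e i \<bullet> e i' = 0) (shift t ` C)"
  proof (rule pairwiseI)
    fix x y assume "x \<in> shift t ` C" "y \<in> shift t ` C" "x \<noteq> y"
    then obtain i i' where i: "i \<in> C" "i' \<in> C" "i \<noteq> i'" "x = shift t i" "y = shift t i'" by blast
    moreover have "i \<in> I" "i' \<in> I" using C i(1,2) unfolding clique_def by blast+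
    ultimately show "e x \<bullet> e y = 0"
      using C e_shift_inner unfolding clique_def pairwise_def by simp
  qed
  then show ?thesis using C inj shift_I unfolding clique_def by (auto simp: card_image)
qed

text \<open>Shifting by \<open>t\<close> adds \<open>N * t\<close> to the sum of the positions modulo 15, so a basis has no
  nontrivial stabiliser.\<close>

lemma clique_shift_inj:
  assumes C: "clique C" and st: "s \<le> t" "t < 15" "shift s ` C = shift t ` C"
  shows "s = t"
proof -
  have "(\<Sum>i\<in>shift t ` C. snd i) mod 15 = ((\<Sum>i\<in>C. snd i) + N * t) mod 15" for t
  proof -
    have "inj_on (shift t) C" using C inj_shift unfolding clique_def by (blast intro: inj_on_subset)
    then have "(\<Sum>i\<in>shift t ` C. snd i) mod 15 = (\<Sum>i\<in>C. snd (shift t i)) mod 15"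
      by (simp add: sum.reindex)
    also have "\<dots> = (\<Sum>i\<in>C. snd (shift t i) mod 15) mod 15" by (rule mod_sum_eq[symmetric])
    also have "\<dots> = (\<Sum>i\<in>C. (snd i + t) mod 15) mod 15"
      by (rule arg_cong[of _ _ "\<lambda>x. x mod 15"], rule sum.cong) auto
    also have "\<dots> = (\<Sum>i\<in>C. snd i + t) mod 15" by (rule mod_sum_eq)
    also have "(\<Sum>i\<in>C. snd i + t) = (\<Sum>i\<in>C. snd i) + N * t"
      using C by (simp add: sum.distrib clique_def)
    finally show ?thesis .
  qed
  then have "((\<Sum>i\<in>C. snd i) + N * t) mod 15 = ((\<Sum>i\<in>C. snd i) + N * s) mod 15" using st(3) by metis
  then have "15 dvd N * t - N * s" using st(1) by (subst (asm) mod_eq_dvd_iff_nat) auto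
  then have "15 dvd t - s"
    using coprime_N by (simp add: coprime_dvd_mult_right_iff coprime_commute flip: diff_mult_distrib2)
  then show ?thesis using st by (auto dest: dvd_imp_le)
qed

lemma orbit_map_inj: "clique C \<Longrightarrow> inj_on (\<lambda>t. R ` shift t ` C) {..<15}"
proof (rule inj_onI)
  fix s t assume C: "clique C" and st: "s \<in> {..<15}" "t \<in> {..<15}" "R ` shift s ` C = R ` shift t ` C"
  have "shift s ` C \<subseteq> I" "shift t ` C \<subseteq> I" using C shift_I by (auto simp: clique_def)
  then have "shift s ` C = shift t ` C" using st(3) inj_R by (metis inj_on_image_eq_iff)
  then show "s = t" using clique_shift_inj[OF C] st by (metis lessThan_iff nle_le)
qed

lemma card_orb: "clique C \<Longrightarrow> card (orb C) = 15"
  using orbit_map_inj[of C] by (simp add: orb_eq_15 clique_def card_image)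

text \<open>The rotation by \<open>t\<close> brings a member \<open>(j, k')\<close> of
  \<open>C\<close> to \<open>(j, k)\<close> exactly if \<open>t\<close> is \<open>k - k'\<close>
  modulo 15, so each member of \<open>C\<close> in orbit \<open>j\<close> accounts for one basis of
  the orbit.\<close>

lemma count_orb:
  assumes C: "clique C" and jk: "(j, k) \<in> I"
  shows "card {B \<in> orb C. R (j, k) \<in> B} = card {k. (j, k) \<in> C}"
proof -
  have CI: "C \<subseteq> I" using C by (simp add: clique_def)
  let ?T = "{t \<in> {..<15}. (j, k) \<in> shift t ` C}"
  have mem: "R (j, k) \<in> R ` shift t ` C \<longleftrightarrow> (j, k) \<in> shift t ` C" for t
  proof -
    have "shift t ` C \<subseteq> I" using CI shift_I by blast
    then show ?thesis by (rule inj_on_image_mem_iff[OF inj_R jk])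
  qed
  have "{B \<in> orb C. R (j, k) \<in> B} = (\<lambda>t. R ` shift t ` C) ` {t \<in> {..<15}. R (j, k) \<in> R ` shift t ` C}"
    unfolding orb_eq_15[OF CI] by blast
  then have "{B \<in> orb C. R (j, k) \<in> B} = (\<lambda>t. R ` shift t ` C) ` ?T"
    unfolding mem .
  moreover have "inj_on (\<lambda>t. R ` shift t ` C) ?T"
    using orbit_map_inj[OF C] by (rule inj_on_subset) auto
  ultimately have "card {B \<in> orb C. R (j, k) \<in> B} = card ?T"
    by (simp only: card_image)
  also have "card ?T = card {k. (j, k) \<in> C}"
  proof (rule bij_betw_same_card)
    \<comment> \<open>This is \<open>k - t\<close> modulo 15 without truncated subtraction; the map
      is its own inverse.\<close>
    show "bij_betw (\<lambda>t. (k + 15 - t) mod 15) ?T {k. (j, k) \<in> C}" (is "bij_betw ?f _ _")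
    proof (rule bij_betw_byWitness[where f' = ?f])
      have k: "k < 15" using jk by (simp add: I_def)
      have ff: "?f (?f t) = t" if "t < 15" for t
        using k that by (cases "t \<le> k") (auto simp: mod_if)
      have sm: "shift t (j, ?f t) = (j, k)" if "t < 15" for t
        using k that by (simp add: mod_add_left_eq)
      show "\<forall>t\<in>?T. ?f (?f t) = t" using ff by auto
      show "\<forall>k'\<in>{k. (j, k) \<in> C}. ?f (?f k') = k'" using ff CI by (auto simp: I_def)
      show "?f ` ?T \<subseteq> {k. (j, k) \<in> C}"
      proof (rule image_subsetI)
        fix t assume "t \<in> ?T"
        then obtain i where t: "t < 15" and i: "(j, k) = shift t i" "i \<in> C" by blast
        have "i \<in> I" "(j, ?f t) \<in> I" using i(2) CI jk by (auto simp: I_def)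
        then have "i = (j, ?f t)"
          by (rule inj_onD[OF inj_shift trans[OF i(1)[symmetric] sm[OF t, symmetric]]])
        then show "?f t \<in> {k. (j, k) \<in> C}" using i(2) by simp
      qed
      show "?f ` {k. (j, k) \<in> C} \<subseteq> ?T"
      proof (rule image_subsetI)
        fix k' assume "k' \<in> {k. (j, k) \<in> C}"
        then have k': "(j, k') \<in> C" by simp
        then have "k' < 15" using CI by (auto simp: I_def)
        then have "(j, k) = shift (?f k') (j, k')" using sm[of k'] by (simp add: add.commute)
        then have "(j, k) \<in> shift (?f k') ` C" using k' by (rule image_eqI)
        then show "?f k' \<in> ?T" by simp
      qed
    qed
  qed
  finally show ?thesis .
qed

lemma orb_invariant: "C \<subseteq> I \<Longrightarrow> act_basis g ` orb C = orb C"
proof -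
  assume C: "C \<subseteq> I"
  have sub: "shift t ` C \<subseteq> I" for t using C shift_I by auto
  have "act_basis g ` orb C = range (\<lambda>t. R ` shift 1 ` shift t ` C)"
    unfolding orb_eq[OF C] image_image[of "act_basis g"] using act_basis_R[OF sub] by simp
  also have "\<dots> = range (\<lambda>t. R ` shift t ` shift 1 ` C)" by (simp only: shift_image_image add.commute)
  also have "\<dots> = orb (shift 1 ` C)" by (rule orb_eq[OF sub, symmetric])
  finally show ?thesis using orb_shift[OF C] by simp
qed

lemma parity_orb: "clique C \<Longrightarrow> parity_proof N V (orb C) \<longleftrightarrow> even_clique C"
proof -
  assume C: "clique C"
  then have CI: "C \<subseteq> I" by (simp add: clique_def)
  have "orb C \<subseteq> bases N V"
    unfolding bases_V orb_eq[OF CI] using clique_shift[OF C] by auto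
  moreover have "(\<forall>r\<in>rays V. even (card {B \<in> orb C. r \<in> B})) \<longleftrightarrow> (\<forall>(j, k)\<in>I. even (card {k. (j, k) \<in> C}))"
    unfolding rays_V using count_orb[OF C] by auto
  moreover have "\<dots> \<longleftrightarrow> (\<forall>j. even (card {k. (j, k) \<in> C}))"
  proof -
    have "{k. (j, k) \<in> C} = {}" if "j \<notin> {..<m}" for j using that CI by (auto simp: I_def)
    then have "even (card {k. (j, k) \<in> C})" if "j \<notin> {..<m}" for j using that by (metis card.empty even_zero)
    then show ?thesis by (fastforce simp: I_def)
  qed
  ultimately show ?thesis using C by (simp add: parity_proof_def card_orb even_clique_def)
qed

lemma orbit_in_proof:
  assumes S: "S \<in> fifteen_basis_proofs N V g"
  obtains C where "even_clique C" "S = orb C"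
proof -
  have S': "S \<subseteq> bases N V" "act_basis g ` S = S" "card S = 15" "parity_proof N V S"
    using S by (auto simp: fifteen_basis_proofs_def fifteenfold_parity_proof_def parity_proof_def)
  have fin: "finite S" using S'(3) by (metis card.infinite zero_neq_numeral)
  have "S \<noteq> {}" using S'(3) by auto
  then obtain C where C: "clique C" "R ` C \<in> S" using S'(1) unfolding bases_V by blast
  have "(act_basis g ^^ t) (R ` C) \<in> S" for t
    by (induction t) (use C(2) S'(2) in auto)
  then have "orb C \<subseteq> S" unfolding orb_def basis_orbit_def by blast
  then have "S = orb C" using card_orb[OF C(1)] S'(3) fin by (metis card_subset_eq)
  with that S'(4) parity_orb[OF C(1)] show ?thesis by blast
qed

text \<open>\<open>L\<close> is a set of representatives up to rotation. Completeness is asked only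
  for cliques that contain \<open>(j, 0)\<close> with \<open>j\<close> their least orbit, a form
  into which every clique can be rotated.\<close>

theorem fifteen_basis_proofs_eq:
  assumes L: "\<And>C. C \<in> L \<Longrightarrow> even_clique C"
    and complete: "\<And>C j. even_clique C \<Longrightarrow> (j, 0) \<in> C \<Longrightarrow> (\<And>i. i \<in> C \<Longrightarrow> j \<le> fst i) \<Longrightarrow>
      \<exists>D\<in>L. \<exists>t. C = shift t ` D"
    and distinct: "\<And>C D t. C \<in> L \<Longrightarrow> D \<in> L \<Longrightarrow> C = shift t ` D \<Longrightarrow> C = D"
  shows "card (fifteen_basis_proofs N V g) = card L"
    "\<forall>S\<in>fifteen_basis_proofs N V g. \<exists>B\<in>bases N V. S = basis_orbit g B"
proof -
  have sub: "C \<subseteq> I" "clique C" if "even_clique C" for C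
    using that by (auto simp: even_clique_def clique_def)
  have "fifteen_basis_proofs N V g = orb ` L"
  proof (intro subset_antisym subsetI)
    fix S assume "S \<in> fifteen_basis_proofs N V g"
    then obtain C where C: "even_clique C" "S = orb C" by (rule orbit_in_proof)
    have "finite C" using sub[OF C(1)] finite_I finite_subset by blast
    moreover have "C \<noteq> {}" using sub(2)[OF C(1)] coprime_N(2) by (auto simp: clique_def)
    ultimately obtain i where "is_arg_min fst (\<lambda>i. i \<in> C) i"
      using ex_is_arg_min_if_finite by blast
    then have i: "i \<in> C" "\<And>i'. i' \<in> C \<Longrightarrow> fst i \<le> fst i'"
      unfolding is_arg_min_linorder by blast+
    obtain j k where jk: "i = (j, k)" by (cases i)
    let ?C = "shift (15 - k) ` C"
    have k: "k < 15" using i(1) jk sub(1)[OF C(1)] by (auto simp: I_def)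
    have orb: "orb ?C = orb C" using orb_shift sub[OF C(1)] by blast
    have "even_clique ?C"
      using parity_orb[OF clique_shift[OF sub(2)[OF C(1)]]] parity_orb[OF sub(2)[OF C(1)]] orb C(1) by metis
    moreover have "(j, 0) \<in> ?C" using i(1) jk k by (auto intro!: image_eqI[of _ _ "(j, k)"])
    moreover have "j \<le> fst i'" if "i' \<in> ?C" for i' using that i(2) jk by auto
    ultimately obtain D t where D: "D \<in> L" "?C = shift t ` D" using complete by blast
    then have "orb ?C = orb D" using orb_shift sub(1)[OF L] by simp
    with orb C(2) D(1) show "S \<in> orb ` L" by (metis image_eqI)
  next
    fix S assume "S \<in> orb ` L"
    then obtain C where "even_clique C" "S = orb C" using L by blast
    then show "S \<in> fifteen_basis_proofs N V g"
      using sub parity_orb[of C] orb_invariant card_orb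
      by (auto simp: fifteen_basis_proofs_def fifteenfold_parity_proof_def)
  qed
  moreover have "inj_on orb L"
  proof (rule inj_onI)
    fix C D assume CD: "C \<in> L" "D \<in> L" "orb C = orb D"
    note CI = sub(1)[OF L[OF CD(1)]] and DI = sub(1)[OF L[OF CD(2)]]
    have "R ` C \<in> orb C" unfolding orb_eq[OF CI] using shift_15_image[OF CI, of 0] by force
    then obtain t where t: "R ` C = R ` shift t ` D" using CD(3) unfolding orb_eq[OF DI] by blast
    have "shift t ` D \<subseteq> I" using DI shift_I by auto
    then have "C = shift t ` D" using t inj_R CI by (metis inj_on_image_eq_iff)
    then show "C = D" using distinct CD by blast
  qed
  ultimately show "card (fifteen_basis_proofs N V g) = card L" by (simp add: card_image)
  show "\<forall>S\<in>fifteen_basis_proofs N V g. \<exists>B\<in>bases N V. S = basis_orbit g B"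
  proof
    fix S assume "S \<in> fifteen_basis_proofs N V g"
    then obtain C where "even_clique C" "S = orb C" by (rule orbit_in_proof)
    then show "\<exists>B\<in>bases N V. S = basis_orbit g B"
      using sub(2) by (auto simp: bases_V orb_def)
  qed
qed

end

section \<open>Exhaustive search for bases\<close>

text \<open>Rays are offered in the order of their orbits, so those taken from one orbit come in
  consecutive pairs. \<open>Some j\<close> means that a partner in orbit \<open>j\<close> is due;
  once the list has passed this orbit, the branch is dead.\<close>

fun srch :: "(nat \<times> nat \<Rightarrow> nat \<times> nat \<Rightarrow> bool) \<Rightarrow> nat \<Rightarrow> nat option \<Rightarrow> (nat \<times> nat) list
    \<Rightarrow> (nat \<times> nat) list list" where
  "srch adj 0 p xs = [[]]"
| "srch adj (Suc n) p [] = []"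
| "srch adj (Suc n) None (x # xs) =
     map (Cons x) (srch adj n (Some (fst x)) (filter (adj x) xs)) @ srch adj (Suc n) None xs"
| "srch adj (Suc n) (Some j) (x # xs) =
     (if fst x = j
      then map (Cons x) (srch adj n None (filter (adj x) xs)) @ srch adj (Suc n) (Some j) xs
      else [])"

text \<open>The set \<open>C\<close> meets every orbit in an even number of rays, except that one ray of the orbit \<open>j\<close>
  is still missing if \<open>p = Some j\<close>.\<close>

definition parity_state :: "nat option \<Rightarrow> (nat \<times> nat) set \<Rightarrow> bool" where
  "parity_state p C \<longleftrightarrow> (\<forall>j. odd (card {x \<in> C. fst x = j}) \<longleftrightarrow> p = Some j)"

lemma card_fst_remove:
  assumes "finite C" "x \<in> C"
  shows "card {y \<in> C. fst y = j} = card {y \<in> C - {x}. fst y = j} + (if fst x = j then 1 else 0)"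
proof (cases "fst x = j")
  case True
  then have "{y \<in> C. fst y = j} = insert x {y \<in> C - {x}. fst y = j}" using assms by auto
  then show ?thesis using True assms by simp
next
  case False
  then have "{y \<in> C. fst y = j} = {y \<in> C - {x}. fst y = j}" by auto
  then show ?thesis using False by simp
qed

lemma parity_state_take:
  assumes "finite C" "x \<in> C"
  shows "parity_state None C \<Longrightarrow> parity_state (Some (fst x)) (C - {x})"
    "parity_state (Some (fst x)) C \<Longrightarrow> parity_state None (C - {x})"
  unfolding parity_state_def card_fst_remove[OF assms] by (auto split: if_splits)

text \<open>Induction along the search, with \<open>C\<close> the rays still to be taken from
  \<open>xs\<close>. Taking the head changes the parity state as the search does; skipping it leaves
  all assumptions in force.\<close>

lemma srch_complete:
  assumes "sorted (map fst xs)" "C \<subseteq> set xs" "card C = n" "pairwise adj C" "parity_state p C"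
    "\<forall>j. p = Some j \<longrightarrow> (\<forall>x\<in>set xs. j \<le> fst x)"
  shows "\<exists>ys\<in>set (srch adj n p xs). set ys = C"
  using assms
proof (induction adj n p xs arbitrary: C rule: srch.induct)
  case (1 adj p xs)
  then have "C = {}" by (metis card_0_eq finite_subset List.finite_set)
  then show ?case by simp
next
  case (3 adj n x xs)
  have fin: "finite C" using 3(4) finite_subset by blast
  show ?case
  proof (cases "x \<in> C")
    case True
    have "\<exists>ys\<in>set (srch adj n (Some (fst x)) (filter (adj x) xs)). set ys = C - {x}"
    proof (rule 3(1))
      show "C - {x} \<subseteq> set (filter (adj x) xs)" using 3(4,6) True by (auto simp: pairwise_def)
      show "parity_state (Some (fst x)) (C - {x})" using parity_state_take fin True 3(7) by blast
      show "pairwise adj (C - {x})" using 3(6) by (rule pairwise_subset) auto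
      show "sorted (map fst (filter (adj x) xs))" using 3(3) by (simp add: sorted_filter)
    qed (use 3 True fin in auto)
    then obtain ys where ys: "ys \<in> set (srch adj n (Some (fst x)) (filter (adj x) xs))" "set ys = C - {x}"
      by blast
    then have "x # ys \<in> set (srch adj (Suc n) None (x # xs))" by simp
    moreover have "set (x # ys) = C" using ys True by auto
    ultimately show ?thesis by blast
  next
    case False
    have "\<exists>ys\<in>set (srch adj (Suc n) None xs). set ys = C"
      by (rule 3(2)) (use 3 False in auto)
    then show ?thesis by auto
  qed
next
  case (4 adj n j x xs)
  have fin: "finite C" using 4(4) finite_subset by blast
  \<comment> \<open>A partner in orbit \<open>j\<close> is still to come and the list is sorted, so
    the head has not passed this orbit and the branch is not cut off.\<close>
  have "odd (card {y \<in> C. fst y = j})" using 4(7) by (simp add: parity_state_def)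
  then have "{y \<in> C. fst y = j} \<noteq> {}" by (metis card.empty even_zero)
  then obtain y where "y \<in> set (x # xs)" "fst y = j" using 4(4) by blast
  then have "fst x \<le> j" using 4(3) by auto
  then have j: "fst x = j" using 4(8) by (auto intro: antisym)
  show ?case
  proof (cases "x \<in> C")
    case True
    have "\<exists>ys\<in>set (srch adj n None (filter (adj x) xs)). set ys = C - {x}"
    proof (rule 4(1)[OF j])
      show "C - {x} \<subseteq> set (filter (adj x) xs)" using 4(4,6) True by (auto simp: pairwise_def)
      show "parity_state None (C - {x})" using parity_state_take fin True 4(7) j by blast
      show "pairwise adj (C - {x})" using 4(6) by (rule pairwise_subset) auto
      show "sorted (map fst (filter (adj x) xs))" using 4(3) by (simp add: sorted_filter)
    qed (use 4 True fin in auto)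
    then obtain ys where ys: "ys \<in> set (srch adj n None (filter (adj x) xs))" "set ys = C - {x}"
      by blast
    then have "x # ys \<in> set (srch adj (Suc n) (Some j) (x # xs))" using j by simp
    moreover have "set (x # ys) = C" using ys True by auto
    ultimately show ?thesis by blast
  next
    case False
    have "\<exists>ys\<in>set (srch adj (Suc n) (Some j) xs). set ys = C"
      by (rule 4(2)[OF j]) (use 4 False in auto)
    then show ?thesis using j by auto
  qed
qed auto

section \<open>Finite sets as strictly increasing lists\<close>

fun merge_sets :: "'a::linorder list \<Rightarrow> 'a list \<Rightarrow> 'a list" where
  "merge_sets [] ys = ys"
| "merge_sets (x # xs) [] = x # xs"
| "merge_sets (x # xs) (y # ys) =
     (if x < y then x # merge_sets xs (y # ys)
      else if y < x then y # merge_sets (x # xs) ys else x # merge_sets xs ys)"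

fun merge_pairs :: "'a::linorder list list \<Rightarrow> 'a list list" where
  "merge_pairs (xs # ys # xss) = merge_sets xs ys # merge_pairs xss"
| "merge_pairs xss = xss"

lemma length_merge_pairs: "length (merge_pairs xss) \<le> length xss"
  by (induction xss rule: merge_pairs.induct) auto

function merge_all :: "'a::linorder list list \<Rightarrow> 'a list" where
  "merge_all [] = []"
| "merge_all [xs] = xs"
| "merge_all (xs # ys # xss) = merge_all (merge_pairs (xs # ys # xss))"
  by pat_completeness auto
termination
  by (relation "Wellfounded.measure length") (auto simp: less_Suc_eq_le intro: length_merge_pairs)

definition single :: "'a \<Rightarrow> 'a list" where "single x = [x]"

text \<open>A normal form: evaluation compares finite sets as lists and reads off their size as a
  length.\<close>

definition canon :: "'a::linorder list \<Rightarrow> 'a list" where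
  "canon xs = merge_all (map single xs)"

lemma set_merge_sets: "set (merge_sets xs ys) = set xs \<union> set ys"
  by (induction xs ys rule: merge_sets.induct) auto

lemma strict_merge_sets:
  "sorted_wrt (<) xs \<Longrightarrow> sorted_wrt (<) ys \<Longrightarrow> sorted_wrt (<) (merge_sets xs ys)"
  by (induction xs ys rule: merge_sets.induct) (auto simp: set_merge_sets)

lemma set_merge_pairs: "\<Union> (set ` set (merge_pairs xss)) = \<Union> (set ` set xss)"
  by (induction xss rule: merge_pairs.induct) (auto simp: set_merge_sets)

lemma strict_merge_pairs:
  "\<forall>xs\<in>set xss. sorted_wrt (<) xs \<Longrightarrow> \<forall>xs\<in>set (merge_pairs xss). sorted_wrt (<) xs"
  by (induction xss rule: merge_pairs.induct) (auto simp: strict_merge_sets)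

lemma set_merge_all: "set (merge_all xss) = \<Union> (set ` set xss)"
proof (induction xss rule: merge_all.induct)
  case (3 xs ys xss)
  then show ?case by (simp only: merge_all.simps set_merge_pairs)
qed auto

lemma strict_merge_all: "\<forall>xs\<in>set xss. sorted_wrt (<) xs \<Longrightarrow> sorted_wrt (<) (merge_all xss)"
proof (induction xss rule: merge_all.induct)
  case (3 xs ys xss)
  then show ?case using strict_merge_pairs[of "xs # ys # xss"] by (metis merge_all.simps(3))
qed auto

lemma set_canon [simp]: "set (canon xs) = set xs"
  by (auto simp: canon_def set_merge_all single_def)

lemma strict_canon: "sorted_wrt (<) (canon xs)"
  unfolding canon_def by (rule strict_merge_all) (auto simp: single_def)

lemma sorted_canon: "sorted (canon xs)" and distinct_canon: "distinct (canon xs)"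
  using strict_canon[of xs] by (simp_all add: strict_sorted_iff)

text \<open>Decides at the first differing entry; the default code equations also compare the tails.\<close>

lemma less_list_lazy [code]:
  fixes xs ys :: "'a::{equal, order} list"
  shows "xs < ([] :: 'a list) \<longleftrightarrow> False" "[] < x # xs \<longleftrightarrow> True"
    "x # xs < y # ys \<longleftrightarrow> (if x = y then xs < ys else x < y)"
  by simp_all

section \<open>Vectors over the golden integers\<close>

text \<open>The flat list \<open>[a\<^sub>1, b\<^sub>1, a\<^sub>2, b\<^sub>2, \<dots>]\<close> stands for the vector with coordinates
  \<open>(a\<^sub>i + b\<^sub>i * gold) / 2\<close>.\<close>

fun zdot :: "int list \<Rightarrow> int list \<Rightarrow> int \<times> int" where
  "zdot (a # b # x) (c # d # y) =
     (case zdot x y of (p, q) \<Rightarrow> (a * c + b * d + p, a * d + b * c + b * d + q))"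
| "zdot _ _ = (0, 0)"

text \<open>The vector \<open>y - (p + q * gold) * x\<close>, multiplied out with gold^2 = gold +
  1.\<close>

fun zaxpy :: "int \<Rightarrow> int \<Rightarrow> int list \<Rightarrow> int list \<Rightarrow> int list" where
  "zaxpy p q (a # b # x) (c # d # y) =
     (c - (p * a + q * b)) # (d - (p * b + q * a + q * b)) # zaxpy p q x y"
| "zaxpy _ _ _ _ = []"

text \<open>If \<open>zdot a a = (2 * h, 0)\<close>, the coefficient 2 (x, a) / (a, a) of a
  reflection is \<open>zdot x a\<close> divided by \<open>h\<close>, as the scaling of
  \<open>zdot\<close> cancels. \<open>zrefl_ok\<close> states that both integer divisions are
  exact.\<close>

definition zrefl :: "int \<Rightarrow> int list \<Rightarrow> int list \<Rightarrow> int list" where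
  "zrefl h a x = (case zdot x a of (p, q) \<Rightarrow> zaxpy (p div h) (q div h) a x)"

definition zrefl_ok :: "int \<Rightarrow> int list \<Rightarrow> int list \<Rightarrow> bool" where
  "zrefl_ok h a x = (case zdot x a of (p, q) \<Rightarrow> p mod h = 0 \<and> q mod h = 0)"

fun zcox :: "int \<Rightarrow> int list list \<Rightarrow> int list \<Rightarrow> int list" where
  "zcox h [] x = x"
| "zcox h (a # as) x = zrefl h a (zcox h as x)"

fun zcox_ok :: "int \<Rightarrow> int list list \<Rightarrow> int list \<Rightarrow> bool" where
  "zcox_ok h [] x = True"
| "zcox_ok h (a # as) x = (zcox_ok h as x \<and> zrefl_ok h a (zcox h as x))"

fun itp :: "'a::real_vector list \<Rightarrow> int list \<Rightarrow> 'a" where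
  "itp (b # bs) (p # q # x) = (zgold p q / 2) *\<^sub>R b + itp bs x"
| "itp _ _ = 0"

fun onb :: "'a::real_inner list \<Rightarrow> bool" where
  "onb [] = True"
| "onb (b # bs) = (b \<bullet> b = 1 \<and> (\<forall>b'\<in>set bs. b \<bullet> b' = 0) \<and> onb bs)"

definition zval :: "int \<times> int \<Rightarrow> real" where
  "zval z = zgold (fst z) (snd z)"

lemma zgold_mult: "zgold a b * zgold c d = zgold (a * c + b * d) (a * d + b * c + b * d)"
  unfolding zgold_def using gold_sq by (simp add: algebra_simps) algebra

lemma zgold_add: "zgold a b + zgold c d = zgold (a + c) (b + d)"
  and zgold_diff: "zgold a b - zgold c d = zgold (a - c) (b - d)"
  and zgold_minus: "- zgold a b = zgold (- a) (- b)"
  by (simp_all add: zgold_def algebra_simps)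

lemma zval_eq_0_iff: "zval z = 0 \<longleftrightarrow> z = (0, 0)"
  by (cases z) (simp add: zval_def zgold_eq_0_iff)

lemma inner_itp_perp: "\<forall>b'\<in>set bs. b \<bullet> b' = 0 \<Longrightarrow> b \<bullet> itp bs x = 0"
  by (induction bs x rule: itp.induct) (auto simp: inner_add_right)

lemma list_pair_induct [consumes 2, case_names Nil Cons]:
  assumes "length x = 2 * length bs" "length y = 2 * length bs" "P [] [] []"
    and "\<And>b bs p q x c d y. length x = 2 * length bs \<Longrightarrow> length y = 2 * length bs \<Longrightarrow> P bs x y \<Longrightarrow>
      P (b # bs) (p # q # x) (c # d # y)"
  shows "P bs x y"
  using assms(1,2)
proof (induction bs arbitrary: x y)
  case Nil
  then show ?case using assms(3) by simp
next
  case (Cons b bs)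
  obtain p q x' where x: "x = p # q # x'" using Cons.prems(1) by (cases x; cases "tl x") auto
  obtain c d y' where y: "y = c # d # y'" using Cons.prems(2) by (cases y; cases "tl y") auto
  show ?case using assms(4)[OF _ _ Cons.IH, of x' y'] Cons.prems x y by simp
qed

lemma inner_itp:
  assumes "length x = 2 * length bs" "length y = 2 * length bs" "onb bs"
  shows "itp bs x \<bullet> itp bs y = zval (zdot x y) / 4"
  using assms
proof (induction bs x y rule: list_pair_induct)
  case (Cons b bs p q x c d y)
  have "itp (b # bs) (p # q # x) \<bullet> itp (b # bs) (c # d # y) =
      zgold p q * zgold c d / 4 + itp bs x \<bullet> itp bs y"
    using Cons.prems inner_itp_perp[of bs b x] inner_itp_perp[of bs b y]
    by (simp add: inner_add_left inner_add_right inner_commute)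
  also have "\<dots> = zval (zdot (p # q # x) (c # d # y)) / 4"
    using Cons by (simp add: zval_def zgold_mult split: prod.split) (simp add: zgold_def field_simps)
  finally show ?case .
qed (simp add: zval_def zgold_def)

lemma itp_zaxpy:
  assumes "length x = 2 * length bs" "length y = 2 * length bs"
  shows "itp bs (zaxpy p q x y) = itp bs y - zgold p q *\<^sub>R itp bs x"
  using assms
proof (induction bs x y rule: list_pair_induct)
  case (Cons b bs a a' x c c' y)
  have "zgold (c - (p * a + q * a')) (c' - (p * a' + q * a + q * a')) = zgold c c' - zgold p q * zgold a a'"
    by (simp add: zgold_mult zgold_diff)
  then show ?case
    using Cons.IH by (simp add: scaleR_left_diff_distrib scaleR_right_distrib diff_divide_distrib)
qed simp

lemma length_zaxpy:
  assumes "length x = 2 * length bs" "length y = 2 * length bs"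
  shows "length (zaxpy p q x y) = 2 * length bs"
  using assms by (induction bs x y rule: list_pair_induct) auto

lemma inj_itp:
  assumes "length x = 2 * length bs" "length y = 2 * length bs" "onb bs" "itp bs x = itp bs y"
  shows "x = y"
  using assms
proof (induction bs x y rule: list_pair_induct)
  case (Cons b bs p q x c d y)
  have "b \<bullet> itp (b # bs) (p # q # x) = b \<bullet> itp (b # bs) (c # d # y)" using Cons.prems by simp
  then have "zgold p q = zgold c d"
    using Cons.prems(1) inner_itp_perp[of bs b x] inner_itp_perp[of bs b y] by (simp add: inner_add_right)
  then have "p = c" "q = d" using zgold_eq_0_iff[of "p - c" "q - d"] zgold_diff[of p q c d] by auto
  then show ?case using Cons by simp
qed simp

lemma itp_uminus: "itp bs (map uminus x) = - itp bs x"
proof (induction bs x rule: itp.induct)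
  case (1 b bs p q x)
  have "zgold (- p) (- q) = - zgold p q" by (simp add: zgold_minus)
  with 1 show ?case by simp
qed auto

lemma itp_zrefl:
  assumes "length a = 2 * length bs" "length x = 2 * length bs" "onb bs"
    and "h > 0" "zdot a a = (2 * h, 0)" "zrefl_ok h a x"
  shows "itp bs (zrefl h a x) = reflection (itp bs a) (itp bs x)"
proof -
  obtain p q where pq: "zdot x a = (p, q)" by fastforce
  have "h dvd p" "h dvd q" using assms(6) pq by (auto simp: zrefl_ok_def)
  then obtain p' q' where pq': "p = h * p'" "q = h * q'" by (auto elim!: dvdE)
  have aa: "itp bs a \<bullet> itp bs a = of_int h / 2"
    using inner_itp[OF assms(1,1,3)] assms(5) by (simp add: zval_def zgold_def)
  have xa: "itp bs x \<bullet> itp bs a = of_int h * zgold p' q' / 4"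
    using inner_itp[OF assms(2,1,3)] pq pq' by (simp add: zval_def zgold_def algebra_simps)
  have "2 * (itp bs x \<bullet> itp bs a) / (itp bs a \<bullet> itp bs a) = zgold p' q'"
    unfolding aa xa using assms(4) by simp
  moreover have "zrefl h a x = zaxpy p' q' a x" using pq pq' assms(4) by (simp add: zrefl_def)
  ultimately show ?thesis using itp_zaxpy[OF assms(1,2)] by (simp add: reflection_def)
qed

lemma length_zrefl:
  assumes "length a = 2 * length bs" "length x = 2 * length bs"
  shows "length (zrefl h a x) = 2 * length bs"
  using length_zaxpy[OF assms] by (simp add: zrefl_def split: prod.split)

lemma itp_zcox:
  assumes "\<forall>a\<in>set as. length a = 2 * length bs \<and> zdot a a = (2 * h, 0)" "onb bs" "h > 0"
    and "length x = 2 * length bs" "zcox_ok h as x"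
  shows "itp bs (zcox h as x) = refl_prod (map (itp bs) as) (itp bs x)
    \<and> length (zcox h as x) = 2 * length bs"
  using assms(1,5)
proof (induction as)
  case (Cons a as)
  then show ?case using assms itp_zrefl[of a bs "zcox h as x" h] length_zrefl[of a bs "zcox h as x" h] by simp
qed (simp add: assms)

text \<open>Inner products with dual vectors isolate the coefficients. This yields independence and
  also the expansion of a root in simple roots without solving a linear system.\<close>

lemma dual_basis:
  fixes as ds :: "'a::euclidean_space list"
  assumes "length as = DIM('a)" "length ds = length as" "K \<noteq> 0"
    and dual: "\<And>i j. i < length as \<Longrightarrow> j < length as \<Longrightarrow> ds ! i \<bullet> as ! j = (if i = j then K else 0)"
  shows "distinct as" "independent (set as)" "span (set as) = UNIV"
    and "\<And>x. \<exists>k. x = (\<Sum>a\<in>set as. k a *\<^sub>R a) \<and> (\<forall>i<length as. k (as ! i) = (x \<bullet> ds ! i) / K)"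
proof -
  let ?n = "length as"
  show d: "distinct as"
    unfolding distinct_conv_nth using dual \<open>K \<noteq> 0\<close> by metis
  have coef: "ds ! i \<bullet> (\<Sum>j<?n. u j *\<^sub>R as ! j) = K * u i" if "i < ?n" for i u
  proof -
    have "ds ! i \<bullet> (\<Sum>j<?n. u j *\<^sub>R as ! j) = (\<Sum>j<?n. if j = i then K * u i else 0)"
      unfolding inner_sum_right by (rule sum.cong) (use dual that in auto)
    then show ?thesis using that by simp
  qed
  have sum_eq: "(\<Sum>a\<in>set as. u a *\<^sub>R a) = (\<Sum>j<?n. u (as ! j) *\<^sub>R as ! j)" for u
    using bij_betw_nth[OF d refl refl] by (rule sum.reindex_bij_betw[symmetric])
  show ind: "independent (set as)"
  proof (rule independent_if_scalars_zero)
    fix u x assume u: "(\<Sum>a\<in>set as. u a *\<^sub>R a) = 0" and x: "x \<in> set as"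
    then obtain i where i: "i < ?n" "x = as ! i" by (metis in_set_conv_nth)
    then have "K * u (as ! i) = 0" using coef[of i "\<lambda>j. u (as ! j)"] u by (simp add: sum_eq)
    then show "u x = 0" using i \<open>K \<noteq> 0\<close> by simp
  qed simp
  show sp: "span (set as) = UNIV"
    using ind d assms(1) card_eq_dim[of "set as" UNIV] by (auto simp: distinct_card)
  fix x
  have "x \<in> span (set as)" using sp by simp
  then obtain u where u: "x = (\<Sum>a\<in>set as. u a *\<^sub>R a)" by (auto simp: span_finite)
  then have x: "x = (\<Sum>j<?n. u (as ! j) *\<^sub>R as ! j)" by (simp add: sum_eq)
  have "u (as ! i) = (x \<bullet> ds ! i) / K" if "i < ?n" for i
  proof -
    have "ds ! i \<bullet> x = K * u (as ! i)" using coef[OF that, of "\<lambda>j. u (as ! j)"] x by metis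
    then show ?thesis using \<open>K \<noteq> 0\<close> by (simp add: inner_commute)
  qed
  with u show "\<exists>k. x = (\<Sum>a\<in>set as. k a *\<^sub>R a) \<and> (\<forall>i<?n. k (as ! i) = (x \<bullet> ds ! i) / K)"
    by blast
qed

section \<open>Conditions decided by evaluation\<close>

definition length_ok :: "nat \<Rightarrow> int list \<Rightarrow> bool" where
  "length_ok n x \<longleftrightarrow> length x = 2 * n"

definition norm_ok :: "int \<times> int \<Rightarrow> int list \<Rightarrow> bool" where
  "norm_ok z x \<longleftrightarrow> zdot x x = z"

text \<open>The lists of vertices and roots below contain one vector of each antipodal pair, normalised by
  \<open>posn\<close>.\<close>

fun neg_lead :: "int list \<Rightarrow> bool" where
  "neg_lead [] \<longleftrightarrow> False"
| "neg_lead (a # x) \<longleftrightarrow> (if a = 0 then neg_lead x else a < 0)"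

definition posn :: "int list \<Rightarrow> int list" where
  "posn x = (if neg_lead x then map uminus x else x)"

definition zrefl_pos :: "int \<Rightarrow> int list \<Rightarrow> int list \<Rightarrow> int list" where
  "zrefl_pos h a x = posn (zrefl h a x)"

definition closed_ok :: "int \<Rightarrow> int list list \<Rightarrow> int list \<Rightarrow> bool" where
  "closed_ok h X a \<longleftrightarrow> list_all (zrefl_ok h a) X \<and> canon (map (zrefl_pos h a) X) = X"

definition gram_ok :: "int \<Rightarrow> int list list \<Rightarrow> int list list \<Rightarrow> bool" where
  "gram_ok K D A \<longleftrightarrow> length D = length A \<and>
     (\<forall>i\<in>set [0..<length A]. \<forall>j\<in>set [0..<length A].
        zdot (D ! i) (A ! j) = (if i = j then (K, 0) else (0, 0)))"

text \<open>Nonnegative integer parts are a sufficient condition for a nonnegative golden number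
  that avoids comparing irrationals. With \<open>D\<close> dual to the simple roots, the numbers
  tested are the coefficients of \<open>x\<close> up to a positive factor.\<close>

fun nonneg_coeffs :: "int list list \<Rightarrow> int list \<Rightarrow> bool" where
  "nonneg_coeffs [] x \<longleftrightarrow> True"
| "nonneg_coeffs (d # D) x \<longleftrightarrow> (case zdot x d of (p, q) \<Rightarrow> 0 \<le> p \<and> 0 \<le> q) \<and> nonneg_coeffs D x"

definition root_ok :: "int list list \<Rightarrow> int list \<Rightarrow> bool" where
  "root_ok D x \<longleftrightarrow> nonneg_coeffs D x \<or> nonneg_coeffs D (map uminus x)"

fun leafy_ok :: "int list list \<Rightarrow> bool" where
  "leafy_ok [] \<longleftrightarrow> True"
| "leafy_ok (a # A) \<longleftrightarrow> leafy_ok A \<and> length (filter (\<lambda>b. zdot a b \<noteq> (0, 0)) A) \<le> 1"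

definition zrot :: "int \<Rightarrow> int list list \<Rightarrow> int list \<Rightarrow> int list" where
  "zrot h A x = zcox h A (zcox h A x)"

fun zorbit :: "nat \<Rightarrow> int \<Rightarrow> int list list \<Rightarrow> int list \<Rightarrow> int list list" where
  "zorbit 0 h A x = []"
| "zorbit (Suc n) h A x = x # zorbit n h A (zrot h A x)"

definition orbits :: "int \<Rightarrow> int list list \<Rightarrow> int list list \<Rightarrow> int list list list" where
  "orbits h A reps = map (zorbit 15 h A) reps"

text \<open>Can be asked of vectors and not just of rays: the 15th power of the rotation is the 30th
  power of the Coxeter element, the identity.\<close>

definition cyclic_ok :: "int \<Rightarrow> int list list \<Rightarrow> int list list \<Rightarrow> bool" where
  "cyclic_ok h A q \<longleftrightarrow> zrot h A (last q) = hd q"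

text \<open>The listed vertices cover all antipodal pairs, and for \<open>X\<close> without
  repetitions their number leaves no room for a coincidence. So the orbits are disjoint and consist
  of 15 different rays.\<close>

definition orbits_ok :: "int \<Rightarrow> int list list \<Rightarrow> int list list \<Rightarrow> int list list list \<Rightarrow> bool" where
  "orbits_ok h A X Os \<longleftrightarrow> list_all (cyclic_ok h A) Os \<and>
     canon (map posn (concat Os)) = X \<and> length X = 15 * length Os"

text \<open>If \<open>e\<^sub>k\<close> is the image of \<open>e\<^sub>0\<close> under the \<open>k\<close>-th power of the Coxeter element \<open>c\<close>, the linear relation
  between the \<open>e\<^sub>k\<close> says that \<open>y = e\<^sub>0 + e\<^sub>2 - (gold - 1) e\<^sub>1 + 2 cos (pi / 15) e\<^sub>1\<close> satisfies
  \<open>c (c y) + y = 2 cos (pi / 15) c y\<close>, so \<open>y\<close> spans with \<open>c y\<close> the Coxeter plane. As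
  \<open>2 cos (pi / 15)\<close> has degree 2 over the golden field, a vertex that is not orthogonal to \<open>e\<^sub>1\<close> is
  not orthogonal to \<open>y\<close> either.\<close>

definition plane_vector_ok :: "int list list \<Rightarrow> int list \<Rightarrow> int list \<Rightarrow> int list \<Rightarrow> int list \<Rightarrow> int list \<Rightarrow> bool" where
  "plane_vector_ok X e0 e1 e2 e3 e4 \<longleftrightarrow>
     (\<forall>x\<in>set X. zdot x e1 \<noteq> (0, 0)) \<and>
     (\<forall>y\<in>set (zaxpy (-1) 1 e3 (zaxpy (-1) 1 e1 (zaxpy (-1) 1 e2 (zaxpy (-1) 0 e4 e0)))). y = 0)"

definition plane_ok :: "int \<Rightarrow> int list list \<Rightarrow> int list list \<Rightarrow> int list \<Rightarrow> bool" where
  "plane_ok h A X e \<longleftrightarrow>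
     zcox_ok h A e \<and> zcox_ok h A (zcox h A e) \<and> zcox_ok h A (zrot h A e) \<and> zcox_ok h A (zcox h A (zrot h A e)) \<and>
     plane_vector_ok X e (zcox h A e) (zrot h A e) (zcox h A (zrot h A e)) (zrot h A (zrot h A e))"

definition orth_vec :: "int list \<Rightarrow> int list \<Rightarrow> bool" where
  "orth_vec x y \<longleftrightarrow> zdot x y = (0, 0)"

definition tab_entry :: "int list list \<Rightarrow> int list list \<Rightarrow> bool list" where
  "tab_entry o1 o2 = map (orth_vec (hd o1)) o2"

definition tab_row :: "int list list list \<Rightarrow> int list list \<Rightarrow> bool list list" where
  "tab_row Os o1 = map (tab_entry o1) Os"

definition tab :: "int list list list \<Rightarrow> bool list list list" where
  "tab Os = map (tab_row Os) Os"

text \<open>The entry \<open>T ! j ! j' ! d\<close> tells whether the rays \<open>(j, 0)\<close> and \<open>(j', d)\<close> are orthogonal; the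
  other pairs are obtained by rotation.\<close>

fun tadj :: "bool list list list \<Rightarrow> nat \<times> nat \<Rightarrow> nat \<times> nat \<Rightarrow> bool" where
  "tadj T (j, k) (j', k') = T ! j ! j' ! (if k \<le> k' then k' - k else k' + 15 - k)"

definition positions :: "nat \<Rightarrow> (nat \<times> nat) list" where
  "positions j = map (Pair j) [0..<15]"

text \<open>The ray \<open>(j, 0)\<close> is taken in advance: \<open>N - 1\<close> rays remain, and
  a partner in orbit \<open>j\<close> is due.\<close>

definition bases_from :: "nat \<Rightarrow> nat \<Rightarrow> bool list list list \<Rightarrow> nat \<Rightarrow> (nat \<times> nat) list list" where
  "bases_from m N T j = map (Cons (j, 0))
     (srch (tadj T) (N - 1) (Some j) (filter (tadj T (j, 0)) (concat (map positions [j..<m]))))"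

text \<open>Lists of numbers carry the lexicographic linear order that \<open>canon\<close>
  requires.\<close>

definition code_pos :: "nat \<times> nat \<Rightarrow> nat list" where
  "code_pos i = [fst i, snd i]"

definition code_basis :: "(nat \<times> nat) list \<Rightarrow> nat list list" where
  "code_basis B = canon (map code_pos B)"

definition code_shift :: "(nat \<times> nat) list \<Rightarrow> nat \<Rightarrow> nat list list" where
  "code_shift B t = code_basis (map (shift t) B)"

definition code_orbit :: "(nat \<times> nat) list \<Rightarrow> nat list list list" where
  "code_orbit B = map (code_shift B) [0..<15]"

text \<open>The entry \<open>(i, t)\<close> of a certificate says that the basis found by the search is \<open>L ! i\<close> rotated
  \<open>t\<close> times.\<close>

definition cert_basis :: "(nat \<times> nat) list list \<Rightarrow> nat \<times> nat \<Rightarrow> nat list list" where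
  "cert_basis L it = code_shift (L ! fst it) (snd it)"

definition even_in :: "(nat \<times> nat) list \<Rightarrow> nat \<times> nat \<Rightarrow> bool" where
  "even_in B i \<longleftrightarrow> even (length (filter (\<lambda>i'. fst i' = fst i) B))"

definition adj_all :: "bool list list list \<Rightarrow> (nat \<times> nat) list \<Rightarrow> nat \<times> nat \<Rightarrow> bool" where
  "adj_all T B i \<longleftrightarrow> (\<forall>i'\<in>set B. i = i' \<or> tadj T i i')"

definition basis_ok :: "nat \<Rightarrow> nat \<Rightarrow> bool list list list \<Rightarrow> (nat \<times> nat) list \<Rightarrow> bool" where
  "basis_ok m N T B \<longleftrightarrow> distinct B \<and> length B = N \<and> (\<forall>i\<in>set B. fst i < m \<and> snd i < 15) \<and>
     list_all (adj_all T B) B \<and> list_all (even_in B) B"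

text \<open>The certificate follows the order in which the search finds its bases. A basis is found
  once for each ray in its least orbit, in different rotations, so \<open>cert\<close> can be longer
  than \<open>L\<close>. The last condition makes all rotations of all members of \<open>L\<close>
  different.\<close>

definition proofs_ok :: "nat \<Rightarrow> nat \<Rightarrow> (nat \<times> nat) list list \<Rightarrow> (nat \<times> nat) list \<Rightarrow> bool list list list \<Rightarrow> bool" where
  "proofs_ok m N L cert T \<longleftrightarrow> list_all (basis_ok m N T) L \<and> (\<forall>it\<in>set cert. fst it < length L) \<and>
     map (cert_basis L) cert = map code_basis (concat (map (bases_from m N T) [0..<m])) \<and>
     length (canon (concat (map code_orbit L))) = 15 * length L"

definition tabulated_proofs_ok ::
  "nat \<Rightarrow> (nat \<times> nat) list list \<Rightarrow> (nat \<times> nat) list \<Rightarrow> int list list list \<Rightarrow> bool" where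
  "tabulated_proofs_ok N L cert Os = proofs_ok (length Os) N L cert (tab Os)"

definition geometry_ok where
  "geometry_ok n h K z A D e R X \<longleftrightarrow>
     list_all (length_ok n) X \<and> list_all (length_ok n) R \<and> list_all (length_ok n) A \<and>
     list_all (length_ok n) D \<and> length_ok n e \<and> 0 < h \<and> 0 < K \<and> 0 < fst z \<and> 0 \<le> snd z \<and>
     list_all (norm_ok z) X \<and> list_all (norm_ok (2 * h, 0)) R \<and>
     list_all (closed_ok h X) A \<and> list_all (closed_ok h R) A \<and>
     (\<forall>a\<in>set A. posn a \<in> set R) \<and> length A = n \<and>
     gram_ok K D A \<and> list_all (root_ok D) R \<and> leafy_ok A \<and>
     plane_ok h A X e"

definition counting_ok where
  "counting_ok N L cert h A X Os \<longleftrightarrow> orbits_ok h A X Os \<and> tabulated_proofs_ok N L cert Os"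

section \<open>Geometry of the coordinate models\<close>

text \<open>For nonzero \<open>q\<close> the number 2 cos (pi / 15) would be golden, and the
  discriminant 6 + 3 gold of its quadratic equation a square in the golden field. The norm of 6 + 3
  gold is 45, so 5 would be a rational square.\<close>

lemma fifteenth_cosine_independent:
  assumes "zval p + 2 * cos (pi / 15) * zval q = 0"
  shows "q = (0, 0)"
proof -
  obtain a b c d where pq: "p = (a, b)" "q = (c, d)" by (cases p, cases q)
  let ?t = "2 * cos (pi / 15)" and ?P = "zgold a b" and ?Q = "zgold c d" and ?g = "zgold (-1) 1"
  have 0: "?P + ?t * ?Q = 0" using assms by (simp add: zval_def pq)
  have t: "?t * ?t = ?g * ?t + (?g + 2)"
    using cos_pi_fifteenth by (simp add: zgold_def)
  have "(2 * ?P + ?g * ?Q) * (2 * ?P + ?g * ?Q) = (?g * ?g + 4 * ?g + 8) * (?Q * ?Q)"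
    using 0 t by algebra
  moreover have "?g * ?g + 4 * ?g + 8 = zgold 6 3"
    unfolding zgold_def using gold_sq by (simp add: algebra_simps)
  moreover obtain m n where "2 * ?P + ?g * ?Q = zgold m n"
  proof
    show "2 * ?P + ?g * ?Q = zgold (2 * a + (d - c)) (2 * b + c)"
      unfolding zgold_mult by (simp add: zgold_def algebra_simps)
  qed
  ultimately have "zgold m n * zgold m n = zgold 6 3 * (?Q * ?Q)" by simp
  then have "zgold (m * m + n * n - (6 * (c * c + d * d) + 3 * (2 * c * d + d * d)))
      (2 * m * n + n * n - (3 * (c * c + d * d) + 9 * (2 * c * d + d * d))) = 0"
    unfolding zgold_mult by (simp add: zgold_def algebra_simps)
  then have e: "m * m + n * n = 6 * (c * c + d * d) + 3 * (2 * c * d + d * d)"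
    "2 * m * n + n * n = 3 * (c * c + d * d) + 9 * (2 * c * d + d * d)"
    unfolding zgold_eq_0_iff by linarith+
  \<comment> \<open>Norms of both sides: that of m + n gold is m^2 + m n - n^2, and 45 = 5 *
    3^2.\<close>
  have "(m * m + m * n - n * n)\<^sup>2 = 5 * (3 * (c * c + c * d - d * d))\<^sup>2"
    using e by algebra
  then have "c * c + c * d - d * d = 0" using square_eq_5_square by fastforce
  \<comment> \<open>Completing the square in four times the norm of
    \<open>c + d * gold\<close>.\<close>
  then have "(2 * c + d)\<^sup>2 = 5 * d\<^sup>2" by algebra
  then have "d = 0" by (rule square_eq_5_square)
  with \<open>c * c + c * d - d * d = 0\<close> show ?thesis by (simp add: pq)
qed

lemma refl_prod_in_grp: "set bs \<subseteq> D \<Longrightarrow> refl_prod bs \<in> refl_grp D"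
  by (induction bs) (auto intro: refl_grp.step simp: refl_grp.id[unfolded id_def] id_def)

lemma leafy_itp:
  assumes "leafy_ok A" "\<forall>a\<in>set A. length a = 2 * length bs" "onb bs"
  shows "leafy (map (itp bs) A)"
  using assms(1,2)
proof (induction A)
  case (Cons a A)
  obtain b0 where b0: "\<forall>b\<in>set A. b \<noteq> b0 \<longrightarrow> zdot a b = (0, 0)"
  proof (cases "filter (\<lambda>b. zdot a b \<noteq> (0, 0)) A")
    case Nil
    then have "\<forall>b\<in>set A. zdot a b = (0, 0)" by (simp add: filter_empty_conv)
    then show ?thesis by (intro that[of a]) blast
  next
    case (Cons b l)
    then have f: "filter (\<lambda>b. zdot a b \<noteq> (0, 0)) A = [b]" using Cons.prems(1) by simp
    have "c = b" if "c \<in> set A" "zdot a c \<noteq> (0, 0)" for c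
    proof -
      have "c \<in> set (filter (\<lambda>b. zdot a b \<noteq> (0, 0)) A)" using that by simp
      then show ?thesis unfolding f by simp
    qed
    then show ?thesis by (intro that[of b]) blast
  qed
  have "orthogonal (itp bs a) (itp bs b)" if b: "b \<in> set A" "itp bs b \<noteq> itp bs b0" for b
  proof -
    have "b \<noteq> b0" using b(2) by auto
    then have "zdot a b = (0, 0)" using b(1) b0 by simp
    then show ?thesis
      using inner_itp[of a bs b] Cons.prems(2) b(1) assms(3) by (simp add: orthogonal_def zval_def zgold_def)
  qed
  moreover have "leafy (map (itp bs) A)" using Cons by simp
  ultimately show ?case by auto
qed simp

lemma zorbit_nth: "k < n \<Longrightarrow> zorbit n h A x ! k = (zrot h A ^^ k) x"
proof (induction n arbitrary: k x)
  case (Suc n)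
  then show ?case by (cases k) (simp_all add: funpow_swap1)
qed simp

lemma length_zorbit [simp]: "length (zorbit n h A x) = n"
  by (induction n arbitrary: x) auto

lemma nonneg_coeffs_D: "nonneg_coeffs D x \<Longrightarrow> d \<in> set D \<Longrightarrow> 0 \<le> zval (zdot x d)"
proof (induction D)
  case (Cons d' D)
  have "0 \<le> zgold p q" if "0 \<le> p" "0 \<le> q" for p q
    using that gold_pos by (simp add: zgold_def)
  then show ?case using Cons by (auto simp: zval_def)
qed simp

lemma canon_eq_iff: "canon xs = canon ys \<longleftrightarrow> set xs = set ys"
proof
  assume "canon xs = canon ys"
  then show "set xs = set ys" by (metis set_canon)
next
  assume "set xs = set ys"
  then show "canon xs = canon ys"
    by (intro sorted_distinct_set_unique) (simp_all add: sorted_canon distinct_canon)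
qed

lemma inj_code_pos: "inj code_pos"
  by (auto simp: inj_on_def code_pos_def prod_eq_iff)

lemma code_basis_eq_iff: "code_basis B = code_basis C \<longleftrightarrow> set B = set C"
  by (simp add: code_basis_def canon_eq_iff inj_image_eq_iff[OF inj_code_pos])

lemma span_eq_same_norm:
  fixes x y :: "'a::real_inner"
  assumes "span {x} = span {y}" "norm x = norm y"
  shows "x = y \<or> x = - y"
proof -
  have "x \<in> span {y}" using assms(1) by (metis insertI1 span_base)
  then obtain c where c: "x = c *\<^sub>R y" by (auto simp: span_singleton)
  show ?thesis
  proof (cases "y = 0")
    case False
    then have "\<bar>c\<bar> = 1" using assms(2) c by simp
    then show ?thesis using c by (auto simp: abs_if split: if_splits)
  qed (simp add: c)
qed

lemma uminus_uminus_list [simp]: "map uminus (map uminus x) = (x :: int list)"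
  by (induction x) auto

lemma neg_lead_uminus: "neg_lead (map uminus x) \<longleftrightarrow> \<not> neg_lead x \<and> map uminus x \<noteq> x"
  by (induction x) auto

lemma posn_uminus: "posn (map uminus x) = posn x"
  by (auto simp: posn_def neg_lead_uminus)

lemma zdot_uminus:
  "zdot (map uminus x) y = (- fst (zdot x y), - snd (zdot x y))"
  "zdot x (map uminus y) = (- fst (zdot x y), - snd (zdot x y))"
  by (induction x y rule: zdot.induct) (auto split: prod.splits)

definition sym_set :: "int list list \<Rightarrow> int list set" where
  "sym_set Y = set Y \<union> map uminus ` set Y"

lemma sym_set_posn: "posn x \<in> set Y \<Longrightarrow> x \<in> sym_set Y"
  unfolding sym_set_def posn_def by (metis UnI1 UnI2 image_eqI uminus_uminus_list)

lemma sym_set_uminus: "x \<in> sym_set Y \<Longrightarrow> map uminus x \<in> sym_set Y"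
  unfolding sym_set_def by (metis UnCI UnE image_iff uminus_uminus_list)

lemma sym_setE:
  assumes "x \<in> sym_set Y"
  obtains "x \<in> set Y" | y where "y \<in> set Y" "x = map uminus y"
  using assms unfolding sym_set_def by blast

text \<open>One model for three polytopes: \<open>A\<close> are simple roots with dual vectors
  \<open>D\<close>, \<open>X\<close> and \<open>R\<close> the vertices and roots up to sign, and
  \<open>e\<close> yields the Coxeter plane. The large computations enter through
  \<open>model\<close> and \<open>cyclic\<close>, which each instance evaluates.\<close>

locale golden_model =
  fixes bs :: "'a::euclidean_space list" and h K :: int and z :: "int \<times> int"
    and A D R X reps :: "int list list" and e :: "int list"
    and N :: nat and L :: "(nat \<times> nat) list list" and cert :: "(nat \<times> nat) list"
  assumes onb_bs: "onb bs" and len_bs: "length bs = DIM('a)"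
    and distinct_X: "distinct X"
    and model: "geometry_ok (length bs) h K z A D e R X"
    and cyclic: "counting_ok N L cert h A X (orbits h A reps)"
    and coprime_N: "coprime N 15" "N > 0"
begin

definition V :: "'a set" where "V = itp bs ` sym_set X"
definition \<Phi> :: "'a set" where "\<Phi> = itp bs ` sym_set R"
definition as :: "'a list" where "as = map (itp bs) A"
definition c0 :: "'a \<Rightarrow> 'a" where "c0 = refl_prod as"
definition Os :: "int list list list" where "Os = orbits h A reps"

lemma lengths:
  shows len_X: "x \<in> sym_set X \<Longrightarrow> length x = 2 * length bs"
    and len_R: "x \<in> sym_set R \<Longrightarrow> length x = 2 * length bs"
    and len_A: "x \<in> set A \<Longrightarrow> length x = 2 * length bs"
    and len_D: "x \<in> set D \<Longrightarrow> length x = 2 * length bs"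
    and len_e: "length e = 2 * length bs"
    and h_pos: "h > 0" and K_pos: "K > 0"
  using model by (auto simp: geometry_ok_def list_all_iff length_ok_def elim!: sym_setE)

lemma zdot_R: "a \<in> sym_set R \<Longrightarrow> zdot a a = (2 * h, 0)"
  and zdot_X: "x \<in> sym_set X \<Longrightarrow> zdot x x = z"
  using model by (auto simp: geometry_ok_def list_all_iff norm_ok_def zdot_uminus elim!: sym_setE)

lemma A_R: "set A \<subseteq> sym_set R"
  using model by (auto simp: geometry_ok_def intro: sym_set_posn)

lemma zval_z: "zval z > 0"
  using model gold_pos by (auto simp: geometry_ok_def zval_def zgold_def intro!: add_pos_nonneg)

text \<open>One vector of each antipodal pair has been checked. For its negative, exactness of the
  division follows from \<open>zdot_uminus\<close>, and membership is transferred by linearity of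
  the reflection and injectivity of \<open>itp\<close>.\<close>

lemma zrefl_closed:
  assumes "Y = X \<or> Y = R" "a \<in> set A" "x \<in> sym_set Y"
  shows "zrefl h a x \<in> sym_set Y" "itp bs (zrefl h a x) = reflection (itp bs a) (itp bs x)"
proof -
  have len: "length y = 2 * length bs" if "y \<in> sym_set Y" for y
    using assms(1) len_X len_R that by blast
  have aa: "zdot a a = (2 * h, 0)" using assms(2) A_R zdot_R by blast
  have closed: "closed_ok h Y a" using assms model by (auto simp: geometry_ok_def list_all_iff)
  then have ok: "zrefl_ok h a y" if "y \<in> set Y" for y
    using that by (auto simp: closed_ok_def list_all_iff)
  have "canon (map (zrefl_pos h a) Y) = Y" using closed by (simp add: closed_ok_def)
  then have "zrefl_pos h a ` set Y = set Y" by (metis set_canon set_map)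
  then have mem: "zrefl h a y \<in> sym_set Y" if "y \<in> set Y" for y
    using that by (intro sym_set_posn) (auto simp: zrefl_pos_def)
  have ref: "itp bs (zrefl h a y) = reflection (itp bs a) (itp bs y)"
    if "y \<in> sym_set Y" "zrefl_ok h a y" for y
    using that len len_A[OF assms(2)] onb_bs h_pos aa by (intro itp_zrefl)
  have "zrefl h a x \<in> sym_set Y \<and> itp bs (zrefl h a x) = reflection (itp bs a) (itp bs x)"
    using assms(3)
  proof (cases rule: sym_setE)
    case 1
    then show ?thesis using mem ok ref assms(3) by blast
  next
    case (2 y)
    have y: "y \<in> sym_set Y" using 2(1) by (simp add: sym_set_def)
    have "zrefl_ok h a x"
      using ok[OF 2(1)] unfolding 2(2) zrefl_ok_def zdot_uminus by (auto simp: mod_eq_0_iff_dvd split: prod.splits)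
    then have x: "itp bs (zrefl h a x) = reflection (itp bs a) (itp bs x)" using ref assms(3) by blast
    have "itp bs (zrefl h a x) = itp bs (map uminus (zrefl h a y))"
      unfolding x itp_uminus ref[OF y ok[OF 2(1)]] unfolding 2(2) itp_uminus
      using reflection_linear by (rule linear_neg)
    moreover have "length (zrefl h a x) = 2 * length bs" "length (zrefl h a y) = 2 * length bs"
      using len len_A[OF assms(2)] y assms(3) length_zrefl by blast+
    ultimately have "zrefl h a x = map uminus (zrefl h a y)" using inj_itp onb_bs by (metis length_map)
    then show ?thesis using x mem[OF 2(1)] sym_set_uminus by metis
  qed
  then show "zrefl h a x \<in> sym_set Y" "itp bs (zrefl h a x) = reflection (itp bs a) (itp bs x)" by auto
qed

lemma reflection_image:
  assumes "Y = X \<or> Y = R" "a \<in> set as"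
  shows "reflection a ` itp bs ` sym_set Y = itp bs ` sym_set Y"
proof -
  obtain a' where a': "a' \<in> set A" "a = itp bs a'" using assms(2) by (auto simp: as_def)
  have sub: "reflection a ` itp bs ` sym_set Y \<subseteq> itp bs ` sym_set Y"
  proof (unfold image_image, rule image_subsetI)
    fix x assume "x \<in> sym_set Y"
    then show "reflection a (itp bs x) \<in> itp bs ` sym_set Y"
      using zrefl_closed[OF assms(1) a'(1)] a'(2) by (metis image_eqI)
  qed
  have "x \<in> reflection a ` itp bs ` sym_set Y" if "x \<in> itp bs ` sym_set Y" for x
    using sub that by (metis image_eqI image_subset_iff reflection_reflection)
  with sub show ?thesis by blast
qed

lemma reflection_V: "a \<in> set as \<Longrightarrow> reflection a ` V = V"
  and reflection_\<Phi>: "a \<in> set as \<Longrightarrow> reflection a ` \<Phi> = \<Phi>"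
  unfolding V_def \<Phi>_def using reflection_image by blast+

text \<open>Closure of the vertices under the simple reflections carries exactness of the divisions
  along the whole word.\<close>

lemma zcox_X:
  assumes "x \<in> sym_set X"
  shows "zcox h A x \<in> sym_set X" "itp bs (zcox h A x) = c0 (itp bs x)"
proof -
  have "zcox h B x \<in> sym_set X \<and> itp bs (zcox h B x) = refl_prod (map (itp bs) B) (itp bs x)"
    if "set B \<subseteq> set A" for B
    using that
  proof (induction B)
    case (Cons b B)
    then show ?case using zrefl_closed[of X b "zcox h B x"] by simp
  qed (simp add: assms)
  then show "zcox h A x \<in> sym_set X" "itp bs (zcox h A x) = c0 (itp bs x)"
    by (auto simp: c0_def as_def)
qed

lemma zrot_X:
  assumes "x \<in> sym_set X"
  shows "zrot h A x \<in> sym_set X" "itp bs (zrot h A x) = (c0 \<circ> c0) (itp bs x)"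
  using zcox_X[OF zcox_X(1)[OF assms]] zcox_X[OF assms] by (simp_all add: zrot_def)

lemma c0_grp: "c0 \<in> refl_grp (set as)"
  unfolding c0_def by (rule refl_prod_in_grp) simp

lemma c0_orthogonal: "orthogonal_transformation c0"
  using c0_grp by (rule refl_grp_orthogonal)

lemma c0_V: "c0 ` V = V"
  using c0_grp reflection_V by (rule refl_grp_image)

lemma length_D: "length D = length A" and length_A: "length A = DIM('a)"
  using model len_bs by (auto simp: geometry_ok_def gram_ok_def)

lemma dual_as:
  assumes "i < length as" "j < length as"
  shows "map (itp bs) D ! i \<bullet> as ! j = (if i = j then K / 4 else 0)"
proof -
  have "i < length A" "j < length A" using assms by (simp_all add: as_def)
  then have "zdot (D ! i) (A ! j) = (if i = j then (K, 0) else (0, 0))"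
    using model by (auto simp: geometry_ok_def gram_ok_def)
  then show ?thesis
    using inner_itp[of "D ! i" bs "A ! j"] \<open>i < length A\<close> \<open>j < length A\<close> length_D len_A len_D onb_bs
    by (cases "i = j") (simp_all add: as_def zval_def zgold_def)
qed

lemma basis_as: "distinct as" "independent (set as)" "span (set as) = UNIV"
  and coeffs_as: "\<exists>k. x = (\<Sum>a\<in>set as. k a *\<^sub>R a) \<and>
    (\<forall>i<length as. k (as ! i) = (x \<bullet> map (itp bs) D ! i) / (K / 4))"
proof -
  have "length as = DIM('a)" "length (map (itp bs) D) = length as" "K / 4 \<noteq> 0"
    using length_A length_D K_pos by (simp_all add: as_def)
  note * = dual_basis[OF this dual_as]
  show "distinct as" "independent (set as)" "span (set as) = UNIV"
    "\<exists>k. x = (\<Sum>a\<in>set as. k a *\<^sub>R a) \<and>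
      (\<forall>i<length as. k (as ! i) = (x \<bullet> map (itp bs) D ! i) / (K / 4))"
    using * by blast+
qed

lemma nonneg_combination:
  assumes "length x = 2 * length bs" "nonneg_coeffs D x"
  shows "\<exists>k. (\<forall>a\<in>set as. 0 \<le> k a) \<and> itp bs x = (\<Sum>a\<in>set as. k a *\<^sub>R a)"
proof -
  obtain k where k: "itp bs x = (\<Sum>a\<in>set as. k a *\<^sub>R a)"
    "\<forall>i<length as. k (as ! i) = (itp bs x \<bullet> map (itp bs) D ! i) / (K / 4)"
    using coeffs_as by blast
  have "0 \<le> k (as ! i)" if "i < length as" for i
  proof -
    have i: "i < length D" using that length_D by (simp add: as_def)
    then have "itp bs x \<bullet> map (itp bs) D ! i = zval (zdot x (D ! i)) / 4"
      using inner_itp[of x bs "D ! i"] assms(1) len_D onb_bs by simp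
    then have "0 \<le> itp bs x \<bullet> map (itp bs) D ! i" using nonneg_coeffs_D[OF assms(2), of "D ! i"] i by simp
    then show ?thesis using k(2) that K_pos by simp
  qed
  then have "\<forall>a\<in>set as. 0 \<le> k a" by (metis in_set_conv_nth)
  then show ?thesis using k(1) by blast
qed

lemma simple_system_as: "simple_system \<Phi> (set as)"
proof -
  have "\<exists>k. (\<forall>a\<in>set as. 0 \<le> k a) \<and> (x = (\<Sum>a\<in>set as. k a *\<^sub>R a) \<or> x = - (\<Sum>a\<in>set as. k a *\<^sub>R a))"
    if "x \<in> \<Phi>" for x
  proof -
    obtain r where r: "r \<in> sym_set R" "x = itp bs r" using \<open>x \<in> \<Phi>\<close> by (auto simp: \<Phi>_def)
    then have "root_ok D r \<or> root_ok D (map uminus r)"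
      using model by (auto simp: geometry_ok_def list_all_iff elim!: sym_setE)
    then have "root_ok D r" by (auto simp: root_ok_def)
    then consider "nonneg_coeffs D r" | "nonneg_coeffs D (map uminus r)" by (auto simp: root_ok_def)
    then show ?thesis
    proof cases
      case 1
      then show ?thesis using nonneg_combination[of r] r len_R by blast
    next
      case 2
      then obtain k where "\<forall>a\<in>set as. 0 \<le> k a" "- x = (\<Sum>a\<in>set as. k a *\<^sub>R a)"
        using nonneg_combination[of "map uminus r"] r len_R itp_uminus[of bs r] by auto
      then show ?thesis by (metis minus_minus)
    qed
  qed
  moreover have "set as \<subseteq> \<Phi>" using A_R by (auto simp: as_def \<Phi>_def)
  ultimately show ?thesis using basis_as(2) unfolding simple_system_def by blast
qed

lemma norm_\<Phi>: "x \<in> \<Phi> \<Longrightarrow> norm x = sqrt (h / 2)"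
proof -
  assume "x \<in> \<Phi>"
  then obtain r where r: "r \<in> sym_set R" "x = itp bs r" by (auto simp: \<Phi>_def)
  then have "x \<bullet> x = h / 2"
    using inner_itp[of r bs r] len_R onb_bs zdot_R by (simp add: zval_def zgold_def)
  then show ?thesis by (simp add: norm_eq_sqrt_inner)
qed

lemma leafy_as: "leafy as"
  unfolding as_def using model len_A onb_bs by (intro leafy_itp) (auto simp: geometry_ok_def)

lemma coxeter_element_conjugate:
  assumes "coxeter_element \<Phi> c"
  obtains w where "w \<in> refl_grp (set as)" "c \<circ> w = w \<circ> c0"
proof -
  have "finite \<Phi>" by (simp add: \<Phi>_def sym_set_def)
  then show ?thesis
    using coxeter_elements_conjugate[OF _ simple_system_as basis_as(3,1) leafy_as norm_\<Phi> _ reflection_\<Phi> assms]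
      h_pos that unfolding c0_def by auto
qed

text \<open>With s = gold - 1 and t = 2 cos (pi / 15), the witness \<open>y\<close> arises from e by
  c0^2 - (s - t) c0 + 1. Applying c0^2 - t c0 + 1 to it gives the quartic that was checked to kill
  e, because t^2 = s t + s + 2.\<close>

lemma plane_vector:
  obtains y where "c0 (c0 y) + y = (2 * cos (pi / 15)) *\<^sub>R c0 y" "\<forall>v\<in>V. v \<bullet> y \<noteq> 0"
proof -
  let ?e1 = "zcox h A e" and ?e2 = "zrot h A e"
  let ?e3 = "zcox h A ?e2" and ?e4 = "zrot h A ?e2"
  have A': "\<forall>a\<in>set A. length a = 2 * length bs \<and> zdot a a = (2 * h, 0)"
    using len_A A_R zdot_R by blast
  have ok: "zcox_ok h A e" "zcox_ok h A ?e1" "zcox_ok h A ?e2" "zcox_ok h A ?e3"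
    and pv: "plane_vector_ok X e ?e1 ?e2 ?e3 ?e4"
    using model by (auto simp: geometry_ok_def plane_ok_def)
  note cox = itp_zcox[OF A' onb_bs h_pos, folded as_def, folded c0_def]
  have e1: "itp bs ?e1 = c0 (itp bs e)" "length ?e1 = 2 * length bs" using cox[OF len_e ok(1)] by auto
  have e2: "itp bs ?e2 = c0 (itp bs ?e1)" "length ?e2 = 2 * length bs"
    using cox[OF e1(2) ok(2)] by (auto simp: zrot_def)
  have e3: "itp bs ?e3 = c0 (itp bs ?e2)" "length ?e3 = 2 * length bs" using cox[OF e2(2) ok(3)] by auto
  have e4: "itp bs ?e4 = c0 (itp bs ?e3)" "length ?e4 = 2 * length bs"
    using cox[OF e3(2) ok(4)] by (auto simp: zrot_def)
  let ?E = "\<lambda>x. itp bs x" and ?g = "gold - 1" and ?t = "2 * cos (pi / 15)"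
  have zero: "itp bs l = 0" if "\<forall>y\<in>set l. y = 0" for l :: "int list"
    using that by (induction bs l rule: itp.induct) (auto simp: zgold_def)
  have g: "zgold (- 1) 1 = ?g" "zgold (- 1) 0 = - 1" by (simp_all add: zgold_def)
  define l where "l = zaxpy (-1) 1 ?e3 (zaxpy (-1) 1 ?e1 (zaxpy (-1) 1 ?e2 (zaxpy (-1) 0 ?e4 e)))"
  have "itp bs l = ?E e + ?E ?e4 - ?g *\<^sub>R ?E ?e2 - ?g *\<^sub>R ?E ?e1 - ?g *\<^sub>R ?E ?e3"
    unfolding l_def using e1(2) e2(2) e3(2) e4(2) len_e by (simp add: itp_zaxpy length_zaxpy g)
  moreover have "itp bs l = 0" using pv by (intro zero) (simp add: plane_vector_ok_def l_def)
  ultimately have rel: "?E e + ?E ?e4 = ?g *\<^sub>R ?E ?e1 + ?g *\<^sub>R ?E ?e2 + ?g *\<^sub>R ?E ?e3"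
    by (simp add: algebra_simps)
  define y where "y = ?E e + ?E ?e2 - ?g *\<^sub>R ?E ?e1 + ?t *\<^sub>R ?E ?e1"
  have lin: "linear c0" using c0_orthogonal by (rule orthogonal_transformation_linear)
  have cy: "c0 y = ?E ?e1 + ?E ?e3 - ?g *\<^sub>R ?E ?e2 + ?t *\<^sub>R ?E ?e2"
    unfolding y_def using lin by (simp only: linear_add linear_diff linear_cmul e1(1)[symmetric] e2(1)[symmetric] e3(1)[symmetric])
  have ccy: "c0 (c0 y) = ?E ?e2 + ?E ?e4 - ?g *\<^sub>R ?E ?e3 + ?t *\<^sub>R ?E ?e3"
    unfolding cy using lin by (simp only: linear_add linear_diff linear_cmul e2(1)[symmetric] e3(1)[symmetric] e4(1)[symmetric])
  have "c0 (c0 y) + y = (?E e + ?E ?e4) + 2 *\<^sub>R ?E ?e2 - ?g *\<^sub>R ?E ?e1 - ?g *\<^sub>R ?E ?e3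
      + ?t *\<^sub>R ?E ?e1 + ?t *\<^sub>R ?E ?e3"
    unfolding ccy unfolding y_def by (simp add: scaleR_2)
  also have "\<dots> = (?g + 2) *\<^sub>R ?E ?e2 + ?t *\<^sub>R ?E ?e1 + ?t *\<^sub>R ?E ?e3"
    unfolding rel by (simp add: scaleR_left_distrib scaleR_left_diff_distrib scaleR_2)
  also have "?g + 2 = ?t * ?t - ?t * ?g" using cos_pi_fifteenth by (simp add: algebra_simps)
  also have "(?t * ?t - ?t * ?g) *\<^sub>R ?E ?e2 + ?t *\<^sub>R ?E ?e1 + ?t *\<^sub>R ?E ?e3 = ?t *\<^sub>R c0 y"
    unfolding cy by (simp only: scaleR_right_distrib scaleR_right_diff_distrib scaleR_left_diff_distrib scaleR_scaleR)
      (simp add: right_diff_distrib scaleR_left_diff_distrib)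
  finally have "c0 (c0 y) + y = ?t *\<^sub>R c0 y" .
  moreover have "v \<bullet> y \<noteq> 0" if "v \<in> V" for v
  proof
    assume 0: "v \<bullet> y = 0"
    obtain x where x: "x \<in> sym_set X" "v = itp bs x" using \<open>v \<in> V\<close> by (auto simp: V_def)
    have ip: "v \<bullet> itp bs l = zval (zdot x l) / 4" if "length l = 2 * length bs" for l
      using inner_itp[OF len_X[OF x(1)] that onb_bs] x(2) by simp
    \<comment> \<open>The part without t is a golden integer, so
      \<open>fifteenth_cosine_independent\<close> applies.\<close>
    have "\<exists>p. 4 * (v \<bullet> ?E e + v \<bullet> ?E ?e2 - ?g * (v \<bullet> ?E ?e1)) = zval p"
    proof -
      obtain a1 a2 b1 b2 c1 c2 where "zdot x e = (a1, a2)" "zdot x ?e2 = (b1, b2)" "zdot x ?e1 = (c1, c2)"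
        by (metis surj_pair)
      then have "4 * (v \<bullet> ?E e + v \<bullet> ?E ?e2 - ?g * (v \<bullet> ?E ?e1)) =
          zgold a1 a2 + zgold b1 b2 - zgold (- 1) 1 * zgold c1 c2"
        using ip[OF len_e] ip[OF e1(2)] ip[OF e2(2)] by (simp add: zval_def g algebra_simps)
      then show ?thesis
        unfolding zgold_mult zgold_add zgold_diff zval_def by (metis fst_conv snd_conv)
    qed
    then obtain p where "4 * (v \<bullet> ?E e + v \<bullet> ?E ?e2 - ?g * (v \<bullet> ?E ?e1)) = zval p" by blast
    moreover have "4 * (v \<bullet> ?E ?e1) = zval (zdot x ?e1)" using ip[OF e1(2)] by simp
    moreover have "4 * (v \<bullet> y) = 4 * (v \<bullet> ?E e + v \<bullet> ?E ?e2 - ?g * (v \<bullet> ?E ?e1)) + ?t * (4 * (v \<bullet> ?E ?e1))"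
      unfolding y_def by (simp add: inner_add_right inner_diff_right)
    ultimately have "zval p + ?t * zval (zdot x ?e1) = 0" using 0 by simp
    then have "zdot x ?e1 = (0, 0)" by (rule fifteenth_cosine_independent)
    then show False using pv x(1) by (auto simp: plane_vector_ok_def zdot_uminus prod_eq_iff elim!: sym_setE)
  qed
  ultimately show ?thesis using that by blast
qed

text \<open>A vertex projecting to the origin would be orthogonal to the whole plane and so to
  \<open>y\<close>. This excludes degenerate polygons and makes \<open>c0 \<circ> c0\<close> a
  fifteen-fold rotation.\<close>

lemma V_nonempty: "V \<noteq> {} \<Longrightarrow> \<exists>P. fifteenfold_rotation V \<Phi> P (c0 \<circ> c0)"
proof -
  assume "V \<noteq> {}"
  obtain y where y: "c0 (c0 y) + y = (2 * cos (pi / 15)) *\<^sub>R c0 y" "\<forall>v\<in>V. v \<bullet> y \<noteq> 0"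
    by (rule plane_vector)
  have "y \<noteq> 0" using y(2) \<open>V \<noteq> {}\<close> by auto
  have \<theta>: "0 < pi / 15" "pi / 15 < pi" by (simp_all add: field_simps)
  obtain u v where uv: "y \<in> span {u, v}" "orthonormal_frame (span {u, v}) u v"
    "c0 u = cos (pi / 15) *\<^sub>R u + sin (pi / 15) *\<^sub>R v" "c0 v = - sin (pi / 15) *\<^sub>R u + cos (pi / 15) *\<^sub>R v"
    using rotation_plane[OF c0_orthogonal \<open>y \<noteq> 0\<close> y(1) \<theta>] .
  have nz: "x \<bullet> u \<noteq> 0 \<or> x \<bullet> v \<noteq> 0" if x: "x \<in> V" for x
  proof (rule ccontr)
    assume "\<not> ?thesis"
    then have "\<forall>q\<in>{u, v}. orthogonal x q" by (auto simp: orthogonal_def)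
    then have "orthogonal x y" using uv(1) by (meson orthogonal_to_span)
    then show False using y(2) x by (simp add: orthogonal_def)
  qed
  note plane = coxeter_plane[OF c0_orthogonal uv(2-4) c0_V nz]
  have "orthogonal_transformation (c0 \<circ> c0)"
    using c0_orthogonal by (intro orthogonal_transformation_compose)
  moreover have "(c0 \<circ> c0) ` V = V" by (simp only: image_comp[symmetric] c0_V)
  moreover have "coxeter_element \<Phi> c0"
    unfolding coxeter_element_def using basis_as(1) simple_system_as by (auto simp: c0_def refl_prod_def)
  ultimately show ?thesis unfolding fifteenfold_rotation_def using plane by blast
qed

end

section \<open>Labels of the rays and the count of proofs\<close>

context golden_model begin

definition I0 :: "(nat \<times> nat) set" where "I0 = {..<length Os} \<times> {..<15}"
definition vertex :: "nat \<times> nat \<Rightarrow> int list" where "vertex i = Os ! fst i ! snd i"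

lemma orbits_ok: "orbits_ok h A X Os" and proofs_ok: "proofs_ok (length Os) N L cert (tab Os)"
  using cyclic by (auto simp: counting_ok_def tabulated_proofs_ok_def Os_def)

lemma length_Os_nth: "j < length Os \<Longrightarrow> length (Os ! j) = 15"
  by (simp add: Os_def orbits_def)

lemma vertex_Suc: "j < length Os \<Longrightarrow> Suc k < 15 \<Longrightarrow> vertex (j, Suc k) = zrot h A (vertex (j, k))"
  by (simp add: vertex_def Os_def orbits_def zorbit_nth)

lemma zrot_vertex:
  assumes "i \<in> I0"
  shows "zrot h A (vertex i) = vertex (shift 1 i)"
proof -
  obtain j k where i: "i = (j, k)" "j < length Os" "k < 15" using assms by (auto simp: I0_def)
  show ?thesis
  proof (cases "Suc k < 15")
    case True
    then show ?thesis using vertex_Suc[of j k] i by simp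
  next
    case False
    then have k: "k = 14" using i by simp
    have ne: "Os ! j \<noteq> []" using length_Os_nth[OF i(2)] by auto
    have "cyclic_ok h A (Os ! j)" using orbits_ok i(2) by (auto simp: orbits_ok_def list_all_iff)
    then show ?thesis
      using i k length_Os_nth[OF i(2)] ne by (simp add: cyclic_ok_def vertex_def last_conv_nth hd_conv_nth)
  qed
qed

lemma set_Os: "set (concat Os) = vertex ` I0"
proof (intro subset_antisym subsetI)
  fix x assume "x \<in> set (concat Os)"
  then obtain q where "q \<in> set Os" "x \<in> set q" by auto
  then obtain j where j: "j < length Os" "x \<in> set (Os ! j)" by (metis in_set_conv_nth)
  then obtain k where "k < 15" "x = Os ! j ! k" using length_Os_nth[OF j(1)] by (metis in_set_conv_nth)
  then show "x \<in> vertex ` I0" using j(1) by (auto simp: vertex_def I0_def intro!: image_eqI[of _ _ "(j, k)"])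
next
  fix x assume "x \<in> vertex ` I0"
  then obtain j k where "j < length Os" "k < 15" "x = Os ! j ! k" by (auto simp: vertex_def I0_def)
  then show "x \<in> set (concat Os)" using length_Os_nth by (auto intro!: bexI[of _ "Os ! j"])
qed

lemma set_X: "set X = posn ` vertex ` I0"
proof -
  have "X = canon (map posn (concat Os))" using orbits_ok by (simp add: orbits_ok_def)
  then have "set X = set (map posn (concat Os))" by (metis set_canon)
  then show ?thesis by (simp only: set_map set_Os)
qed

lemma finite_I0: "finite I0" by (simp add: I0_def)

text \<open>A surjection onto a set of the same finite cardinality is injective; this replaces a
  comparison of all pairs of labels.\<close>

lemma inj_vertex: "inj_on (\<lambda>i. posn (vertex i)) I0"
proof -
  have "card (set X) = card I0"
    using orbits_ok distinct_card[OF distinct_X] by (simp add: orbits_ok_def I0_def)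
  then show ?thesis unfolding set_X image_image by (rule eq_card_imp_inj_on[OF finite_I0])
qed

lemma vertex_X: "i \<in> I0 \<Longrightarrow> vertex i \<in> sym_set X"
  by (rule sym_set_posn) (simp add: set_X)

lemma V_vertex: "V = (\<lambda>i. itp bs (vertex i)) ` I0 \<union> (\<lambda>i. - itp bs (vertex i)) ` I0"
proof
  show "V \<subseteq> (\<lambda>i. itp bs (vertex i)) ` I0 \<union> (\<lambda>i. - itp bs (vertex i)) ` I0"
    unfolding V_def sym_set_def set_X by (auto simp: posn_def itp_uminus)
  show "(\<lambda>i. itp bs (vertex i)) ` I0 \<union> (\<lambda>i. - itp bs (vertex i)) ` I0 \<subseteq> V"
    unfolding V_def using vertex_X sym_set_uminus by (auto simp flip: itp_uminus)
qed

lemma itp_vertex_eq: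
  assumes "i \<in> I0" "i' \<in> I0" "itp bs (vertex i) = itp bs (vertex i') \<or> itp bs (vertex i) = - itp bs (vertex i')"
  shows "i = i'"
proof -
  have len: "length (vertex i) = 2 * length bs" "length (vertex i') = 2 * length bs"
    using vertex_X assms(1,2) len_X by blast+
  have "vertex i = vertex i' \<or> vertex i = map uminus (vertex i')"
    using assms(3) len onb_bs inj_itp unfolding itp_uminus[symmetric] by (metis length_map)
  then have "posn (vertex i) = posn (vertex i')" by (auto simp: posn_uminus)
  then show ?thesis using inj_vertex assms(1,2) by (auto dest: inj_onD)
qed

lemma inner_vertex: "i \<in> I0 \<Longrightarrow> i' \<in> I0 \<Longrightarrow> itp bs (vertex i) \<bullet> itp bs (vertex i') = zval (zdot (vertex i) (vertex i')) / 4"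
  by (intro inner_itp onb_bs len_X vertex_X)

lemma norm_vertex: "i \<in> I0 \<Longrightarrow> norm (itp bs (vertex i)) = sqrt (zval z / 4)"
  using inner_vertex[of i i] zdot_X[OF vertex_X] by (simp add: norm_eq_sqrt_inner)

text \<open>The conjugator \<open>w\<close> preserves \<open>V\<close> and carries the orbits of
  \<open>c0 \<circ> c0\<close> to those of \<open>c \<circ> c\<close>, so every admissible rotation
  receives the same labels. As \<open>w\<close> is an isometry, orthogonality can be read from the
  same table.\<close>

lemma cyclic_rays_conj:
  assumes w: "w \<in> refl_grp (set as)" and c: "c \<circ> w = w \<circ> c0" and orth: "orthogonal_transformation c"
  shows "cyclic_rays V (c \<circ> c) (\<lambda>i. w (itp bs (vertex i))) (length Os) N"
proof (unfold_locales, unfold I0_def[symmetric])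
  have wo: "orthogonal_transformation w" using w by (rule refl_grp_orthogonal)
  then have lin: "linear w" and inj: "inj w"
    by (auto intro: orthogonal_transformation_inj orthogonal_transformation_linear)
  show "orthogonal_transformation (c \<circ> c)" using orth by (intro orthogonal_transformation_compose)
  have "V = w ` V" using refl_grp_image[OF w reflection_V] by simp
  also have "\<dots> = (\<lambda>i. w (itp bs (vertex i))) ` I0 \<union> (\<lambda>i. w (itp bs (map uminus (vertex i)))) ` I0"
    by (simp add: V_vertex image_Un image_image itp_uminus)
  finally show "V = (\<lambda>i. w (itp bs (vertex i))) ` I0 \<union> (\<lambda>i. - w (itp bs (vertex i))) ` I0"
    using lin by (simp add: itp_uminus linear_neg)
  show "inj_on (\<lambda>i. span {w (itp bs (vertex i))}) I0"
  proof (rule inj_onI)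
    fix i i' assume i: "i \<in> I0" "i' \<in> I0" "span {w (itp bs (vertex i))} = span {w (itp bs (vertex i'))}"
    have "norm (w x) = norm x" for x using wo by (simp add: orthogonal_transformation_norm)
    then have "w (itp bs (vertex i)) = w (itp bs (vertex i')) \<or> w (itp bs (vertex i)) = - w (itp bs (vertex i'))"
      using span_eq_same_norm[OF i(3)] norm_vertex i(1,2) by simp
    then have "itp bs (vertex i) = itp bs (vertex i') \<or> itp bs (vertex i) = - itp bs (vertex i')"
      unfolding linear_neg[OF lin, symmetric] using inj by (auto dest: injD)
    then show "i = i'" using itp_vertex_eq i(1,2) by blast
  qed
  show "(c \<circ> c) (w (itp bs (vertex i))) = w (itp bs (vertex (shift 1 i)))" if i: "i \<in> I0" for i
  proof -
    have cw: "c (w x) = w (c0 x)" for x using c by (metis comp_apply)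
    show ?thesis using zrot_X[OF vertex_X[OF i]] zrot_vertex[OF i] by (simp add: cw)
  qed
qed (rule coprime_N)+

lemma tab_nth:
  assumes "j < length Os" "j' < length Os" "d < 15"
  shows "tab Os ! j ! j' ! d \<longleftrightarrow> itp bs (vertex (j, 0)) \<bullet> itp bs (vertex (j', d)) = 0"
proof -
  have "Os ! j \<noteq> []" using length_Os_nth[OF assms(1)] by auto
  then have "tab Os ! j ! j' ! d \<longleftrightarrow> zdot (vertex (j, 0)) (vertex (j', d)) = (0, 0)"
    using assms length_Os_nth
    by (simp add: tab_def tab_row_def tab_entry_def orth_vec_def vertex_def hd_conv_nth)
  moreover have "(j, 0) \<in> I0" "(j', d) \<in> I0" using assms by (auto simp: I0_def)
  ultimately show ?thesis by (simp add: inner_vertex zval_eq_0_iff)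
qed

lemma card_fiber:
  assumes "distinct B"
  shows "card {k. (j, k) \<in> set B} = length (filter (\<lambda>i. fst i = j) B)"
proof -
  have "length (filter (\<lambda>i. fst i = j) B) = card (set (filter (\<lambda>i. fst i = j) B))"
    using assms by (metis distinct_card distinct_filter)
  also have "set (filter (\<lambda>i. fst i = j) B) = Pair j ` {k. (j, k) \<in> set B}" by auto
  finally show ?thesis by (simp add: card_image inj_on_def)
qed

lemma distinct_code_orbits: "distinct (concat (map code_orbit L))" "distinct (map code_orbit L)"
proof -
  have len: "length (concat (map code_orbit L)) = 15 * length L"
    by (induction L) (auto simp: code_orbit_def)
  have "length (canon (concat (map code_orbit L))) = 15 * length L" using proofs_ok by (simp add: proofs_ok_def)
  then have "card (set (concat (map code_orbit L))) = length (concat (map code_orbit L))"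
    using len distinct_card[OF distinct_canon] by (metis set_canon)
  then show d: "distinct (concat (map code_orbit L))" by (rule card_distinct)
  \<comment> \<open>A distinct concatenation may have repeated empty parts; these are excluded to
    obtain distinctness of the outer list.\<close>
  have "[] \<notin> set (map code_orbit L)" by (auto simp: code_orbit_def)
  then have "removeAll [] (map code_orbit L) = map code_orbit L" by (rule removeAll_id)
  then show "distinct (map code_orbit L)" using d unfolding distinct_concat_iff by metis
qed

text \<open>Rotations of one another share an entry of their code orbits, so disjointness of these
  separates the members of \<open>L\<close>.\<close>

lemma code_orbit_distinct:
  assumes "B \<in> set L" "B' \<in> set L" "set B = shift t ` set B'"
  shows "B = B'"
proof -
  have inj: "inj_on code_orbit (set L)" using distinct_code_orbits(2) by (simp add: distinct_map)
  have I: "set C \<subseteq> I0" if C: "C \<in> set L" for C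
  proof
    fix i assume "i \<in> set C"
    moreover have "basis_ok (length Os) N (tab Os) C" using C proofs_ok by (auto simp: proofs_ok_def list_all_iff)
    ultimately have "fst i < length Os" "snd i < 15" unfolding basis_ok_def by blast+
    then show "i \<in> I0" by (simp add: I0_def mem_Times_iff)
  qed
  have "shift 0 i = i" if "i \<in> I0" for i using that by (cases i) (simp add: I0_def)
  then have "shift 0 ` set B = set B" using I[OF assms(1)] by (force simp: subset_iff)
  moreover have "shift (t mod 15) ` set B' = shift t ` set B'" by (simp add: shift_mod)
  ultimately have "code_shift B 0 = code_shift B' (t mod 15)"
    using assms(3) by (simp add: code_shift_def code_basis_eq_iff)
  moreover have "code_shift B 0 \<in> set (code_orbit B)" "code_shift B' (t mod 15) \<in> set (code_orbit B')"
    unfolding code_orbit_def by (auto intro!: imageI)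
  ultimately have "set (code_orbit B) \<inter> set (code_orbit B') \<noteq> {}" by auto
  then have "code_orbit B = code_orbit B'"
    using distinct_code_orbits(1) assms(1,2) unfolding distinct_concat_iff by (metis image_eqI list.set_map)
  then show ?thesis using inj assms(1,2) by (auto dest: inj_onD)
qed

theorem count_proofs:
  assumes w: "w \<in> refl_grp (set as)" and c: "c \<circ> w = w \<circ> c0" and orth: "orthogonal_transformation c"
  shows "card (fifteen_basis_proofs N V (c \<circ> c)) = length L"
    "\<forall>S\<in>fifteen_basis_proofs N V (c \<circ> c). \<exists>B\<in>bases N V. S = basis_orbit (c \<circ> c) B"
proof -
  let ?E = "\<lambda>i. w (itp bs (vertex i))" and ?m = "length Os" and ?T = "tab Os"
  interpret C: cyclic_rays V "c \<circ> c" ?E ?m N by (rule cyclic_rays_conj[OF assms])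
  have I: "C.I = I0" by (simp add: C.I_def I0_def)
  have wi: "w x \<bullet> w y = x \<bullet> y" for x y
    using refl_grp_orthogonal[OF w] by (simp add: orthogonal_transformation_def)
  have adj: "tadj ?T i i' \<longleftrightarrow> ?E i \<bullet> ?E i' = 0" if i: "i \<in> I0" "i' \<in> I0" for i i'
  proof -
    obtain j k j' k' where jk: "i = (j, k)" "i' = (j', k')" "j < ?m" "j' < ?m" "k < 15" "k' < 15"
      using i by (auto simp: I0_def)
    define d where "d = (if k \<le> k' then k' - k else k' + 15 - k)"
    have d: "d < 15"
    proof (cases "k \<le> k'")
      case True
      then show ?thesis using jk(6) by (simp add: d_def)
    next
      case False
      then have "d = k' + 15 - k" by (simp add: d_def)
      then show ?thesis using False by arith
    qed
    have "shift k (j, 0) = i" "shift k (j', d) = i'" using jk by (auto simp: d_def)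
    moreover have "(j, 0) \<in> C.I" "(j', d) \<in> C.I" using jk d by (auto simp: C.I_def)
    ultimately have "?E i \<bullet> ?E i' = ?E (j, 0) \<bullet> ?E (j', d)" using C.e_shift_inner by metis
    then show ?thesis using tab_nth[OF jk(3,4) d] jk by (simp add: wi d_def)
  qed
  have nonorth: "\<not> tadj ?T i i" if "i \<in> I0" for i
    using adj[OF that that] inner_vertex[OF that that] zdot_X[OF vertex_X[OF that]] zval_z by (simp add: wi)
  have L_even: "C.even_clique C" if "C \<in> set ` set L" for C
  proof -
    obtain B where B: "B \<in> set L" "C = set B" using \<open>C \<in> set ` set L\<close> by blast
    have ok: "basis_ok ?m N ?T B" using proofs_ok B(1) by (auto simp: proofs_ok_def list_all_iff)
    then have dist: "distinct B" "length B = N" and "\<forall>i\<in>set B. fst i < length Os \<and> snd i < 15"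
      unfolding basis_ok_def by blast+
    then have sub: "set B \<subseteq> I0" by (auto simp: I0_def mem_Times_iff)
    have "pairwise (\<lambda>i i'. ?E i \<bullet> ?E i' = 0) (set B)"
    proof (rule pairwiseI)
      fix i i' assume "i \<in> set B" "i' \<in> set B" "i \<noteq> i'"
      moreover from this have "tadj ?T i i'" using ok by (auto simp: basis_ok_def list_all_iff adj_all_def)
      ultimately show "?E i \<bullet> ?E i' = 0" using adj sub by blast
    qed
    moreover have "even (card {k. (j, k) \<in> set B})" for j
    proof (cases "\<exists>k. (j, k) \<in> set B")
      case True
      then obtain k where "(j, k) \<in> set B" by blast
      then have "even_in B (j, k)" using ok by (auto simp: basis_ok_def list_all_iff)
      then show ?thesis using card_fiber[OF dist(1), of j] by (simp add: even_in_def)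
    qed simp
    ultimately show ?thesis
      using sub dist unfolding C.even_clique_def C.clique_def B(2) I by (simp add: distinct_card)
  qed
  have complete: "\<exists>D\<in>set ` set L. \<exists>t. C = shift t ` D"
    if C: "C.even_clique C" "(j, 0) \<in> C" "\<And>i. i \<in> C \<Longrightarrow> j \<le> fst i" for C j
  proof -
    have CI: "C \<subseteq> I0" "card C = N" "pairwise (\<lambda>i i'. ?E i \<bullet> ?E i' = 0) C"
      and ev: "even (card {k. (j, k) \<in> C})" for j
      using C(1) by (auto simp: C.even_clique_def C.clique_def I)
    have fin: "finite C" using CI(1) finite_I0 finite_subset by blast
    have tadj: "tadj ?T i i'" if "i \<in> C" "i' \<in> C" "i \<noteq> i'" for i i'
    proof -
      have "?E i \<bullet> ?E i' = 0" using CI(3) that unfolding pairwise_def by blast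
      moreover have "i \<in> I0" "i' \<in> I0" using CI(1) that by blast+
      ultimately show ?thesis using adj by blast
    qed
    let ?ys = "concat (map positions [j..<?m])"
    let ?xs = "filter (tadj ?T (j, 0)) ?ys"
    have j: "j < ?m" using C(2) CI(1) by (auto simp: I0_def)
    have ys: "set ?ys = {i \<in> I0. j \<le> fst i}" by (auto simp: positions_def I0_def)
    have "sorted (map fst (concat (map positions [i..<n])))" for i n
    proof (induction n)
      case (Suc n)
      then show ?case
        by (cases "i \<le> n") (auto simp: sorted_append positions_def comp_def map_replicate_const)
    qed simp
    then have sorted: "sorted (map fst ?xs)" by (simp add: sorted_filter)
    have "parity_state None C"
    proof -
      have "card {x \<in> C. fst x = i} = card {k. (i, k) \<in> C}" for i
      proof -
        have "{x \<in> C. fst x = i} = Pair i ` {k. (i, k) \<in> C}" by auto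
        then show ?thesis by (simp add: card_image inj_on_def)
      qed
      then show ?thesis using ev by (simp add: parity_state_def)
    qed
    \<comment> \<open>Removing the single ray \<open>(j, 0)\<close> leaves an odd number in orbit
      \<open>j\<close> only, the initial state of \<open>bases_from\<close>.\<close>
    then have par: "parity_state (Some j) (C - {(j, 0)})" using parity_state_take(1)[OF fin C(2)] by simp
    have "\<exists>ys\<in>set (srch (tadj ?T) (N - 1) (Some j) ?xs). set ys = C - {(j, 0)}"
    proof (rule srch_complete[OF sorted _ _ _ par])
      show "C - {(j, 0)} \<subseteq> set ?xs" using CI(1) C(2,3) tadj[OF C(2)] unfolding set_filter ys by auto
      show "card (C - {(j, 0)}) = N - 1" using CI(2) C(2) fin by simp
      show "pairwise (tadj ?T) (C - {(j, 0)})" using tadj by (auto simp: pairwise_def)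
      show "\<forall>j'. Some j = Some j' \<longrightarrow> (\<forall>x\<in>set ?xs. j' \<le> fst x)" unfolding set_filter ys by auto
    qed
    then obtain ys where ys: "ys \<in> set (srch (tadj ?T) (N - 1) (Some j) ?xs)" "set ys = C - {(j, 0)}" by blast
    have "(j, 0) # ys \<in> set (bases_from ?m N ?T j)" using ys(1) by (auto simp: bases_from_def)
    then have "(j, 0) # ys \<in> set (concat (map (bases_from ?m N ?T) [0..<?m]))" using j by auto
    then have "code_basis ((j, 0) # ys) \<in> set (map code_basis (concat (map (bases_from ?m N ?T) [0..<?m])))"
      by (metis image_eqI list.set_map)
    also have "map code_basis (concat (map (bases_from ?m N ?T) [0..<?m])) = map (cert_basis L) cert"
      using proofs_ok by (simp add: proofs_ok_def)
    finally obtain it where it: "it \<in> set cert" "code_basis ((j, 0) # ys) = cert_basis L it" by auto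
    then have "set ((j, 0) # ys) = shift (snd it) ` set (L ! fst it)"
      by (simp add: cert_basis_def code_shift_def code_basis_eq_iff)
    moreover have "set ((j, 0) # ys) = C" using ys(2) C(2) by auto
    moreover have "L ! fst it \<in> set L" using proofs_ok it(1) by (auto simp: proofs_ok_def)
    ultimately show ?thesis by blast
  qed
  have distinct: "C = D" if "C \<in> set ` set L" "D \<in> set ` set L" "C = shift t ` D" for C D t
    using that code_orbit_distinct by blast
  have "inj_on set (set L)"
  proof (rule inj_onI)
    fix B B' assume B: "B \<in> set L" "B' \<in> set L" "set B = set B'"
    have "set B' \<subseteq> I0" using L_even B(2) by (auto simp: C.even_clique_def C.clique_def I)
    moreover have "shift 0 i = i" if "i \<in> I0" for i using that by (cases i) (simp add: I0_def)
    ultimately have "shift 0 ` set B' = set B'" by (force simp: subset_iff)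
    then show "B = B'" using code_orbit_distinct B by metis
  qed
  moreover have "distinct L" using distinct_code_orbits(2) by (simp add: distinct_map)
  ultimately have "card (set ` set L) = length L" by (simp add: card_image distinct_card)
  then show "card (fifteen_basis_proofs N V (c \<circ> c)) = length L"
    "\<forall>S\<in>fifteen_basis_proofs N V (c \<circ> c). \<exists>B\<in>bases N V. S = basis_orbit (c \<circ> c) B"
    using C.fifteen_basis_proofs_eq[of "set ` set L", OF L_even complete distinct] by auto
qed

theorem fifteenfold_count:
  assumes "X \<noteq> []"
  shows "(\<exists>P g. fifteenfold_rotation V \<Phi> P g) \<and>
    (\<forall>P g. fifteenfold_rotation V \<Phi> P g \<longrightarrow>
      card (fifteen_basis_proofs N V g) = length L \<and>
      (\<forall>S\<in>fifteen_basis_proofs N V g. \<exists>B\<in>bases N V. S = basis_orbit g B))"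
proof -
  have "V \<noteq> {}" using assms by (simp add: V_def sym_set_def)
  moreover have "card (fifteen_basis_proofs N V g) = length L \<and>
      (\<forall>S\<in>fifteen_basis_proofs N V g. \<exists>B\<in>bases N V. S = basis_orbit g B)"
    if rot: "fifteenfold_rotation V \<Phi> P g" for P g
  proof -
    obtain c where c: "coxeter_element \<Phi> c" "g = c \<circ> c"
      using rot unfolding fifteenfold_rotation_def by blast
    obtain w where w: "w \<in> refl_grp (set as)" "c \<circ> w = w \<circ> c0" by (rule coxeter_element_conjugate[OF c(1)])
    have "orthogonal_transformation c"
    proof -
      obtain bs where "c = refl_prod bs" using c(1) by (auto simp: coxeter_element_def refl_prod_def)
      then show ?thesis using refl_grp_orthogonal[OF refl_prod_in_grp[of bs "set bs"]] by simp
    qed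
    then show ?thesis using count_proofs[OF w] c(2) by simp
  qed
  ultimately show ?thesis using V_nonempty by blast
qed

end

section \<open>Vertex lists in golden coordinates\<close>

fun signings :: "(int \<times> int) list \<Rightarrow> int list list" where
  "signings [] = [[]]"
| "signings ((a, b) # xs) =
     (if a = 0 \<and> b = 0 then map (append [0, 0]) (signings xs)
      else map (append [a, b]) (signings xs) @ map (append [- a, - b]) (signings xs))"

definition even_perms :: "'a \<Rightarrow> 'a \<Rightarrow> 'a \<Rightarrow> 'a \<Rightarrow> 'a list list" where
  "even_perms a b c d =
     [[a,b,c,d], [a,c,d,b], [a,d,b,c], [b,a,d,c], [b,c,a,d], [b,d,c,a],
      [c,a,b,d], [c,b,d,a], [c,d,a,b], [d,a,c,b], [d,b,a,c], [d,c,b,a]]"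

definition even_orbit :: "int \<times> int \<Rightarrow> int \<times> int \<Rightarrow> int \<times> int \<Rightarrow> int \<times> int \<Rightarrow> int list list" where
  "even_orbit a b c d = concat (map signings (even_perms a b c d))"

text \<open>Odd permutations are even ones after exchanging \<open>a\<close> and \<open>b\<close>.
  Equal entries make permutations coincide, hence \<open>remdups\<close>.\<close>

definition full_orbit :: "int \<times> int \<Rightarrow> int \<times> int \<Rightarrow> int \<times> int \<Rightarrow> int \<times> int \<Rightarrow> int list list" where
  "full_orbit a b c d = concat (map signings (remdups (even_perms a b c d @ even_perms b a c d)))"

definition list600 :: "int list list" where
  "list600 = full_orbit (2,0) (0,0) (0,0) (0,0) @ full_orbit (1,0) (1,0) (1,0) (1,0) @
     even_orbit (0,1) (1,0) (-1,1) (0,0)"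

text \<open>The pairs are doubled coordinates, with 1/gold = gold - 1, gold^2 = gold + 1, 1/gold^2 =
  2 - gold and sqrt 5 = 2 gold - 1.\<close>

definition list120 :: "int list list" where
  "list120 = full_orbit (4,0) (4,0) (0,0) (0,0) @ full_orbit (-2,4) (2,0) (2,0) (2,0) @
     full_orbit (0,2) (0,2) (0,2) (4,-2) @ full_orbit (2,2) (-2,2) (-2,2) (-2,2) @
     even_orbit (2,0) (2,2) (4,-2) (0,0) @ even_orbit (0,2) (-2,4) (-2,2) (0,0) @
     even_orbit (0,2) (4,0) (2,0) (-2,2)"

definition pair_entry :: "int \<Rightarrow> int \<Rightarrow> nat \<Rightarrow> nat \<Rightarrow> nat \<Rightarrow> int list" where
  "pair_entry s t i j r = [if r = i then s else if r = j then t else 0, 0]"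

definition pair_vec :: "nat \<Rightarrow> nat \<Rightarrow> int \<Rightarrow> int \<Rightarrow> int list" where
  "pair_vec i j s t = concat (map (pair_entry s t i j) [0..<8])"

definition pair_vecs :: "nat \<Rightarrow> nat \<Rightarrow> int list list" where
  "pair_vecs i j = (if i \<ge> j then [] else
     [pair_vec i j 2 2, pair_vec i j 2 (-2), pair_vec i j (-2) 2, pair_vec i j (-2) (-2)])"

definition pair_vecs_from :: "nat \<Rightarrow> int list list" where
  "pair_vecs_from i = concat (map (pair_vecs i) [0..<8])"

text \<open>Counting -1 in the flat list ignores the interleaved golden parts, which are 0.\<close>

definition even_minus :: "int list \<Rightarrow> bool" where
  "even_minus x \<longleftrightarrow> even (length (filter ((=) (-1)) x))"

definition list421 :: "int list list" where
  "list421 = concat (map pair_vecs_from [0..<8]) @ filter even_minus (signings (replicate 8 (1, 0)))"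

section \<open>The vertex sets as lists\<close>

lemma UNIV_8: "(UNIV :: 8 set) = {0, 1, 2, 3, 4, 5, 6, 7}"
proof -
  have "x \<in> {0, 1, 2, 3, 4, 5, 6, 7}" for x :: 8
  proof (induct x)
    case (of_int z)
    then have "z = 0 \<or> z = 1 \<or> z = 2 \<or> z = 3 \<or> z = 4 \<or> z = 5 \<or> z = 6 \<or> z = 7" by fastforce
    then show ?case by auto
  qed
  then show ?thesis by blast
qed

definition half_zval :: "int \<times> int \<Rightarrow> real" where
  "half_zval x = zgold (fst x) (snd x) / 2"

text \<open>\<open>signings\<close> leaves a zero coordinate unsigned to avoid repetitions. For sets
  of vectors this makes no difference, so one formula covers every coordinate.\<close>

lemma itp_signings_Cons:
  "itp (b # bs) ` set (signings (x # xs)) =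
     (\<lambda>(s, v). (s * half_zval x) *\<^sub>R b + v) ` ({- 1, 1} \<times> itp bs ` set (signings xs))"
proof -
  obtain p q where x: "x = (p, q)" by (cases x)
  have "zgold (- p) (- q) = - zgold p q" by (simp add: zgold_def)
  then have "itp (b # bs) ` set (map (append [p, q]) (signings xs) @ map (append [- p, - q]) (signings xs)) =
     (\<lambda>(s, v). (s * half_zval x) *\<^sub>R b + v) ` ({- 1, 1} \<times> itp bs ` set (signings xs))"
    by (force simp: x half_zval_def image_Un image_image)
  moreover have "set (signings (x # xs)) =
      set (map (append [p, q]) (signings xs) @ map (append [- p, - q]) (signings xs))"
    by (simp add: x)
  ultimately show ?thesis by simp
qed

section \<open>The 600-cell and the 120-cell\<close>

definition bs4 :: "(real^4) list" where
  "bs4 = [axis 1 1, axis 2 1, axis 3 1, axis 4 1]"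

definition sign_changes :: "real^4 \<Rightarrow> (real^4) set" where
  "sign_changes w = {(\<chi> i. s i * w $ i) | s. range s \<subseteq> {-1, 1}}"

definition vec4 :: "'a list \<Rightarrow> ('a \<Rightarrow> real) \<Rightarrow> real^4" where
  "vec4 l f = (\<chi> i. if i = 1 then f (l ! 0) else if i = 2 then f (l ! 1) else if i = 3 then f (l ! 2) else f (l ! 3))"

lemma vec4_nth:
  "vec4 [a, b, c, d] f $ 1 = f a" "vec4 [a, b, c, d] f $ 2 = f b"
  "vec4 [a, b, c, d] f $ 3 = f c" "vec4 [a, b, c, d] f $ 4 = f d"
  by (simp_all add: vec4_def)

lemma sign_changes_iff:
  "v \<in> sign_changes w \<longleftrightarrow> (\<forall>i. v $ i = w $ i \<or> v $ i = - w $ i)"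
proof
  assume "v \<in> sign_changes w"
  then obtain s where s: "v = (\<chi> i. s i * w $ i)" "range s \<subseteq> {-1, 1}" by (auto simp: sign_changes_def)
  show "\<forall>i. v $ i = w $ i \<or> v $ i = - w $ i"
  proof
    fix i
    have "s i = -1 \<or> s i = 1" using s(2) by blast
    then show "v $ i = w $ i \<or> v $ i = - w $ i" using s(1) by auto
  qed
next
  assume v: "\<forall>i. v $ i = w $ i \<or> v $ i = - w $ i"
  let ?s = "\<lambda>i. if v $ i = w $ i then 1 else -1"
  have "v = (\<chi> i. ?s i * w $ i)" using v by (auto simp: vec_eq_iff)
  moreover have "range ?s \<subseteq> {-1, 1}" by auto
  ultimately show "v \<in> sign_changes w" unfolding sign_changes_def by (intro CollectI exI[of _ ?s] conjI)
qed

lemma itp_signings4: "itp bs4 ` set (signings [a, b, c, d]) = sign_changes (vec4 [a, b, c, d] half_zval)"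
proof -
  have "v \<in> itp bs4 ` set (signings [a, b, c, d]) \<longleftrightarrow>
      (\<exists>s1\<in>{-1,1}. \<exists>s2\<in>{-1,1}. \<exists>s3\<in>{-1,1}. \<exists>s4\<in>{-1,1}.
        v = (s1 * half_zval a) *\<^sub>R axis 1 1 + ((s2 * half_zval b) *\<^sub>R axis 2 1 +
          ((s3 * half_zval c) *\<^sub>R axis 3 1 + ((s4 * half_zval d) *\<^sub>R axis 4 1 + 0))))" for v
  proof -
    have "itp [] ` set (signings []) = {0 :: real^4}" by simp
    then show ?thesis unfolding bs4_def itp_signings_Cons by (auto simp: image_iff)
  qed
  also have "\<dots> v \<longleftrightarrow> v \<in> sign_changes (vec4 [a, b, c, d] half_zval)" for v
    unfolding sign_changes_iff forall_4 vec4_nth by (simp add: vec_eq_iff forall_4 axis_def) (smt (verit))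
  finally show ?thesis by blast
qed

abbreviation swap4 :: "4 \<Rightarrow> 4 \<Rightarrow> 4 \<Rightarrow> 4" where
  "swap4 \<equiv> Transposition.transpose"

text \<open>Iterating \<open>permutes_insert\<close> writes every permutation as (1 a)(2 b)(3 c),
  which turns a quantifier over permutations into 24 explicit cases.\<close>

lemma perms4:
  "(\<exists>p. p permutes UNIV \<and> P p) \<longleftrightarrow>
    (\<exists>a\<in>{1, 2, 3, 4}. \<exists>b\<in>{2, 3, 4}. \<exists>c\<in>{3, 4}. P (swap4 1 a \<circ> (swap4 2 b \<circ> swap4 3 c)))"
proof -
  have e: "(\<exists>p. p permutes insert a S \<and> P p) \<longleftrightarrow> (\<exists>b\<in>insert a S. \<exists>q. q permutes S \<and> P (swap4 a b \<circ> q))"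
    for a S P
  proof -
    have "p permutes insert a S \<longleftrightarrow> (\<exists>b\<in>insert a S. \<exists>q. q permutes S \<and> p = swap4 a b \<circ> q)" for p
    proof -
      have "p permutes insert a S \<longleftrightarrow> p \<in> {p. p permutes insert a S}" by simp
      also have "\<dots> \<longleftrightarrow> (\<exists>b\<in>insert a S. \<exists>q. q permutes S \<and> p = swap4 a b \<circ> q)"
        unfolding permutes_insert
      proof
        assume "\<exists>b\<in>insert a S. \<exists>q. q permutes S \<and> p = swap4 a b \<circ> q"
        then obtain b q where "b \<in> insert a S" "q permutes S" "p = swap4 a b \<circ> q" by blast
        then show "p \<in> (\<lambda>(b, q). swap4 a b \<circ> q) ` {(b, q). b \<in> insert a S \<and> q \<in> {q. q permutes S}}"
          by (intro image_eqI[of _ _ "(b, q)"]) simp_all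
      next
        assume "p \<in> (\<lambda>(b, q). swap4 a b \<circ> q) ` {(b, q). b \<in> insert a S \<and> q \<in> {q. q permutes S}}"
        then obtain z where z: "p = (case z of (b, q) \<Rightarrow> swap4 a b \<circ> q)"
          "z \<in> {(b, q). b \<in> insert a S \<and> q \<in> {q. q permutes S}}" by (rule imageE)
        have "fst z \<in> insert a S" "snd z permutes S" "p = swap4 a (fst z) \<circ> snd z"
          using z by (auto simp: case_prod_beta mem_Times_iff)
        then show "\<exists>b\<in>insert a S. \<exists>q. q permutes S \<and> p = swap4 a b \<circ> q"
          by (intro bexI[of _ "fst z"] exI[of _ "snd z"] conjI)
      qed
      finally show ?thesis .
    qed
    then show ?thesis by (simp only:) blast
  qed
  have s: "(\<exists>p. p permutes {4} \<and> P p) \<longleftrightarrow> P id" for P :: "(4 \<Rightarrow> 4) \<Rightarrow> bool"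
    unfolding e by (simp add: permutes_empty)
  have "(\<exists>p. p permutes UNIV \<and> P p) \<longleftrightarrow> (\<exists>a\<in>{1, 2, 3, 4}. \<exists>q. q permutes {2, 3, 4} \<and> P (swap4 1 a \<circ> q))"
    unfolding UNIV_4 by (rule e)
  also have "\<dots> \<longleftrightarrow> (\<exists>a\<in>{1, 2, 3, 4}. \<exists>b\<in>{2, 3, 4}. \<exists>q. q permutes {3, 4} \<and> P (swap4 1 a \<circ> (swap4 2 b \<circ> q)))"
    unfolding e[of 2 "{3, 4}"] ..
  also have "\<dots> \<longleftrightarrow> (\<exists>a\<in>{1, 2, 3, 4}. \<exists>b\<in>{2, 3, 4}. \<exists>c\<in>{3, 4}. P (swap4 1 a \<circ> (swap4 2 b \<circ> (swap4 3 c \<circ> id))))"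
    unfolding e[of 3 "{4}"] s ..
  finally show ?thesis by simp
qed

text \<open>A factor is even exactly if its two points coincide, and a nested equivalence of three
  statements holds exactly if an even number of them fail.\<close>

lemma even_transpositions:
  "evenperm (swap4 a b \<circ> (swap4 c d \<circ> swap4 e f)) \<longleftrightarrow> ((a = b) = ((c = d) = (e = f)))"
  by (simp add: evenperm_comp permutation_swap_id permutation_compose evenperm_swap)

lemma transposed_values:
  fixes a b c :: 4
  shows "(\<exists>a\<in>{1, 2, 3, 4}. \<exists>b\<in>{2, 3, 4}. \<exists>c\<in>{3, 4}. Q ((a = 1) = ((b = 2) = (c = 3)))
      (map (swap4 1 a \<circ> (swap4 2 b \<circ> swap4 3 c)) [1, 2, 3, 4])) \<longleftrightarrow>
    (\<exists>l\<in>set (even_perms 1 2 3 4). Q True l) \<or> (\<exists>l\<in>set (even_perms 2 1 3 4). Q False l)"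
  by (simp add: even_perms_def Transposition.transpose_def) argo


lemma signed_perms_eq:
  "signed_perms w = (\<Union>l\<in>set (even_perms 1 2 3 4 @ even_perms 2 1 3 4). sign_changes (vec4 l (($) w)))" (is ?all)
  "even_signed_perms w = (\<Union>l\<in>set (even_perms 1 2 3 4). sign_changes (vec4 l (($) w)))" (is ?even)
proof -
  have ch: "(\<exists>s. v = (\<chi> i. s i * w $ p i) \<and> range s \<subseteq> {-1, 1}) \<longleftrightarrow>
      v \<in> sign_changes (vec4 (map p [1, 2, 3, 4]) (($) w))" for v p
  proof -
    have "vec4 (map p [1, 2, 3, 4]) (($) w) = (\<chi> i. w $ p i)"
      by (simp add: vec_eq_iff forall_4 vec4_nth)
    then show ?thesis unfolding sign_changes_def by auto
  qed
  have "v \<in> signed_perms w \<longleftrightarrow> (\<exists>p. p permutes UNIV \<and> v \<in> sign_changes (vec4 (map p [1, 2, 3, 4]) (($) w)))" for v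
    unfolding signed_perms_def ch[symmetric] by blast
  then show ?all
    unfolding perms4 transposed_values[of "\<lambda>_ l. _ \<in> sign_changes (vec4 l (($) w))"] by auto
  have "v \<in> even_signed_perms w \<longleftrightarrow>
      (\<exists>p. p permutes UNIV \<and> evenperm p \<and> v \<in> sign_changes (vec4 (map p [1, 2, 3, 4]) (($) w)))" for v
    unfolding even_signed_perms_def ch[symmetric] by blast
  then show ?even
    unfolding perms4 even_transpositions eq_commute[of 1] eq_commute[of 2 "_ :: 4"] eq_commute[of 3 "_ :: 4"]
      transposed_values[of "\<lambda>e l. e \<and> _ \<in> sign_changes (vec4 l (($) w))"] by auto
qed

lemma itp_orbit:
  assumes "w = vec4 [a, b, c, d] half_zval"
  shows "itp bs4 ` set (full_orbit a b c d) = signed_perms w" (is ?full)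
    "itp bs4 ` set (even_orbit a b c d) = even_signed_perms w" (is ?even)
proof -
  have w: "w $ 1 = half_zval a" "w $ 2 = half_zval b" "w $ 3 = half_zval c" "w $ 4 = half_zval d"
    unfolding assms vec4_nth by simp_all
  have vec4_eq: "vec4 [i, j, k, l] (($) w) = vec4 [x, y, u, v] half_zval"
    if "w $ i = half_zval x" "w $ j = half_zval y" "w $ k = half_zval u" "w $ l = half_zval v" for i j k l x y u v
    using that by (simp add: vec_eq_iff forall_4 vec4_nth)
  have e: "itp bs4 ` (\<Union> (set ` signings ` set (even_perms a b c d))) =
      (\<Union>l\<in>set (even_perms 1 2 3 4). sign_changes (vec4 l (($) w)))"
    "itp bs4 ` (\<Union> (set ` signings ` set (even_perms b a c d))) =
      (\<Union>l\<in>set (even_perms 2 1 3 4). sign_changes (vec4 l (($) w)))"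
    by (simp_all only: even_perms_def list.set image_insert image_empty Union_insert Union_empty
        image_Un itp_signings4 UN_insert UN_empty vec4_eq w)
  show ?even unfolding signed_perms_eq e[symmetric] by (simp add: even_orbit_def)
  show ?full unfolding signed_perms_eq set_append UN_Un e[symmetric]
    by (simp add: full_orbit_def image_Un)
qed

lemma vec4_vector: "vec4 [a, b, c, d] f = vector [f a, f b, f c, f d]"
  by (simp add: vec_eq_iff forall_4 vec4_nth) (simp add: vector_def)

lemma cell600_eq: "cell600 = itp bs4 ` set list600"
proof -
  have g: "1 / (2 * gold) = half_zval (- 1, 1)"
    using gold_sq gold_pos by (simp add: half_zval_def zgold_def field_simps)
  have v: "vector [1, 0, 0, 0] = vec4 [(2, 0), (0, 0), (0, 0), (0, 0)] half_zval"
    "vector [1/2, 1/2, 1/2, 1/2] = vec4 [(1, 0), (1, 0), (1, 0), (1, 0)] half_zval"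
    "vector [gold/2, 1/2, 1/(2*gold), 0] = vec4 [(0, 1), (1, 0), (- 1, 1), (0, 0)] half_zval"
    unfolding g by (simp_all add: vec4_vector half_zval_def zgold_def)
  show ?thesis
    unfolding cell600_def list600_def set_append image_Un
    unfolding itp_orbit[OF v(1)] itp_orbit[OF v(2)] itp_orbit[OF v(3)] by blast
qed

lemma cell120_eq: "cell120 = itp bs4 ` set list120"
proof -
  have g: "1 / gold = half_zval (- 2, 2)" "gold^2 = half_zval (2, 2)" "1 / gold^2 = half_zval (4, - 2)"
    "sqrt 5 = half_zval (- 2, 4)"
  proof -
    show "1 / gold = half_zval (- 2, 2)"
      using gold_sq gold_pos by (simp add: half_zval_def zgold_def field_simps)
    show sq: "gold^2 = half_zval (2, 2)"
      using gold_sq by (simp add: half_zval_def zgold_def power2_eq_square)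
    have "gold^2 * half_zval (4, - 2) = 1"
      unfolding sq using gold_sq by (simp add: half_zval_def zgold_def algebra_simps)
    then show "1 / gold^2 = half_zval (4, - 2)" by (metis nonzero_eq_divide_eq mult.commute mult_zero_left zero_neq_one)
    show "sqrt 5 = half_zval (- 2, 4)" by (simp add: half_zval_def zgold_def gold_def field_simps)
  qed
  have n: "gold = half_zval (0, 2)" "2 = half_zval (4, 0)" "1 = half_zval (2, 0)" "0 = half_zval (0, 0)"
    by (simp_all add: half_zval_def zgold_def)
  have v: "vector [2, 2, 0, 0] = vec4 [(4, 0), (4, 0), (0, 0), (0, 0)] half_zval"
    "vector [sqrt 5, 1, 1, 1] = vec4 [(- 2, 4), (2, 0), (2, 0), (2, 0)] half_zval"
    "vector [gold, gold, gold, 1/gold^2] = vec4 [(0, 2), (0, 2), (0, 2), (4, - 2)] half_zval"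
    "vector [gold^2, 1/gold, 1/gold, 1/gold] = vec4 [(2, 2), (- 2, 2), (- 2, 2), (- 2, 2)] half_zval"
    "vector [1, gold^2, 1/gold^2, 0] = vec4 [(2, 0), (2, 2), (4, - 2), (0, 0)] half_zval"
    "vector [gold, sqrt 5, 1/gold, 0] = vec4 [(0, 2), (- 2, 4), (- 2, 2), (0, 0)] half_zval"
    "vector [gold, 2, 1, 1/gold] = vec4 [(0, 2), (4, 0), (2, 0), (- 2, 2)] half_zval"
    unfolding g(1,3) unfolding g(2,4) by (simp_all add: vec4_vector n[symmetric])
  show ?thesis
    unfolding cell120_def list120_def set_append image_Un
    unfolding itp_orbit[OF v(1)] itp_orbit[OF v(2)] itp_orbit[OF v(3)] itp_orbit[OF v(4)]
      itp_orbit[OF v(5)] itp_orbit[OF v(6)] itp_orbit[OF v(7)] by blast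
qed

lemma uminus_signed_perms:
  "uminus ` signed_perms w = signed_perms w" "uminus ` even_signed_perms w = even_signed_perms w"
proof -
  have "- v \<in> sign_changes u" if "v \<in> sign_changes u" for u v using that by (auto simp: sign_changes_iff)
  then have s: "uminus ` sign_changes u = sign_changes u" for u by (force intro: image_eqI[of _ uminus "- _"])
  show "uminus ` signed_perms w = signed_perms w" "uminus ` even_signed_perms w = even_signed_perms w"
    by (simp_all only: signed_perms_eq image_UN s)
qed

lemma uminus_cells: "uminus ` cell600 = cell600" "uminus ` cell120 = cell120"
  by (simp_all only: cell600_def cell120_def image_Un uminus_signed_perms)

section \<open>The roots of E8\<close>

definition idx8 :: "8 list" where "idx8 = [0, 1, 2, 3, 4, 5, 6, 7]"
definition bs8 :: "(real^8) list" where "bs8 = map (\<lambda>i. axis i 1) idx8"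

lemma idx8: "distinct idx8" "set idx8 = UNIV" "length idx8 = 8"
proof -
  show "set idx8 = UNIV" unfolding idx8_def UNIV_8 list.set ..
  show "length idx8 = 8" by (simp add: idx8_def)
  then show "distinct idx8" using \<open>set idx8 = UNIV\<close> by (intro card_distinct) simp
qed

lemma idx8_bij: "bij_betw ((!) idx8) {..<8} UNIV"
  using bij_betw_nth[OF idx8(1)] idx8 by simp

lemma itp_integral:
  "length bs = n \<Longrightarrow> itp bs (concat (map (\<lambda>r. [c r, 0]) [0..<n])) = (\<Sum>r<n. (of_int (c r) / 2) *\<^sub>R bs ! r)"
proof (induction bs arbitrary: n c)
  case (Cons b bs)
  then obtain k where k: "n = Suc k" "length bs = k" by auto
  have "map (\<lambda>r. [c r, 0]) [0..<n] = [c 0, 0] # map (\<lambda>r. [c (Suc r), 0]) [0..<k]"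
    unfolding k(1) by (simp add: upt_conv_Cons map_Suc_upt[symmetric] comp_def del: upt_Suc)
  then show ?case
    using Cons.IH[OF k(2), of "\<lambda>r. c (Suc r)"] by (simp add: k(1) sum.lessThan_Suc_shift zgold_def del: sum.lessThan_Suc)
qed simp

lemma itp_bs8_nth:
  assumes "k < 8"
  shows "itp bs8 (concat (map (\<lambda>r. [c r, 0]) [0..<8])) $ (idx8 ! k) = of_int (c k) / 2"
proof -
  have "itp bs8 (concat (map (\<lambda>r. [c r, 0]) [0..<8])) = (\<Sum>r<8. (of_int (c r) / 2) *\<^sub>R axis (idx8 ! r) 1)"
    using itp_integral[of bs8 8 c] idx8 by (simp add: bs8_def)
  then have "itp bs8 (concat (map (\<lambda>r. [c r, 0]) [0..<8])) $ (idx8 ! k) =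
      (\<Sum>r<8. (of_int (c r) / 2) * axis (idx8 ! r) 1 $ (idx8 ! k))" by simp
  also have "\<dots> = (\<Sum>r<8. if r = k then of_int (c k) / 2 else 0)"
    by (rule sum.cong) (use assms idx8 in \<open>auto simp: axis_def nth_eq_iff_index_eq\<close>)
  finally show ?thesis using assms by simp
qed

lemma vec8_eq_iff: "(x :: real^8) = y \<longleftrightarrow> (\<forall>k<8. x $ (idx8 ! k) = y $ (idx8 ! k))"
proof -
  have "\<exists>k<8. i = idx8 ! k" for i using idx8 by (metis UNIV_I in_set_conv_nth)
  then show ?thesis by (metis vec_eq_iff)
qed

lemma itp_pair_vec:
  assumes "i < 8" "j < 8" "i \<noteq> j"
  shows "itp bs8 (pair_vec i j (2 * s) (2 * t)) = of_int s *\<^sub>R axis (idx8 ! i) 1 + of_int t *\<^sub>R axis (idx8 ! j) 1"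
  unfolding vec8_eq_iff pair_vec_def pair_entry_def
  using assms idx8 by (auto simp: itp_bs8_nth axis_def nth_eq_iff_index_eq)

lemma pair_roots:
  "{s *\<^sub>R axis i 1 + t *\<^sub>R axis j 1 | s t i j. s \<in> {-1, 1} \<and> t \<in> {-1, 1} \<and> i \<noteq> j} =
     itp bs8 ` set (concat (map pair_vecs_from [0..<8]))" (is "?A = ?B")
proof
  have mem: "itp bs8 (pair_vec i j (2 * s) (2 * t)) \<in> ?B"
    if "i < j" "j < 8" "s \<in> {-1, 1}" "t \<in> {-1, 1}" for i j s t
    using that by (intro imageI) (force simp: pair_vecs_from_def pair_vecs_def)
  show "?A \<subseteq> ?B"
  proof clarify
    fix s t :: real and i j :: 8 assume st: "s \<in> {-1, 1}" "t \<in> {-1, 1}" "i \<noteq> j"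
    obtain i' j' where ij: "i' < 8" "i = idx8 ! i'" "j' < 8" "j = idx8 ! j'"
      using idx8 by (metis UNIV_I in_set_conv_nth)
    obtain s' t' :: int where st': "s = of_int s'" "s' \<in> {-1, 1}" "t = of_int t'" "t' \<in> {-1, 1}"
    proof
      show "s = of_int (if s = 1 then 1 else -1)" "t = of_int (if t = 1 then 1 else -1)" using st by auto
    qed auto
    have "i' \<noteq> j'" using st(3) ij by auto
    \<comment> \<open>The list has pairs in increasing order only; in the other case the two
      summands are exchanged.\<close>
    then consider "i' < j'" | "j' < i'" by linarith
    then show "s *\<^sub>R axis i 1 + t *\<^sub>R axis j 1 \<in> ?B"
    proof cases
      case 1
      then show ?thesis using mem[of i' j' s' t'] st' ij by (simp add: itp_pair_vec)
    next
      case 2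
      then show ?thesis using mem[of j' i' t' s'] st' ij by (simp add: itp_pair_vec add.commute)
    qed
  qed
  show "?B \<subseteq> ?A"
  proof
    fix x assume "x \<in> ?B"
    then obtain y where y: "y \<in> set (concat (map pair_vecs_from [0..<8]))" "x = itp bs8 y" by blast
    then obtain i where i: "i < 8" "y \<in> set (pair_vecs_from i)" by auto
    then obtain j where j: "j < 8" "y \<in> set (pair_vecs i j)" by (auto simp: pair_vecs_from_def)
    have "i < j" using j(2) by (cases "i \<ge> j") (auto simp: pair_vecs_def)
    note ij = this j y(2)
    then obtain s t :: int where st: "y = pair_vec i j (2 * s) (2 * t)" "s \<in> {-1, 1}" "t \<in> {-1, 1}"
      by (auto simp: pair_vecs_def)
        (metis insertCI mult.right_neutral mult_minus_right)+
    have "x = of_int s *\<^sub>R axis (idx8 ! i) 1 + of_int t *\<^sub>R axis (idx8 ! j) 1"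
      using ij st itp_pair_vec[of i j s t] by simp
    moreover have "idx8 ! i \<noteq> idx8 ! j" using ij idx8 by (simp add: nth_eq_iff_index_eq)
    moreover have "(of_int s :: real) \<in> {-1, 1}" "(of_int t :: real) \<in> {-1, 1}" using st by auto
    ultimately show "x \<in> ?A" by blast
  qed
qed

lemma set_signings_ones:
  "set (signings (replicate n (1, 0))) =
     {concat (map (\<lambda>r. [c r, 0]) [0..<n]) | c. \<forall>r<n. c r = -1 \<or> c r = (1::int)}"
proof (induction n)
  case (Suc n)
  have e: "concat (map (\<lambda>r. [c r, 0]) [0..<Suc n]) = [c 0, 0] @ concat (map (\<lambda>r. [c (Suc r), 0]) [0..<n])"
    for c :: "nat \<Rightarrow> int"
    by (simp add: upt_conv_Cons map_Suc_upt[symmetric] comp_def del: upt_Suc)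
  have s: "set (signings (replicate (Suc n) (1, 0))) = (\<lambda>(s, x). [s, 0] @ x) ` ({-1, 1} \<times> set (signings (replicate n (1, 0))))"
    by (auto simp: image_iff)
  show ?case
  proof (intro subset_antisym subsetI)
    fix x assume "x \<in> set (signings (replicate (Suc n) (1, 0)))"
    then obtain s c where sc: "s = -1 \<or> s = 1" "\<forall>r<n. c r = -1 \<or> c r = (1::int)"
      "x = [s, 0] @ concat (map (\<lambda>r. [c r, 0]) [0..<n])"
      unfolding s Suc by auto
    let ?c = "\<lambda>r. case r of 0 \<Rightarrow> s | Suc k \<Rightarrow> c k"
    have "x = concat (map (\<lambda>r. [?c r, 0]) [0..<Suc n])" unfolding e sc(3) by simp
    moreover have "\<forall>r<Suc n. ?c r = -1 \<or> ?c r = 1" using sc by (auto split: nat.split)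
    ultimately show "x \<in> {concat (map (\<lambda>r. [c r, 0]) [0..<Suc n]) | c. \<forall>r<Suc n. c r = -1 \<or> c r = (1::int)}"
      by blast
  next
    fix x assume "x \<in> {concat (map (\<lambda>r. [c r, 0]) [0..<Suc n]) | c. \<forall>r<Suc n. c r = -1 \<or> c r = (1::int)}"
    then obtain c where c: "x = concat (map (\<lambda>r. [c r, 0]) [0..<Suc n])" "\<forall>r<Suc n. c r = -1 \<or> c r = (1::int)" by blast
    have "concat (map (\<lambda>r. [c (Suc r), 0]) [0..<n]) \<in> set (signings (replicate n (1, 0)))"
      unfolding Suc using c(2) by (intro CollectI exI[of _ "\<lambda>r. c (Suc r)"]) simp
    then show "x \<in> set (signings (replicate (Suc n) (1, 0)))"
      unfolding s c(1) e using c(2) by (force intro: image_eqI[of _ _ "(c 0, _)"])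
  qed
qed simp

lemma even_minus_iff:
  "even_minus (concat (map (\<lambda>r. [c r, 0]) [0..<n])) \<longleftrightarrow> even (card {r. r < n \<and> c r = -1})"
proof -
  have "filter ((=) (-1)) (concat (map (\<lambda>r. [c r, 0]) xs)) = map c (filter (\<lambda>r. c r = -1) xs)" for xs :: "nat list"
    by (induction xs) auto
  moreover have "length (filter (\<lambda>r. c r = -1) [0..<n]) = card {r. r < n \<and> c r = -1}"
    by (subst distinct_card[symmetric]) (auto intro: arg_cong[of _ _ card])
  ultimately show ?thesis by (simp add: even_minus_def)
qed

lemma half_roots:
  "{x :: real^8. (\<forall>i. x $ i \<in> {-1/2, 1/2}) \<and> even (card {i. x $ i = -1/2})} =
     itp bs8 ` set (filter even_minus (signings (replicate 8 (1, 0))))" (is "?A = ?B")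
proof -
  let ?l = "\<lambda>c :: nat \<Rightarrow> int. concat (map (\<lambda>r. [c r, 0]) [0..<8])"
  have all: "(\<forall>i. P i) \<longleftrightarrow> (\<forall>k<8. P (idx8 ! k))" for P
    using idx8 by (metis UNIV_I in_set_conv_nth)
  have card: "card {i. P i} = card {k. k < 8 \<and> P (idx8 ! k)}" for P
  proof -
    have "{i. P i} = (!) idx8 ` {k. k < 8 \<and> P (idx8 ! k)}"
      using idx8_bij by (auto simp: bij_betw_def set_eq_iff image_iff) (metis lessThan_iff rangeI surj_def)
    moreover have "inj_on ((!) idx8) {k. k < 8 \<and> P (idx8 ! k)}"
      using idx8_bij by (auto simp: bij_betw_def intro: inj_on_subset)
    ultimately show ?thesis by (simp add: card_image)
  qed
  have key: "itp bs8 (?l c) \<in> ?A \<longleftrightarrow> even_minus (?l c)" if c: "\<forall>r<8. c r = -1 \<or> c r = 1" for c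
  proof -
    have "itp bs8 (?l c) $ (idx8 ! k) = -1/2 \<longleftrightarrow> c k = -1" if "k < 8" for k
      using itp_bs8_nth[OF that, of c] by auto
    then have "{k. k < 8 \<and> itp bs8 (?l c) $ (idx8 ! k) = -1/2} = {k. k < 8 \<and> c k = -1}" by blast
    moreover have "itp bs8 (?l c) $ (idx8 ! k) \<in> {-1/2, 1/2}" if "k < 8" for k
    proof -
      have "c k = -1 \<or> c k = 1" using c that by blast
      then show ?thesis unfolding itp_bs8_nth[OF that] by auto
    qed
    ultimately show ?thesis unfolding mem_Collect_eq all[of "\<lambda>i. _ $ i \<in> _"] card even_minus_iff by simp
  qed
  show ?thesis
  proof (intro subset_antisym subsetI)
    fix x assume x: "x \<in> ?A"
    define c where "c k = (if x $ (idx8 ! k) = -1/2 then -1 else (1::int))" for k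
    have c: "\<forall>r<8. c r = -1 \<or> c r = 1" by (simp add: c_def)
    have "x = itp bs8 (?l c)"
      using x unfolding vec8_eq_iff by (auto simp: itp_bs8_nth c_def)
    then show "x \<in> ?B" using x key[OF c] c unfolding set_filter set_signings_ones by blast
  next
    fix x assume "x \<in> ?B"
    then obtain c where "\<forall>r<8. c r = -1 \<or> c r = 1" "even_minus (?l c)" "x = itp bs8 (?l c)"
      unfolding set_filter set_signings_ones by blast
    then show "x \<in> ?A" using key by blast
  qed
qed

lemma E8_roots_eq: "E8_roots = itp bs8 ` set list421"
  unfolding E8_roots_def pair_roots half_roots list421_def by (simp only: set_append image_Un)

lemma uminus_E8_roots: "uminus ` E8_roots = E8_roots"
proof -
  have "- x \<in> E8_roots" if "x \<in> E8_roots" for x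
    using that unfolding E8_roots_def
  proof (elim UnE CollectE exE conjE)
    fix s t :: real and i j :: 8
    assume "x = s *\<^sub>R axis i 1 + t *\<^sub>R axis j 1" "s \<in> {-1, 1}" "t \<in> {-1, 1}" "i \<noteq> j"
    then have "- x = (- s) *\<^sub>R axis i 1 + (- t) *\<^sub>R axis j 1" "- s \<in> {-1, 1}" "- t \<in> {-1, 1}" "i \<noteq> j" by auto
    then show "- x \<in> {s *\<^sub>R axis i 1 + t *\<^sub>R axis j 1 | s t i j. s \<in> {-1, 1} \<and> t \<in> {-1, 1} \<and> i \<noteq> j} \<union>
       {x. (\<forall>i. x $ i \<in> {-1/2, 1/2}) \<and> even (card {i. x $ i = -1/2})}" by blast
  next
    assume x: "\<forall>i. x $ i \<in> {-1/2, 1/2}" "even (card {i. x $ i = -1/2})"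
    \<comment> \<open>Negation complements the set of minus signs among 8 places, which keeps its
      size even.\<close>
    have "{i. (- x) $ i = -1/2} = UNIV - {i. x $ i = -1/2}"
    proof (intro set_eqI)
      fix i show "i \<in> {i. (- x) $ i = -1/2} \<longleftrightarrow> i \<in> UNIV - {i. x $ i = -1/2}"
        using x(1)[rule_format, of i] by auto
    qed
    then have "card {i. (- x) $ i = -1/2} = 8 - card {i. x $ i = -1/2}" by (simp add: card_Diff_subset)
    moreover have "card {i. x $ i = -1/2} \<le> 8" using card_mono[of UNIV "{i. x $ i = -1/2}"] by simp
    ultimately have "even (card {i. (- x) $ i = -1/2})" using x(2) by simp
    moreover have "(- x) $ i \<in> {-1/2, 1/2}" for i using x(1)[rule_format, of i] by auto
    ultimately show "- x \<in> {s *\<^sub>R axis i 1 + t *\<^sub>R axis j 1 | s t i j. s \<in> {-1, 1} \<and> t \<in> {-1, 1} \<and> i \<noteq> j} \<union>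
       {x. (\<forall>i. x $ i \<in> {-1/2, 1/2}) \<and> even (card {i. x $ i = -1/2})}" by blast
  qed
  then show ?thesis by (force intro: image_eqI[of _ uminus "- _"])
qed

section \<open>Certificates\<close>

text \<open>Unit vectors listed along the diagram, a path with labels 5, 3, 3, so that each is a
  leaf over the later ones.\<close>

definition simple_H4 :: "int list list" where
  "simple_H4 = [[2, 0, 0, 0, 0, 0, 0, 0], [0, -1, -1, 0, -1, 1, 0, 0], [0, 0, 2, 0, 0, 0, 0, 0],
     [0, 0, -1, 0, 0, -1, -1, 1]]"

text \<open>The fundamental weights: their inner products with the simple roots are 0 or half the
  squared length of a root, so \<open>K = 2\<close>.\<close>

definition dual_H4 :: "int list list" where
  "dual_H4 = [[1, 0, 0, 0, 1, 1, 2, 3], [0, 0, 0, 0, 0, 2, 2, 4], [0, 0, 1, 0, 0, 1, 1, 3], [0,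
     0, 0, 0, 0, 0, 0, 2]]"

text \<open>Bourbaki's simple roots, the second before the first: the two shorter arms of the
  diagram are removed, then the long arm from the branch point outwards.\<close>

definition simple_E8 :: "int list list" where
  "simple_E8 = [[2, 0, 2, 0, 0, 0, 0, 0, 0, 0, 0, 0, 0, 0, 0, 0], [1, 0, -1, 0, -1, 0, -1, 0,
     -1, 0, -1, 0, -1, 0, 1, 0], [-2, 0, 2, 0, 0, 0, 0, 0, 0, 0, 0, 0, 0, 0, 0, 0], [0, 0, -2,
     0, 2, 0, 0, 0, 0, 0, 0, 0, 0, 0, 0, 0], [0, 0, 0, 0, -2, 0, 2, 0, 0, 0, 0, 0, 0, 0, 0, 0],
     [0, 0, 0, 0, 0, 0, -2, 0, 2, 0, 0, 0, 0, 0, 0, 0], [0, 0, 0, 0, 0, 0, 0, 0, -2, 0, 2, 0, 0,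
     0, 0, 0], [0, 0, 0, 0, 0, 0, 0, 0, 0, 0, -2, 0, 2, 0, 0, 0]]"

definition dual_E8 :: "int list list" where
  "dual_E8 = [[1, 0, 1, 0, 1, 0, 1, 0, 1, 0, 1, 0, 1, 0, 5, 0], [0, 0, 0, 0, 0, 0, 0, 0, 0, 0,
     0, 0, 0, 0, 4, 0], [-1, 0, 1, 0, 1, 0, 1, 0, 1, 0, 1, 0, 1, 0, 7, 0], [0, 0, 0, 0, 2, 0, 2,
     0, 2, 0, 2, 0, 2, 0, 10, 0], [0, 0, 0, 0, 0, 0, 2, 0, 2, 0, 2, 0, 2, 0, 8, 0], [0, 0, 0, 0,
     0, 0, 0, 0, 2, 0, 2, 0, 2, 0, 6, 0], [0, 0, 0, 0, 0, 0, 0, 0, 0, 0, 2, 0, 2, 0, 4, 0], [0,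
     0, 0, 0, 0, 0, 0, 0, 0, 0, 0, 0, 2, 0, 2, 0]]"

text \<open>One vertex for each of the 60 / 15 = 4 orbits of rays.\<close>

definition reps600 :: "int list list" where
  "reps600 = [[2, 0, 0, 0, 0, 0, 0, 0], [0, 0, 2, 0, 0, 0, 0, 0], [0, 0, 0, 0, 2, 0, 0, 0], [0,
     0, 0, 0, 0, 0, 2, 0]]"

text \<open>In dimension 4 the quartic relation holds for any vector by Cayley-Hamilton. The entries
  are constrained by exact divisions and by the condition that the image under the Coxeter element
  is orthogonal to no vertex.\<close>

definition vec600 :: "int list" where
  "vec600 = [1, -3, 1, 0, 6, 0, 0, 1]"

definition proofs600 :: "(nat \<times> nat) list list" where
  "proofs600 = [[(0, 0), (0, 2), (2, 3), (2, 11)], [(1, 0), (1, 1), (3, 9), (3, 13)]]"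

definition cert600 :: "(nat \<times> nat) list" where
  "cert600 = [(0, 0), (0, 13), (1, 0), (1, 14)]"

definition reps120 :: "int list list" where
  "reps120 = [[4, 0, 4, 0, 0, 0, 0, 0], [4, 0, 0, 0, 4, 0, 0, 0], [4, 0, 0, 0, 0, 0, 4, 0], [0,
     0, 4, 0, 0, 0, -4, 0], [4, 0, 2, 0, 0, 2, 2, -2], [4, 0, 2, 0, 0, 2, -2, 2], [4, 0, 2, 0,
     0, -2, 2, -2], [4, 0, 2, 0, 0, -2, -2, 2], [4, 0, 2, -2, 2, 0, 0, 2], [4, 0, 2, -2, 2, 0,
     0, -2], [4, 0, 2, -2, -2, 0, 0, 2], [4, 0, 2, -2, -2, 0, 0, -2], [4, 0, 0, 2, 2, -2, 2, 0],
     [4, 0, 0, 2, 2, -2, -2, 0], [4, 0, 0, 2, -2, 2, 2, 0], [4, 0, 0, 2, -2, 2, -2, 0], [4, 0,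
     0, -2, 2, -2, -2, 0], [4, 0, 0, -2, -2, 2, 2, 0], [2, 2, 2, 0, 0, 0, -4, 2], [2, 2, 0, 0,
     4, -2, -2, 0]]"

definition vec120 :: "int list" where
  "vec120 = [-3, -1, 0, -1, 3, 8, 0, 0]"

definition proofs120 :: "(nat \<times> nat) list list" where
  "proofs120 = [[(0, 0), (0, 1), (1, 2), (1, 13)], [(2, 0), (2, 2), (3, 4), (3, 11)], [(4, 0),
     (4, 2), (18, 5), (18, 13)], [(8, 0), (8, 4), (12, 1), (12, 2)]]"

definition cert120 :: "(nat \<times> nat) list" where
  "cert120 = [(0, 0), (0, 14), (1, 0), (1, 13), (2, 0), (2, 13), (3, 0), (3, 11)]"

definition reps421 :: "int list list" where
  "reps421 = [[2, 0, 2, 0, 0, 0, 0, 0, 0, 0, 0, 0, 0, 0, 0, 0], [2, 0, 0, 0, 2, 0, 0, 0, 0, 0,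
     0, 0, 0, 0, 0, 0], [2, 0, 0, 0, 0, 0, 2, 0, 0, 0, 0, 0, 0, 0, 0, 0], [2, 0, 0, 0, 0, 0, 0,
     0, 0, 0, 0, 0, 0, 0, 2, 0], [2, 0, 0, 0, 0, 0, 0, 0, 0, 0, 0, 0, -2, 0, 0, 0], [0, 0, 2, 0,
     0, 0, 0, 0, 0, 0, 0, 0, 0, 0, 2, 0], [0, 0, 2, 0, 0, 0, 0, 0, -2, 0, 0, 0, 0, 0, 0, 0], [0,
     0, 2, 0, 0, 0, -2, 0, 0, 0, 0, 0, 0, 0, 0, 0]]"

text \<open>In dimension 8 the quartic relation confines the vector to the invariant subspace with
  eigenvalue angles of 12 and 132 degrees up to sign. This subspace is four-dimensional and defined
  over the golden field, not over the rationals.\<close>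

definition vec421 :: "int list" where
  "vec421 = [-1, 0, -1, 4, 5, 0, 7, -2, 1, 2, -3, 2, 1, -2, 3, 8]"

definition proofs421 :: "(nat \<times> nat) list list" where
  "proofs421 = [[(0, 0), (0, 2), (1, 9), (1, 12), (5, 9), (5, 12), (7, 3), (7, 10)], [(0, 0),
     (0, 2), (1, 11), (1, 12), (5, 8), (5, 12), (7, 6), (7, 13)], [(0, 0), (0, 2), (1, 11), (1,
     14), (5, 8), (5, 11), (7, 1), (7, 9)], [(0, 0), (0, 2), (3, 12), (3, 14), (4, 5), (4, 13),
     (7, 6), (7, 13)], [(0, 0), (0, 6), (1, 2), (1, 3), (5, 8), (5, 12), (7, 4), (7, 13)], [(0,
     0), (0, 6), (1, 9), (1, 10), (5, 1), (5, 12), (7, 4), (7, 10)], [(0, 0), (0, 6), (3, 2),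
     (3, 13), (4, 3), (4, 4), (7, 1), (7, 7)], [(0, 0), (0, 6), (4, 2), (4, 3), (4, 4), (4, 5),
     (6, 7), (6, 8)], [(1, 0), (1, 1), (2, 6), (2, 7), (5, 1), (5, 12), (6, 0), (6, 4)], [(1,
     0), (1, 3), (2, 1), (2, 14), (5, 6), (5, 9), (6, 7), (6, 14)], [(1, 0), (1, 3), (3, 7), (3,
     14), (6, 0), (6, 6), (6, 7), (6, 14)], [(2, 0), (2, 1), (3, 10), (3, 12), (4, 3), (4, 11),
     (6, 9), (6, 13)], [(2, 0), (2, 2), (2, 4), (2, 6), (4, 1), (4, 3), (5, 9), (5, 12)], [(2,
     0), (2, 4), (3, 3), (3, 7), (3, 11), (3, 14), (7, 6), (7, 12)], [(2, 0), (2, 4), (3, 11),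
     (3, 14), (4, 7), (4, 10), (6, 12), (6, 13)], [(2, 0), (2, 6), (3, 2), (3, 10), (4, 1), (4,
     3), (6, 3), (6, 9)]]"

text \<open>The 16 bases are found 34 times: 15 of them have two rays in their least orbit, and one
  has four.\<close>

definition cert421 :: "(nat \<times> nat) list" where
  "cert421 = [(0, 0), (1, 0), (2, 0), (3, 0), (4, 0), (5, 0), (6, 0), (7, 0), (5, 9), (4, 9),
     (6, 9), (7, 9), (0, 13), (1, 13), (2, 13), (3, 13), (8, 0), (9, 0), (10, 0), (9, 12), (10,
     12), (8, 14), (11, 0), (12, 0), (12, 13), (12, 11), (13, 0), (14, 0), (15, 0), (12, 9),
     (15, 9), (13, 11), (14, 11), (11, 14)]"

lemma geometry_ok_600:
  "geometry_ok 4 2 2 (4, 0) simple_H4 dual_H4 vec600 (canon (map posn list600)) (canon (map posn list600))"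
  by code_simp

lemma counting_ok_600:
  "counting_ok 4 proofs600 cert600 2 simple_H4 (canon (map posn list600)) (orbits 2 simple_H4 reps600)"
  by code_simp

lemma geometry_ok_120:
  "geometry_ok 4 2 2 (32, 0) simple_H4 dual_H4 vec120 (canon (map posn list600)) (canon (map posn list120))"
  by code_simp

lemma counting_ok_120:
  "counting_ok 4 proofs120 cert120 2 simple_H4 (canon (map posn list120)) (orbits 2 simple_H4 reps120)"
  by code_simp

lemma geometry_ok_421:
  "geometry_ok 8 4 4 (8, 0) simple_E8 dual_E8 vec421 (canon (map posn list421)) (canon (map posn list421))"
  by code_simp

lemma counting_ok_421:
  "counting_ok 8 proofs421 cert421 4 simple_E8 (canon (map posn list421)) (orbits 4 simple_E8 reps421)"
  by code_simp

lemma itp_sym_set_posn: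
  assumes "uminus ` C = C" "C = itp bs ` set raw"
  shows "itp bs ` sym_set (canon (map posn raw)) = C"
proof
  have "itp bs (posn x) \<in> C" if "x \<in> set raw" for x
    using that assms by (auto simp: posn_def itp_uminus)
  then show "itp bs ` sym_set (canon (map posn raw)) \<subseteq> C"
    using assms(1) by (auto simp: sym_set_def itp_uminus)
  show "C \<subseteq> itp bs ` sym_set (canon (map posn raw))"
    unfolding assms(2) by (intro image_mono subsetI sym_set_posn) simp
qed

lemma canon_nonempty: "xs \<noteq> [] \<Longrightarrow> canon (map f xs) \<noteq> []"
  by (metis list.map_disc_iff set_canon set_empty)

lemma onb_bs4: "onb bs4" "length bs4 = 4"
  by (simp_all add: bs4_def inner_axis_axis)

lemma onb_axes: "distinct xs \<Longrightarrow> onb (map (\<lambda>i. axis i (1::real)) xs)"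
  by (induction xs) (auto simp: inner_axis_axis)

lemma onb_bs8: "onb bs8" "length bs8 = 8"
  using idx8 onb_axes by (simp_all add: bs8_def)

lemma coprime_15: "coprime 4 (15::nat)" "coprime 8 (15::nat)"
  by code_simp+

lemma fifteenfold_600:
  "(\<exists>P g. fifteenfold_rotation cell600 H4_roots P g) \<and>
    (\<forall>P g. fifteenfold_rotation cell600 H4_roots P g \<longrightarrow>
      card (fifteen_basis_proofs 4 cell600 g) = 2 \<and>
      (\<forall>S\<in>fifteen_basis_proofs 4 cell600 g. \<exists>B\<in>bases 4 cell600. S = basis_orbit g B))"
proof -
  \<comment> \<open>Four times the squared circumradius 1, because list entries are doubled
    coordinates.\<close>
  interpret golden_model bs4 2 2 "(4, 0)" simple_H4 dual_H4
    "canon (map posn list600)" "canon (map posn list600)" reps600 vec600 4 proofs600 cert600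
  proof
    show "geometry_ok (length bs4) 2 2 (4, 0) simple_H4 dual_H4 vec600
        (canon (map posn list600)) (canon (map posn list600))"
      unfolding onb_bs4(2) by (rule geometry_ok_600)
  qed (simp_all add: onb_bs4 distinct_canon counting_ok_600 coprime_15)
  have "V = cell600" unfolding V_def using uminus_cells(1) cell600_eq by (rule itp_sym_set_posn)
  moreover have "\<Phi> = H4_roots" unfolding \<Phi>_def H4_roots_def using uminus_cells(1) cell600_eq by (rule itp_sym_set_posn)
  moreover have "canon (map posn list600) \<noteq> []" by (rule canon_nonempty) code_simp
  ultimately show ?thesis using fifteenfold_count by (simp add: proofs600_def)
qed

text \<open>The roots remain those given by the 600-cell, whose symmetry group the 120-cell shares;
  its squared circumradius 8 gives \<open>(32, 0)\<close>.\<close>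

lemma fifteenfold_120:
  "(\<exists>P g. fifteenfold_rotation cell120 H4_roots P g) \<and>
    (\<forall>P g. fifteenfold_rotation cell120 H4_roots P g \<longrightarrow>
      card (fifteen_basis_proofs 4 cell120 g) = 4 \<and>
      (\<forall>S\<in>fifteen_basis_proofs 4 cell120 g. \<exists>B\<in>bases 4 cell120. S = basis_orbit g B))"
proof -
  interpret golden_model bs4 2 2 "(32, 0)" simple_H4 dual_H4
    "canon (map posn list600)" "canon (map posn list120)" reps120 vec120 4 proofs120 cert120
  proof
    show "geometry_ok (length bs4) 2 2 (32, 0) simple_H4 dual_H4 vec120
        (canon (map posn list600)) (canon (map posn list120))"
      unfolding onb_bs4(2) by (rule geometry_ok_120)
  qed (simp_all add: onb_bs4 distinct_canon counting_ok_120 coprime_15)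
  have "V = cell120" unfolding V_def using uminus_cells(2) cell120_eq by (rule itp_sym_set_posn)
  moreover have "\<Phi> = H4_roots" unfolding \<Phi>_def H4_roots_def using uminus_cells(1) cell600_eq by (rule itp_sym_set_posn)
  moreover have "canon (map posn list120) \<noteq> []" by (rule canon_nonempty) code_simp
  ultimately show ?thesis using fifteenfold_count by (simp add: proofs120_def)
qed

lemma fifteenfold_421:
  "(\<exists>P g. fifteenfold_rotation gosset421 E8_roots P g) \<and>
    (\<forall>P g. fifteenfold_rotation gosset421 E8_roots P g \<longrightarrow>
      card (fifteen_basis_proofs 8 gosset421 g) = 16 \<and>
      (\<forall>S\<in>fifteen_basis_proofs 8 gosset421 g. \<exists>B\<in>bases 8 gosset421. S = basis_orbit g B))"
proof -
  interpret golden_model bs8 4 4 "(8, 0)" simple_E8 dual_E8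
    "canon (map posn list421)" "canon (map posn list421)" reps421 vec421 8 proofs421 cert421
  proof
    show "geometry_ok (length bs8) 4 4 (8, 0) simple_E8 dual_E8 vec421
        (canon (map posn list421)) (canon (map posn list421))"
      unfolding onb_bs8(2) by (rule geometry_ok_421)
  qed (simp_all add: onb_bs8 distinct_canon counting_ok_421 coprime_15)
  have "V = gosset421" unfolding V_def gosset421_def using uminus_E8_roots E8_roots_eq by (rule itp_sym_set_posn)
  moreover have "\<Phi> = E8_roots" unfolding \<Phi>_def  using uminus_E8_roots E8_roots_eq by (rule itp_sym_set_posn)
  moreover have "canon (map posn list421) \<noteq> []" by (rule canon_nonempty) code_simp
  ultimately show ?thesis using fifteenfold_count by (simp add: proofs421_def)
qed

theorem mainTheorem2:
  shows
    "((\<exists>P g. fifteenfold_rotation cell600 H4_roots P g) \<and>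
      (\<forall>P g. fifteenfold_rotation cell600 H4_roots P g \<longrightarrow>
         card (fifteen_basis_proofs 4 cell600 g) = 2 \<and>
         (\<forall>S\<in>fifteen_basis_proofs 4 cell600 g. \<exists>B\<in>bases 4 cell600. S = basis_orbit g B))) \<and>
     ((\<exists>P g. fifteenfold_rotation cell120 H4_roots P g) \<and>
      (\<forall>P g. fifteenfold_rotation cell120 H4_roots P g \<longrightarrow>
         card (fifteen_basis_proofs 4 cell120 g) = 4 \<and>
         (\<forall>S\<in>fifteen_basis_proofs 4 cell120 g. \<exists>B\<in>bases 4 cell120. S = basis_orbit g B))) \<and>
     ((\<exists>P g. fifteenfold_rotation gosset421 E8_roots P g) \<and>
      (\<forall>P g. fifteenfold_rotation gosset421 E8_roots P g \<longrightarrow>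
         card (fifteen_basis_proofs 8 gosset421 g) = 16 \<and>
         (\<forall>S\<in>fifteen_basis_proofs 8 gosset421 g. \<exists>B\<in>bases 8 gosset421. S = basis_orbit g B)))"
  by (rule conjI[OF fifteenfold_600 conjI[OF fifteenfold_120 fifteenfold_421]])

end
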